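(* Let $d\ge 2$ and let $G$ be a connected simple graph embedded in $\mathbb{H}^d$ such that its edges are geodesic segments, its sets of vertices and edges are locally finite, and it is transitive under isometries. Let $p_0=p_0(G)$ be the threshold defined in the context. Then for every $p$ with $0\le p<p_0$, almost surely every cluster in $p$-Bernoulli bond percolation on $G$ has only one-point boundaries of ends, i.e. almost surely, for every cluster $C$ and every end $e$ of $C$, the boundary $\partial e$ consists of exactly one point.
   Context: Graph. Local finiteness means that every compact subset of $\mathbb{H}^d$ meets only finitely many vertices and edges of the embedded graph. "Transitive under isometries" means that some group of isometries of $\mathbb{H}^d$ acts on $G$ by graph automorphisms, transitively on the vertex set $V(G)$. A vertex $o$ of $G$ is fixed once and for all. Percolation. $p$-Bernoulli bond percolation on $G$ is the random subgraph $\omega$ with vertex set $V(G)$ in which each edge of $G$ is kept (open) independently with probability $p$; $\mathrm{P}_p$ is its law. Clusters are the connected components of $\omega$, viewed as subsets of $\mathbb{H}^d$ (unions of their vertices and edges). $C(v)$ is the cluster of the vertex $v$. Boundaries and ends. Let $\widehat{\mathbb{H}}^d$ be the compactification of $\mathbb{H}^d$ by its set of points at infinity $\partial\mathbb{H}^d=\widehat{\mathbb{H}}^d\setminus\mathbb{H}^d$ (the boundary sphere in the Poincaré disc model). For $C\subseteq\mathbb{H}^d$, put $\partial C=\overline{C}\setminus\mathbb{H}^d$, the closure being taken in $\widehat{\mathbb{H}}^d$. An end of $C\subseteq\mathbb{H}^d$ is a function $e$ from the family of all compact subsets of $\mathbb{H}^d$ to the family of subsets of $C$ such that for every compact $K$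 the set $e(K)$ is one of the connected components of $C\setminus K$, and $e(K)\supseteq e(K')$ whenever $K\subseteq K'$ are compact. The boundary of an end $e$ is $\partial e=\bigcap_{K\subseteq\mathbb{H}^d\text{ compact}}\partial e(K)$. Threshold. $\mathcal{N}(G)=\{p\in[0,1]: \mathrm{P}_p(x\in\partial C(o))=0\text{ for all }x\in\partial\mathbb{H}^d\}$ and $p_0(G)=\sup\mathcal{N}(G)$. *)

theory Defs
  imports "HOL-Probability.Probability" "HOL-Algebra.Bij"
begin

text \<open>
  Hyperbolic space of dimension \<open>d = DIM('a)\<close> is the open unit ball of the Euclidean space \<open>'a\<close>
  (Poincare ball model).
  The hyperbolic metric induces the Euclidean subspace topology on it, and its compactification by
  points at infinity is the closed unit ball. Hence compactness, connectedness and closure below are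
  the library's Euclidean notions, and the boundary at infinity is the unit sphere.
\<close>

definition hyp :: "'a::euclidean_space set" where
  "hyp = ball 0 1"

definition hyp_boundary :: "'a::euclidean_space set" where
  "hyp_boundary = sphere 0 1"

definition hdist :: "'a::euclidean_space \<Rightarrow> 'a \<Rightarrow> real" where
  "hdist x y = arcosh (1 + 2 * (norm (x - y))\<^sup>2 / ((1 - (norm x)\<^sup>2) * (1 - (norm y)\<^sup>2)))"

definition hyp_geodesic :: "(real \<Rightarrow> 'a::euclidean_space) \<Rightarrow> 'a \<Rightarrow> 'a \<Rightarrow> bool" where
  "hyp_geodesic g u v \<longleftrightarrow>
     g 0 = u \<and> g (hdist u v) = v \<and> g ` {0..hdist u v} \<subseteq> hyp \<and>
     (\<forall>s\<in>{0..hdist u v}. \<forall>t\<in>{0..hdist u v}. hdist (g s) (g t) = \<bar>s - t\<bar>)"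

text \<open>Geodesics of hyperbolic space are unique, so this union is a single segment.\<close>

definition hyp_segment :: "'a::euclidean_space \<Rightarrow> 'a \<Rightarrow> 'a set" where
  "hyp_segment u v = \<Union>{g ` {0..hdist u v} | g. hyp_geodesic g u v}"

definition hyp_isometry :: "('a::euclidean_space \<Rightarrow> 'a) \<Rightarrow> bool" where
  "hyp_isometry f \<longleftrightarrow>
     bij_betw f hyp hyp \<and> (\<forall>x\<in>hyp. \<forall>y\<in>hyp. hdist (f x) (f y) = hdist x y)"

text \<open>
  A simple graph has a vertex set \<open>V\<close> of points and a set \<open>E\<close> of unordered pairs \<open>{u, v}\<close> of distinct
  vertices; the pair \<open>{u, v}\<close> is drawn as the geodesic segment from \<open>u\<close> to \<open>v\<close>.
\<close>

definition edge_segment :: "'a::euclidean_space set \<Rightarrow> 'a set" where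
  "edge_segment e = \<Union>{hyp_segment u v | u v. e = {u, v}}"

text \<open>Being embedded means that drawn edges meet other edges and vertices only in their endpoints.\<close>

definition embedded_simple_graph :: "'a::euclidean_space set \<Rightarrow> 'a set set \<Rightarrow> bool" where
  "embedded_simple_graph V E \<longleftrightarrow>
     V \<subseteq> hyp \<and>
     E \<subseteq> {{u, v} | u v. u \<in> V \<and> v \<in> V \<and> u \<noteq> v} \<and>
     (\<forall>e\<in>E. edge_segment e \<inter> V = e) \<and>
     (\<forall>e\<in>E. \<forall>f\<in>E. e \<noteq> f \<longrightarrow> edge_segment e \<inter> edge_segment f = e \<inter> f)"

definition locally_finite_graph :: "'a::euclidean_space set \<Rightarrow> 'a set set \<Rightarrow> bool" where
  "locally_finite_graph V E \<longleftrightarrow>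
     (\<forall>K. compact K \<and> K \<subseteq> hyp \<longrightarrow>
        finite (V \<inter> K) \<and> finite {e \<in> E. edge_segment e \<inter> K \<noteq> {}})"

definition joined :: "'a set set \<Rightarrow> 'a \<Rightarrow> 'a \<Rightarrow> bool" where
  "joined E = (\<lambda>u v. {u, v} \<in> E)\<^sup>*\<^sup>*"

definition connected_graph :: "'a set \<Rightarrow> 'a set set \<Rightarrow> bool" where
  "connected_graph V E \<longleftrightarrow> (\<forall>u\<in>V. \<forall>v\<in>V. joined E u v)"

definition graph_automorphism :: "'a set \<Rightarrow> 'a set set \<Rightarrow> ('a \<Rightarrow> 'a) \<Rightarrow> bool" where
  "graph_automorphism V E f \<longleftrightarrow>
     bij_betw f V V \<and> (\<forall>u\<in>V. \<forall>v\<in>V. {f u, f v} \<in> E \<longleftrightarrow> {u, v} \<in> E)"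

definition transitive_under_isometries :: "'a::euclidean_space set \<Rightarrow> 'a set set \<Rightarrow> bool" where
  "transitive_under_isometries V E \<longleftrightarrow>
     (\<exists>\<Gamma>. subgroup \<Gamma> (BijGroup hyp) \<and>
        (\<forall>f\<in>\<Gamma>. hyp_isometry f \<and> graph_automorphism V E f) \<and>
        (\<forall>u\<in>V. \<forall>v\<in>V. \<exists>f\<in>\<Gamma>. f u = v))"

text \<open>In a configuration \<open>\<omega>\<close>, the edge \<open>e\<close> is open iff \<open>\<omega> e\<close> holds.\<close>

definition percolation :: "'a set set \<Rightarrow> real \<Rightarrow> ('a set \<Rightarrow> bool) measure" where
  "percolation E p = (\<Pi>\<^sub>M e\<in>E. measure_pmf (bernoulli_pmf p))"

definition open_edges :: "'a set set \<Rightarrow> ('a set \<Rightarrow> bool) \<Rightarrow> 'a set set" where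
  "open_edges E \<omega> = {e \<in> E. \<omega> e}"

definition cluster_vertices :: "'a set set \<Rightarrow> ('a set \<Rightarrow> bool) \<Rightarrow> 'a \<Rightarrow> 'a set" where
  "cluster_vertices E \<omega> v = {u. joined (open_edges E \<omega>) v u}"

definition cluster ::
    "'a::euclidean_space set set \<Rightarrow> ('a set \<Rightarrow> bool) \<Rightarrow> 'a \<Rightarrow> 'a set" where
  "cluster E \<omega> v =
     cluster_vertices E \<omega> v \<union>
     \<Union>(edge_segment ` {e \<in> open_edges E \<omega>. e \<subseteq> cluster_vertices E \<omega> v})"

definition boundary_at_infinity :: "'a::euclidean_space set \<Rightarrow> 'a set" where
  "boundary_at_infinity C = closure C - hyp"

text \<open>Only the values of \<open>e\<close> at compact subsets of hyperbolic space are relevant.\<close>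

definition is_end :: "'a::euclidean_space set \<Rightarrow> ('a set \<Rightarrow> 'a set) \<Rightarrow> bool" where
  "is_end C e \<longleftrightarrow>
     (\<forall>K. compact K \<and> K \<subseteq> hyp \<longrightarrow> e K \<in> components (C - K)) \<and>
     (\<forall>K K'. compact K \<and> compact K' \<and> K \<subseteq> K' \<and> K' \<subseteq> hyp \<longrightarrow> e K' \<subseteq> e K)"

definition end_boundary :: "('a::euclidean_space set \<Rightarrow> 'a set) \<Rightarrow> 'a set" where
  "end_boundary e = (\<Inter>K\<in>{K. compact K \<and> K \<subseteq> hyp}. boundary_at_infinity (e K))"

text \<open>
  Probability zero is expressed by \<open>null_sets\<close>, since \<open>measure\<close> is also zero on non-measurable sets.
  For locally finite graphs the events in question are measurable.
\<close>

definition null_boundary_params :: "'a::euclidean_space set set \<Rightarrow> 'a \<Rightarrow> real set" where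
  "null_boundary_params E v =
     {p \<in> {0..1}. \<forall>x\<in>hyp_boundary.
        {\<omega> \<in> space (percolation E p). x \<in> boundary_at_infinity (cluster E \<omega> v)}
          \<in> null_sets (percolation E p)}"

definition p\<^sub>0 :: "'a::euclidean_space set set \<Rightarrow> 'a \<Rightarrow> real" where
  "p\<^sub>0 E v = Sup (null_boundary_params E v)"

end

theory Submission
  imports Defs "HOL-Complex_Analysis.Great_Picard" "HOL-Real_Asymp.Real_Asymp"
begin

text \<open>
  Fix \<open>p < p' < p\<^sub>0\<close> and a point \<open>x\<close> at infinity. Since \<open>x\<close> is almost surely not in the boundary of the
  cluster of \<open>v\<^sub>0\<close> at \<open>p'\<close>, the differential inequality of Duminil-Copin and Tassion yields sets \<open>S\<close> of
  vertices, avoiding a neighbourhood of \<open>x\<close>, such that the expected number of boundary edges of \<open>S\<close>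
  reached from \<open>v\<^sub>0\<close> inside \<open>S\<close> is at most \<open>1/2\<close> at \<open>p\<close>. By compactness the neighbourhood can be
  chosen uniformly in \<open>x\<close>.

  For a vertex \<open>w\<close> at small Euclidean distance \<open>h\<close> from the sphere, transport by an isometry taking
  \<open>v\<^sub>0\<close> to \<open>w\<close> the set obtained for an \<open>x\<close> close to the preimage of the centre of the ball: its
  image lies within Euclidean distance \<open>O(h)\<close> of \<open>w\<close>. A path from \<open>w\<close> that stays as close to the
  sphere as \<open>w\<close> and covers Euclidean distance \<open>\<delta>\<close> must leave about \<open>\<delta>/h\<close> such sets in
  succession, which has probability exponentially small in \<open>\<delta>/h\<close>. There are polynomially many
  vertices at distance \<open>h\<close>, so by Borel-Cantelli almost surely only finitely many \<open>w\<close> start such a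
  path. An end with two boundary points at distance \<open>4 \<delta>\<close> would give, outside every compact
  ball, an open path covering distance \<open>2 \<delta>\<close>, and the innermost vertex of this path would
  be such a \<open>w\<close>.
\<close>

section \<open>Percolation on finite graphs\<close>

text \<open>The sets \<open>S\<close> only have to avoid a neighbourhood of \<open>x\<close>, so
  they may be infinite and approach other points at infinity. Every estimate is therefore made
  inside a finite vertex set \<open>A\<close>, with \<open>S\<close> contained in \<open>A\<close>
  and chosen after \<open>A\<close>, and with constants independent of \<open>A\<close>; monotone
  limits then give the infinite graph. On a finite edge set the expectation \<open>bern_exp\<close>
  is a polynomial in \<open>p\<close>, so the differential inequality concerns derivatives of
  polynomials. The gap between \<open>p\<close> and \<open>p'\<close> serves the mean value theorem:
  if all exit sums exceeded \<open>1/2\<close> at \<open>p\<close>, the probability of coming near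
  \<open>x\<close> would grow too fast to be small at \<open>p'\<close>. Successive exits can be
  iterated only at a common scale. The bound on exit sets gets worse towards the centre, so a path
  must stay at least as far out as its start. Reading an arbitrary path from its innermost vertex,
  in both directions, brings it into this form.\<close>

definition bern_exp :: "'b set \<Rightarrow> real \<Rightarrow> ('b set \<Rightarrow> real) \<Rightarrow> real" where
  "bern_exp F p g = (\<Sum>\<omega>\<in>Pow F. p ^ card \<omega> * (1 - p) ^ card (F - \<omega>) * g \<omega>)"

lemma bern_exp_empty [simp]: "bern_exp {} p g = g {}"
  by (simp add: bern_exp_def)

lemma bern_exp_insert:
  assumes "finite F" "a \<notin> F"
  shows "bern_exp (insert a F) p g = p * bern_exp F p (\<lambda>\<omega>. g (insert a \<omega>)) + (1 - p) * bern_exp F p g"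
proof -
  have fin: "finite \<omega>" and na: "a \<notin> \<omega>" if "\<omega> \<in> Pow F" for \<omega>
    using that assms finite_subset by auto
  have inj: "inj_on (insert a) (Pow F)"
    using assms(2) by (auto simp: inj_on_def)
  have "bern_exp (insert a F) p g =
      (\<Sum>\<omega>\<in>Pow F. p ^ card \<omega> * (1 - p) ^ card (insert a F - \<omega>) * g \<omega>) +
      (\<Sum>\<omega>\<in>insert a ` Pow F. p ^ card \<omega> * (1 - p) ^ card (insert a F - \<omega>) * g \<omega>)"
    unfolding bern_exp_def Pow_insert using assms
    by (intro sum.union_disjoint) auto
  also have "(\<Sum>\<omega>\<in>Pow F. p ^ card \<omega> * (1 - p) ^ card (insert a F - \<omega>) * g \<omega>) = (1 - p) * bern_exp F p g"
    unfolding bern_exp_def sum_distrib_left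
  proof (rule sum.cong)
    fix \<omega> assume w: "\<omega> \<in> Pow F"
    have "insert a F - \<omega> = insert a (F - \<omega>)" using na[OF w] by auto
    then have "card (insert a F - \<omega>) = Suc (card (F - \<omega>))" using assms by simp
    then show "p ^ card \<omega> * (1 - p) ^ card (insert a F - \<omega>) * g \<omega> =
      (1 - p) * (p ^ card \<omega> * (1 - p) ^ card (F - \<omega>) * g \<omega>)" by simp
  qed simp
  also have "(\<Sum>\<omega>\<in>insert a ` Pow F. p ^ card \<omega> * (1 - p) ^ card (insert a F - \<omega>) * g \<omega>) =
      p * bern_exp F p (\<lambda>\<omega>. g (insert a \<omega>))"
    unfolding bern_exp_def sum_distrib_left sum.reindex[OF inj] o_def
  proof (rule sum.cong)
    fix \<omega> assume w: "\<omega> \<in> Pow F"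
    have "insert a F - insert a \<omega> = F - \<omega>" using assms by auto
    then show "p ^ card (insert a \<omega>) * (1 - p) ^ card (insert a F - insert a \<omega>) * g (insert a \<omega>) =
      p * (p ^ card \<omega> * (1 - p) ^ card (F - \<omega>) * g (insert a \<omega>))"
      using fin[OF w] na[OF w] by simp
  qed simp
  finally show ?thesis by simp
qed

lemma bern_exp_cong: "F = F' \<Longrightarrow> (\<And>\<omega>. \<omega> \<subseteq> F \<Longrightarrow> g \<omega> = h \<omega>) \<Longrightarrow> bern_exp F p g = bern_exp F' p h"
  unfolding bern_exp_def by (intro sum.cong) auto

lemma bern_exp_const: "finite F \<Longrightarrow> bern_exp F p (\<lambda>_. c) = c"
  by (induction F rule: finite_induct) (auto simp: bern_exp_insert algebra_simps)

lemma bern_exp_mono: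
  assumes "0 \<le> p" "p \<le> 1" "\<And>\<omega>. \<omega> \<subseteq> F \<Longrightarrow> g \<omega> \<le> h \<omega>"
  shows "bern_exp F p g \<le> bern_exp F p h"
  unfolding bern_exp_def using assms by (intro sum_mono mult_left_mono) auto

lemma bern_exp_nonneg:
  assumes "0 \<le> p" "p \<le> 1" "\<And>\<omega>. \<omega> \<subseteq> F \<Longrightarrow> 0 \<le> g \<omega>"
  shows "0 \<le> bern_exp F p g"
  unfolding bern_exp_def using assms by (intro sum_nonneg mult_nonneg_nonneg) auto

lemma bern_exp_sum: "bern_exp F p (\<lambda>\<omega>. \<Sum>i\<in>I. g i \<omega>) = (\<Sum>i\<in>I. bern_exp F p (g i))"
  unfolding bern_exp_def sum_distrib_left by (rule sum.swap)

lemma bern_exp_cmult: "bern_exp F p (\<lambda>\<omega>. c * g \<omega>) = c * bern_exp F p g"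
  unfolding bern_exp_def sum_distrib_left by (intro sum.cong) auto

lemma bern_exp_diff: "bern_exp F p (\<lambda>\<omega>. g \<omega> - h \<omega>) = bern_exp F p g - bern_exp F p h"
  unfolding bern_exp_def by (simp add: algebra_simps sum_subtractf)

lemma bern_exp_Un:
  assumes "finite F1" "finite F2" "F1 \<inter> F2 = {}"
  shows "bern_exp (F1 \<union> F2) p g = bern_exp F1 p (\<lambda>\<omega>1. bern_exp F2 p (\<lambda>\<omega>2. g (\<omega>1 \<union> \<omega>2)))"
  using assms
proof (induction F1 arbitrary: g rule: finite_induct)
  case (insert a F)
  then have "a \<notin> F \<union> F2" "finite (F \<union> F2)" by auto
  then show ?case using insert by (simp add: bern_exp_insert)
qed simp

lemma bern_exp_indep:
  assumes "finite F1" "finite F2" "F1 \<inter> F2 = {}"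
    and "\<And>\<omega>. \<omega> \<subseteq> F1 \<union> F2 \<Longrightarrow> g (\<omega> \<inter> F1) = g \<omega>" "\<And>\<omega>. \<omega> \<subseteq> F1 \<union> F2 \<Longrightarrow> h (\<omega> \<inter> F2) = h \<omega>"
  shows "bern_exp (F1 \<union> F2) p (\<lambda>\<omega>. g \<omega> * h \<omega>) = bern_exp F1 p g * bern_exp F2 p h"
proof -
  have "bern_exp (F1 \<union> F2) p (\<lambda>\<omega>. g \<omega> * h \<omega>) =
     bern_exp F1 p (\<lambda>\<omega>1. bern_exp F2 p (\<lambda>\<omega>2. g (\<omega>1 \<union> \<omega>2) * h (\<omega>1 \<union> \<omega>2)))"
    by (rule bern_exp_Un[OF assms(1-3)])
  also have "\<dots> = bern_exp F1 p (\<lambda>\<omega>1. bern_exp F2 p (\<lambda>\<omega>2. g \<omega>1 * h \<omega>2))"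
  proof (intro bern_exp_cong refl)
    fix \<omega>1 \<omega>2 assume *: "\<omega>1 \<subseteq> F1" "\<omega>2 \<subseteq> F2"
    then have "(\<omega>1 \<union> \<omega>2) \<inter> F1 = \<omega>1" "(\<omega>1 \<union> \<omega>2) \<inter> F2 = \<omega>2" using assms(3) by auto
    moreover have "\<omega>1 \<union> \<omega>2 \<subseteq> F1 \<union> F2" using * by auto
    note assms(4)[OF this] assms(5)[OF this]
    ultimately have "g (\<omega>1 \<union> \<omega>2) = g \<omega>1" "h (\<omega>1 \<union> \<omega>2) = h \<omega>2"
      by simp_all
    then show "g (\<omega>1 \<union> \<omega>2) * h (\<omega>1 \<union> \<omega>2) = g \<omega>1 * h \<omega>2" by simp
  qed
  also have "\<dots> = bern_exp F1 p (\<lambda>\<omega>1. bern_exp F2 p h * g \<omega>1)"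
    by (simp only: bern_exp_cmult mult.commute[of "bern_exp F2 p h"])
  also have "\<dots> = bern_exp F1 p g * bern_exp F2 p h"
    unfolding bern_exp_cmult by (rule mult.commute)
  finally show ?thesis .
qed

lemma bern_exp_restrict:
  assumes "finite F" "F' \<subseteq> F" "\<And>\<omega>. \<omega> \<subseteq> F \<Longrightarrow> g (\<omega> \<inter> F') = g \<omega>"
  shows "bern_exp F p g = bern_exp F' p g"
proof -
  have *: "F' \<union> (F - F') = F" using assms by auto
  have "bern_exp (F' \<union> (F - F')) p (\<lambda>\<omega>. g \<omega> * 1) = bern_exp F' p g * bern_exp (F - F') p (\<lambda>_. 1)"
    using assms by (intro bern_exp_indep) (auto intro: finite_subset simp: *)
  then show ?thesis using assms * by (simp add: bern_exp_const)
qed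

lemma bern_exp_image:
  assumes "finite F" "inj_on f F"
  shows "bern_exp (f ` F) p g = bern_exp F p (\<lambda>\<omega>. g (f ` \<omega>))"
  using assms
proof (induction F arbitrary: g rule: finite_induct)
  case (insert a F)
  then have "f a \<notin> f ` F" "finite (f ` F)" by auto
  then show ?case using insert by (simp add: bern_exp_insert)
qed simp

text \<open>Russo's formula, for arbitrary \<open>g\<close>. Conditioning on the new edge
  \<open>a\<close> gives \<open>p\<close> times one polynomial plus \<open>1 - p\<close> times
  another; the product rule yields the influence of \<open>a\<close>, and the induction hypothesis
  for both polynomials yields the influences of the other edges.\<close>

lemma bern_exp_deriv:
  assumes "finite F"
  shows "((\<lambda>p. bern_exp F p g) has_real_derivative
           (\<Sum>e\<in>F. bern_exp (F - {e}) p (\<lambda>\<omega>. g (insert e \<omega>) - g \<omega>))) (at p)"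
  using assms
proof (induction F arbitrary: g rule: finite_induct)
  case (insert a F)
  let ?g' = "\<lambda>\<omega>. g (insert a \<omega>)"
  let ?D = "\<lambda>g. \<Sum>e\<in>F. bern_exp (F - {e}) p (\<lambda>\<omega>. g (insert e \<omega>) - g \<omega>)"
  have *: "bern_exp (insert a F - {e}) p (\<lambda>\<omega>. g (insert e \<omega>) - g \<omega>) =
     p * bern_exp (F - {e}) p (\<lambda>\<omega>. ?g' (insert e \<omega>) - ?g' \<omega>) +
     (1 - p) * bern_exp (F - {e}) p (\<lambda>\<omega>. g (insert e \<omega>) - g \<omega>)" if "e \<in> F" for e
  proof -
    have "insert a F - {e} = insert a (F - {e})" "a \<notin> F - {e}" using insert that by auto
    then show ?thesis using insert by (simp add: bern_exp_insert insert_commute)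
  qed
  have "((\<lambda>p. p * bern_exp F p ?g' + (1 - p) * bern_exp F p g) has_real_derivative
     (bern_exp F p ?g' - bern_exp F p g + (p * ?D ?g' + (1 - p) * ?D g))) (at p)"
    by (rule derivative_eq_intros insert.IH refl | simp)+
  moreover have "bern_exp F p ?g' - bern_exp F p g + (p * ?D ?g' + (1 - p) * ?D g) =
     (\<Sum>e\<in>insert a F. bern_exp (insert a F - {e}) p (\<lambda>\<omega>. g (insert e \<omega>) - g \<omega>))"
  proof -
    have "insert a F - {a} = F" using insert(2) by auto
    moreover have "(\<Sum>e\<in>F. bern_exp (insert a F - {e}) p (\<lambda>\<omega>. g (insert e \<omega>) - g \<omega>)) =
       p * ?D ?g' + (1 - p) * ?D g"
      unfolding sum_distrib_left sum.distrib[symmetric] by (intro sum.cong refl *)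
    ultimately show ?thesis
      by (subst sum.insert[OF insert(1,2)]) (simp only: bern_exp_diff)
  qed
  ultimately show ?case using insert(1,2) by (simp add: bern_exp_insert)
qed simp

lemma bern_exp_mono_param:
  assumes "finite F" "0 \<le> p" "p \<le> q" "q \<le> 1" "\<And>\<omega> e. e \<in> F \<Longrightarrow> \<omega> \<subseteq> F \<Longrightarrow> g \<omega> \<le> g (insert e \<omega>)"
  shows "bern_exp F p g \<le> bern_exp F q g"
proof (rule DERIV_nonneg_imp_nondecreasing[OF assms(3)])
  fix x assume "p \<le> x" "x \<le> q"
  then have "0 \<le> (\<Sum>e\<in>F. bern_exp (F - {e}) x (\<lambda>\<omega>. g (insert e \<omega>) - g \<omega>))"
    using assms by (intro sum_nonneg bern_exp_nonneg) auto
  then show "\<exists>y. ((\<lambda>p. bern_exp F p g) has_real_derivative y) (at x) \<and> y \<ge> 0"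
    using bern_exp_deriv[OF assms(1)] by blast
qed

section \<open>Open paths, induced edge sets and exit sums\<close>

lemma joined_mono: "joined A u v \<Longrightarrow> A \<subseteq> B \<Longrightarrow> joined B u v"
  unfolding joined_def by (erule rtranclp_mono[THEN predicate2D, rotated]) auto

lemma joined_refl [simp]: "joined A u u"
  by (simp add: joined_def)

lemma joined_trans: "joined A u v \<Longrightarrow> joined A v w \<Longrightarrow> joined A u w"
  unfolding joined_def by (rule rtranclp_trans)

lemma joined_edge: "{u, v} \<in> A \<Longrightarrow> joined A u v"
  unfolding joined_def by blast

lemma joined_sym: "joined A u v \<Longrightarrow> joined A v u"
  unfolding joined_def
  by (rule sympD[OF symp_rtranclp]) (auto simp: symp_def insert_commute)

lemma joined_induct [consumes 1, case_names refl step]: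
  assumes "joined A u v" "P u" "\<And>y z. joined A u y \<Longrightarrow> {y, z} \<in> A \<Longrightarrow> P y \<Longrightarrow> P z"
  shows "P v"
  using assms unfolding joined_def by (rule rtranclp_induct) auto

definition induced :: "'v set set \<Rightarrow> 'v set \<Rightarrow> 'v set set" where
  "induced E A = {e \<in> E. e \<subseteq> A}"

lemma finite_induced: "finite A \<Longrightarrow> finite (induced E A)"
  by (rule finite_subset[of _ "Pow A"]) (auto simp: induced_def)

lemma induced_mono: "A \<subseteq> B \<Longrightarrow> induced E A \<subseteq> induced E B"
  by (auto simp: induced_def)

definition exit_pairs :: "'v set set \<Rightarrow> 'v set \<Rightarrow> 'v set \<Rightarrow> ('v \<times> 'v) set" where
  "exit_pairs E A S = {(y, z). y \<in> S \<and> z \<in> A - S \<and> {y, z} \<in> E}"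

text \<open>This is the functional of Duminil-Copin and Tassion for the set \<open>S\<close>,
  without its factor \<open>p\<close>: pivotal boundary edges are counted while closed, and a path
  that leaves \<open>S\<close> is bounded with the state of the crossing edge ignored.\<close>

definition exit_sum :: "'v set set \<Rightarrow> 'v set \<Rightarrow> 'v set \<Rightarrow> real \<Rightarrow> 'v \<Rightarrow> real" where
  "exit_sum E A S p w =
    (\<Sum>(y, z)\<in>exit_pairs E A S. bern_exp (induced E S) p (\<lambda>\<omega>. of_bool (joined \<omega> w y)))"

definition reach_prob :: "'v set set \<Rightarrow> 'v set \<Rightarrow> real \<Rightarrow> 'v \<Rightarrow> 'v set \<Rightarrow> real" where
  "reach_prob E A p w T = bern_exp (induced E A) p (\<lambda>\<omega>. of_bool (\<exists>t\<in>T. joined \<omega> w t))"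

lemma finite_exit_pairs: "finite A \<Longrightarrow> S \<subseteq> A \<Longrightarrow> finite (exit_pairs E A S)"
  by (rule finite_subset[of _ "A \<times> A"]) (auto simp: exit_pairs_def)

section \<open>The differential inequality of Duminil-Copin and Tassion\<close>

definition unreached :: "'v set \<Rightarrow> 'v set \<Rightarrow> 'v set set \<Rightarrow> 'v set" where
  "unreached A T \<omega> = {z \<in> A. \<forall>t\<in>T. \<not> joined \<omega> z t}"

lemma unreached_iff: "z \<in> unreached A T \<omega> \<longleftrightarrow> z \<in> A \<and> (\<forall>t\<in>T. \<not> joined \<omega> z t)"
  by (simp add: unreached_def)

text \<open>The set not connected to \<open>T\<close> is found by exploring from \<open>T\<close>.
  If it equals \<open>S\<close>, the exploration examines only edges with an endpoint outside
  \<open>S\<close>, so erasing the edges inside \<open>S\<close> neither creates nor destroys this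
  event. Hence the event is independent of the connections inside \<open>S\<close>.\<close>

lemma unreached_local:
  assumes "\<omega> \<subseteq> induced E A" "T \<subseteq> A"
  shows "unreached A T (\<omega> - induced E S) = S \<longleftrightarrow> unreached A T \<omega> = S"
proof
  define \<omega>' where "\<omega>' = \<omega> - induced E S"
  have jm: "joined \<omega> y z" if "joined \<omega>' y z" for y z
    using that by (rule joined_mono) (simp add: \<omega>'_def)
  have sub: "unreached A T \<omega> \<subseteq> unreached A T \<omega>'"
    unfolding subset_iff unreached_iff using jm by blast
  have edge: "{y, z} \<in> \<omega>'" if "{y, z} \<in> \<omega>" "y \<notin> S" for y z
    using that by (auto simp: \<omega>'_def induced_def)
  {
    assume "unreached A T (\<omega> - induced E S) = S"
    then have L: "z \<in> S \<longleftrightarrow> z \<in> A \<and> (\<forall>t\<in>T. \<not> joined \<omega>' z t)" for z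
      unfolding \<omega>'_def[symmetric] by (metis unreached_iff)
    have no: "z \<notin> S" if "joined \<omega> t z" "t \<in> T" for t z
      using that
    proof (induction rule: joined_induct)
      case refl
      then show ?case using L[of t] joined_refl[of \<omega>' t] by blast
    next
      case (step y z)
      then have "y \<notin> S" by simp
      moreover have "y \<in> A" using step(2) assms(1) by (auto simp: induced_def)
      ultimately obtain t' where t': "t' \<in> T" "joined \<omega>' y t'"
        using L[of y] by blast
      have "joined \<omega>' z y" by (rule joined_sym[OF joined_edge[OF edge]]) fact+
      from joined_trans[OF this t'(2)] show ?case using L[of z] t'(1) by blast
    qed
    have "unreached A T \<omega>' \<subseteq> unreached A T \<omega>"
    proof
      fix z assume z: "z \<in> unreached A T \<omega>'"
      then have "z \<in> S" using L[of z] unfolding unreached_iff by simp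
      then have "\<not> joined \<omega> z t" if "t \<in> T" for t
        using no[OF joined_sym] that by blast
      then show "z \<in> unreached A T \<omega>" using z by (simp add: unreached_iff)
    qed
    then have "unreached A T \<omega> = unreached A T \<omega>'" using sub by simp
    also have "\<dots> = S" unfolding \<omega>'_def by fact
    finally show "unreached A T \<omega> = S" .
  }
  {
    assume L: "unreached A T \<omega> = S"
    have j: "joined \<omega>' t z" if "joined \<omega> t z" "t \<in> T" for t z
      using that
    proof (induction rule: joined_induct)
      case (step y z)
      have "joined \<omega> y t" by (rule joined_sym) fact
      then have "y \<notin> S" unfolding L[symmetric] unreached_iff using step by blast
      from joined_edge[OF edge[OF step(2) this]] step show ?case using joined_trans by metis
    qed simp
    have "unreached A T \<omega>' \<subseteq> unreached A T \<omega>"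
    proof
      fix z assume z: "z \<in> unreached A T \<omega>'"
      have "\<not> joined \<omega> z t" if "t \<in> T" for t
        using joined_sym[OF j[OF joined_sym]] z that unfolding unreached_iff by blast
      then show "z \<in> unreached A T \<omega>" using z by (simp add: unreached_iff)
    qed
    then have "unreached A T \<omega>' = unreached A T \<omega>" using sub by simp
    also note L
    finally show "unreached A T (\<omega> - induced E S) = S" unfolding \<omega>'_def .
  }
qed

text \<open>The outer endpoint of a boundary edge of \<open>S\<close> reaches \<open>T\<close>. Such
  an edge is closed, since otherwise its inner endpoint would reach \<open>T\<close> as well; if the
  inner endpoint is joined to \<open>w\<close> within \<open>S\<close>, opening the edge connects
  \<open>w\<close> with \<open>T\<close>.\<close>

lemma pivotal_count:
  assumes "finite A" "\<omega> \<subseteq> induced E A" "T \<subseteq> A" "w \<in> unreached A T \<omega>"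
  defines "S \<equiv> unreached A T \<omega>"
  shows "(\<Sum>(y, z)\<in>exit_pairs E A S. of_bool (joined (\<omega> \<inter> induced E S) w y)) \<le>
    (\<Sum>e\<in>induced E A. of_bool (e \<notin> \<omega> \<and> \<not> (\<exists>t\<in>T. joined \<omega> w t) \<and> (\<exists>t\<in>T. joined (insert e \<omega>) w t)) :: real)"
proof -
  let ?B = "{(y, z) \<in> exit_pairs E A S. joined (\<omega> \<inter> induced E S) w y}"
  let ?f = "\<lambda>(y, z). {y, z}"
  let ?C = "{e \<in> induced E A. e \<notin> \<omega> \<and> \<not> (\<exists>t\<in>T. joined \<omega> w t) \<and> (\<exists>t\<in>T. joined (insert e \<omega>) w t)}"
  have SA: "S \<subseteq> A" by (auto simp: S_def unreached_def)
  note fin = finite_exit_pairs[OF assms(1) SA, of E] finite_induced[OF assms(1), of E]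
  have "(\<Sum>(y, z)\<in>exit_pairs E A S. of_bool (joined (\<omega> \<inter> induced E S) w y)) = real (card ?B)"
  proof -
    have "(\<Sum>(y, z)\<in>exit_pairs E A S. of_bool (joined (\<omega> \<inter> induced E S) w y)) =
      (\<Sum>x\<in>exit_pairs E A S. if joined (\<omega> \<inter> induced E S) w (fst x) then 1 else 0 :: real)"
      by (intro sum.cong) auto
    also have "\<dots> = (\<Sum>x\<in>?B. 1)"
      by (subst sum.inter_filter[symmetric, OF fin(1)]) (intro sum.cong; auto)
    finally show ?thesis by simp
  qed
  \<comment> \<open>The unordered edge determines the pair, since exactly one endpoint lies in
    \<open>S\<close>.\<close>
  also have "card ?B = card (?f ` ?B)"
  proof (intro card_image[symmetric] inj_onI, clarify)
    fix a b c d assume "(a, b) \<in> exit_pairs E A S" "(c, d) \<in> exit_pairs E A S" "{a, b} = {c, d}"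
    then show "a = c \<and> b = d" by (auto simp: exit_pairs_def doubleton_eq_iff)
  qed
  also have "card (?f ` ?B) \<le> card ?C"
  proof (rule card_mono)
    show "finite ?C" using fin by auto
    show "?f ` ?B \<subseteq> ?C"
    proof clarify
      fix y z assume yz: "(y, z) \<in> exit_pairs E A S" and j: "joined (\<omega> \<inter> induced E S) w y"
      have y: "y \<in> S" and z: "z \<in> A" "z \<notin> S" and e: "{y, z} \<in> E"
        using yz by (auto simp: exit_pairs_def)
      obtain t where t: "t \<in> T" "joined \<omega> z t" using z by (auto simp: S_def unreached_def)
      have w: "\<not> (\<exists>t\<in>T. joined \<omega> w t)" using assms(4) by (auto simp: unreached_def)
      have "{y, z} \<notin> \<omega>"
      proof
        assume "{y, z} \<in> \<omega>"
        then have "joined \<omega> y t" using t joined_edge joined_trans by metis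
        then show False using y t by (auto simp: S_def unreached_def)
      qed
      moreover have "joined (insert {y, z} \<omega>) w t"
      proof -
        have "joined (insert {y, z} \<omega>) w y" using j by (rule joined_mono) auto
        moreover have "joined (insert {y, z} \<omega>) y z" by (rule joined_edge) auto
        moreover have "joined (insert {y, z} \<omega>) z t" using t(2) by (rule joined_mono) auto
        ultimately show ?thesis using joined_trans by metis
      qed
      ultimately show "{y, z} \<in> induced E A \<and> {y, z} \<notin> \<omega> \<and> \<not> (\<exists>t\<in>T. joined \<omega> w t) \<and>
          (\<exists>t\<in>T. joined (insert {y, z} \<omega>) w t)"
        using w t y z e SA by (auto simp: induced_def)
    qed
  qed
  also have "real (card ?C) = (\<Sum>e\<in>induced E A. of_bool (e \<notin> \<omega> \<and> \<not> (\<exists>t\<in>T. joined \<omega> w t) \<and> (\<exists>t\<in>T. joined (insert e \<omega>) w t)))"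
    using fin by (simp add: of_bool_def Collect_conj_eq sum.If_cases)
  finally show ?thesis by simp
qed

lemma reach_prob_le_1:
  assumes "finite A" "0 \<le> p" "p \<le> 1" shows "reach_prob E A p w T \<le> 1"
proof -
  have "reach_prob E A p w T \<le> bern_exp (induced E A) p (\<lambda>_. 1)"
    unfolding reach_prob_def using assms by (intro bern_exp_mono) auto
  then show ?thesis using assms by (simp add: bern_exp_const finite_induced)
qed

lemma reach_prob_nonneg:
  assumes "0 \<le> p" "p \<le> 1" shows "0 \<le> reach_prob E A p w T"
  unfolding reach_prob_def using assms by (intro bern_exp_nonneg) auto

text \<open>By Russo's formula the right-hand side is the derivative of
  \<open>reach_prob E A q w T\<close> in \<open>q\<close>. When \<open>w\<close> does not reach
  \<open>T\<close>, the unreached set is a random \<open>S\<close> containing \<open>w\<close>, and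
  given its value at least \<open>exit_sum E A S q w\<close> closed pivotal edges are
  expected.\<close>

lemma reach_prob_deriv_ge:
  assumes "finite A" "T \<subseteq> A" "w \<in> A" "0 \<le> q" "q \<le> 1" "0 \<le> c"
    and c: "\<And>S. w \<in> S \<Longrightarrow> S \<subseteq> A - T \<Longrightarrow> c \<le> exit_sum E A S q w"
  defines "g \<equiv> \<lambda>\<omega>. of_bool (\<exists>t\<in>T. joined \<omega> w t) :: real"
  shows "c * (1 - reach_prob E A q w T) \<le>
    (\<Sum>e\<in>induced E A. bern_exp (induced E A - {e}) q (\<lambda>\<omega>. g (insert e \<omega>) - g \<omega>))"
proof -
  let ?F = "induced E A"
  let ?SS = "{S. w \<in> S \<and> S \<subseteq> A - T}"
  let ?piv = "\<lambda>e \<omega>. of_bool (e \<notin> \<omega> \<and> \<not> (\<exists>t\<in>T. joined \<omega> w t) \<and> (\<exists>t\<in>T. joined (insert e \<omega>) w t)) :: real"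
  let ?in = "\<lambda>S \<omega> y. of_bool (joined (\<omega> \<inter> induced E S) w y) :: real"
  have finF: "finite ?F" by (rule finite_induced) fact
  have finSS: "finite ?SS" by (rule finite_subset[of _ "Pow A"]) (use assms in auto)
  have unr: "w \<in> unreached A T \<omega> \<longleftrightarrow> \<not> (\<exists>t\<in>T. joined \<omega> w t)" "unreached A T \<omega> \<subseteq> A - T" for \<omega>
    unfolding subset_iff Diff_iff unreached_iff using assms(3) joined_refl[of \<omega>] by blast+
  \<comment> \<open>The indicator vanishes when \<open>e\<close> is open, so its expectation is
    \<open>1 - q\<close> times an expectation over the other edges; this factor is bounded by
    \<open>1\<close>.\<close>
  have *: "bern_exp ?F q (?piv e) \<le> bern_exp (?F - {e}) q (\<lambda>\<omega>. g (insert e \<omega>) - g \<omega>)" if "e \<in> ?F" for e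
  proof -
    have "bern_exp (insert e (?F - {e})) q (?piv e) =
       q * bern_exp (?F - {e}) q (\<lambda>_. 0) + (1 - q) * bern_exp (?F - {e}) q (?piv e)"
      using finF by (subst bern_exp_insert) auto
    also have "\<dots> \<le> bern_exp (?F - {e}) q (?piv e)"
      using assms finF bern_exp_nonneg[of q "?F - {e}" "?piv e"]
      by (simp add: bern_exp_const mult_left_le_one_le)
    also have "\<dots> \<le> bern_exp (?F - {e}) q (\<lambda>\<omega>. g (insert e \<omega>) - g \<omega>)"
    proof (rule bern_exp_mono[OF assms(4,5)])
      fix \<omega>
      have "joined (insert e \<omega>) w t" if "joined \<omega> w t" for t
        using joined_mono[OF that] by auto
      then show "?piv e \<omega> \<le> g (insert e \<omega>) - g \<omega>" unfolding g_def by auto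
    qed
    finally show ?thesis using that by (simp add: insert_absorb)
  qed
  have "c * (1 - reach_prob E A q w T) = c * bern_exp ?F q (\<lambda>\<omega>. 1 - g \<omega>)"
    by (simp add: reach_prob_def g_def bern_exp_diff bern_exp_const finF)
  \<comment> \<open>The event that \<open>w\<close> does not reach \<open>T\<close> is split
    according to the value of the unreached set.\<close>
  also have "\<dots> = c * bern_exp ?F q (\<lambda>\<omega>. \<Sum>S\<in>?SS. of_bool (unreached A T \<omega> = S))"
  proof (intro arg_cong[where f = "(*) c"] bern_exp_cong refl)
    fix \<omega>
    have "(\<Sum>S\<in>?SS. of_bool (unreached A T \<omega> = S)) = (\<Sum>S\<in>?SS. if S = unreached A T \<omega> then 1 else 0 :: real)"
      by (intro sum.cong) auto
    also have "\<dots> = of_bool (unreached A T \<omega> \<in> ?SS)"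
      using finSS by (subst sum.delta) auto
    also have "\<dots> = 1 - g \<omega>" unfolding g_def using unr by auto
    finally show "1 - g \<omega> = (\<Sum>S\<in>?SS. of_bool (unreached A T \<omega> = S))" by simp
  qed
  also have "\<dots> = (\<Sum>S\<in>?SS. c * bern_exp ?F q (\<lambda>\<omega>. of_bool (unreached A T \<omega> = S)))"
    by (simp add: bern_exp_sum sum_distrib_left)
  also have "\<dots> \<le> (\<Sum>S\<in>?SS. exit_sum E A S q w * bern_exp ?F q (\<lambda>\<omega>. of_bool (unreached A T \<omega> = S)))"
    using c assms(4,5) by (intro sum_mono mult_right_mono bern_exp_nonneg) auto
  \<comment> \<open>Independence: whether the unreached set is \<open>S\<close> is decided by the
    edges in \<open>?R\<close>, the connections from \<open>w\<close> inside \<open>S\<close> by the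
    complementary edges \<open>induced E S\<close>.\<close>
  also have "\<dots> = (\<Sum>S\<in>?SS. bern_exp ?F q (\<lambda>\<omega>. of_bool (unreached A T \<omega> = S) *
      (\<Sum>(y, z)\<in>exit_pairs E A S. ?in S \<omega> y)))"
  proof (intro sum.cong refl)
    fix S assume S: "S \<in> ?SS"
    let ?R = "?F - induced E S"
    have SF: "induced E S \<subseteq> ?F" using S by (intro induced_mono) auto
    have F: "?F = ?R \<union> induced E S" using SF by auto
    have loc: "unreached A T (\<omega> \<inter> ?R) = S \<longleftrightarrow> unreached A T \<omega> = S" if "\<omega> \<subseteq> ?F" for \<omega>
    proof -
      have "\<omega> \<inter> ?R = \<omega> - induced E S" using that by auto
      then show ?thesis using unreached_local[OF that assms(2), of S] by simp
    qed
    have "exit_sum E A S q w * bern_exp ?F q (\<lambda>\<omega>. of_bool (unreached A T \<omega> = S)) =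
      (\<Sum>(y, z)\<in>exit_pairs E A S. bern_exp ?F q (\<lambda>\<omega>. of_bool (unreached A T \<omega> = S)) *
         bern_exp (induced E S) q (\<lambda>\<omega>. ?in S \<omega> y))"
    proof -
      have "bern_exp (induced E S) q (\<lambda>\<omega>. of_bool (joined \<omega> w y)) = bern_exp (induced E S) q (\<lambda>\<omega>. ?in S \<omega> y)" for y
        by (intro bern_exp_cong refl) (auto simp: Int_absorb2)
      then show ?thesis by (simp add: exit_sum_def sum_distrib_left mult.commute case_prod_beta)
    qed
    also have "\<dots> = (\<Sum>(y, z)\<in>exit_pairs E A S. bern_exp ?F q (\<lambda>\<omega>. of_bool (unreached A T \<omega> = S) * ?in S \<omega> y))"
    proof (intro sum.cong refl, clarify)
      fix y z
      have "bern_exp ?F q (\<lambda>\<omega>. of_bool (unreached A T \<omega> = S)) = bern_exp ?R q (\<lambda>\<omega>. of_bool (unreached A T \<omega> = S))"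
        using finF loc by (intro bern_exp_restrict) auto
      moreover have "bern_exp (?R \<union> induced E S) q (\<lambda>\<omega>. of_bool (unreached A T \<omega> = S) * ?in S \<omega> y) =
        bern_exp ?R q (\<lambda>\<omega>. of_bool (unreached A T \<omega> = S)) * bern_exp (induced E S) q (\<lambda>\<omega>. ?in S \<omega> y)"
      proof (rule bern_exp_indep)
        show "of_bool (unreached A T (\<omega> \<inter> ?R) = S) = (of_bool (unreached A T \<omega> = S) :: real)"
          if "\<omega> \<subseteq> ?R \<union> induced E S" for \<omega>
          using loc[of \<omega>] that F by simp
      qed (use finF SF finite_subset in \<open>auto simp: Int_assoc\<close>)
      ultimately show "bern_exp ?F q (\<lambda>\<omega>. of_bool (unreached A T \<omega> = S)) * bern_exp (induced E S) q (\<lambda>\<omega>. ?in S \<omega> y) =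
        bern_exp ?F q (\<lambda>\<omega>. of_bool (unreached A T \<omega> = S) * ?in S \<omega> y)"
        using F by simp
    qed
    also have "\<dots> = bern_exp ?F q (\<lambda>\<omega>. of_bool (unreached A T \<omega> = S) * (\<Sum>(y, z)\<in>exit_pairs E A S. ?in S \<omega> y))"
      by (simp add: sum_distrib_left bern_exp_sum case_prod_beta)
    finally show "exit_sum E A S q w * bern_exp ?F q (\<lambda>\<omega>. of_bool (unreached A T \<omega> = S)) = \<dots>" .
  qed
  also have "\<dots> = bern_exp ?F q (\<lambda>\<omega>. \<Sum>S\<in>?SS. of_bool (unreached A T \<omega> = S) * (\<Sum>(y, z)\<in>exit_pairs E A S. ?in S \<omega> y))"
    by (simp add: bern_exp_sum)
  also have "\<dots> \<le> bern_exp ?F q (\<lambda>\<omega>. \<Sum>e\<in>?F. ?piv e \<omega>)"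
  proof (rule bern_exp_mono[OF assms(4,5)])
    fix \<omega> assume w: "\<omega> \<subseteq> ?F"
    let ?U = "unreached A T \<omega>"
    let ?G = "\<lambda>S. \<Sum>(y, z)\<in>exit_pairs E A S. ?in S \<omega> y"
    have "(\<Sum>S\<in>?SS. of_bool (?U = S) * ?G S) = (\<Sum>S\<in>?SS. if S = ?U then ?G S else 0)"
      by (intro sum.cong) auto
    also have "\<dots> = (if ?U \<in> ?SS then ?G ?U else 0)"
      using finSS by (subst sum.delta) auto
    also have "\<dots> \<le> (\<Sum>e\<in>?F. ?piv e \<omega>)"
      using pivotal_count[OF assms(1) w assms(2), of w] by (auto intro!: sum_nonneg)
    finally show "(\<Sum>S\<in>?SS. of_bool (?U = S) * ?G S) \<le> (\<Sum>e\<in>?F. ?piv e \<omega>)" .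
  qed
  also have "\<dots> = (\<Sum>e\<in>?F. bern_exp ?F q (?piv e))" by (rule bern_exp_sum)
  also have "\<dots> \<le> (\<Sum>e\<in>?F. bern_exp (?F - {e}) q (\<lambda>\<omega>. g (insert e \<omega>) - g \<omega>))"
    by (intro sum_mono *)
  finally show ?thesis .
qed

lemma exit_sum_mono_param:
  assumes "finite A" "S \<subseteq> A" "0 \<le> p" "p \<le> q" "q \<le> 1"
  shows "exit_sum E A S p w \<le> exit_sum E A S q w"
proof -
  have "finite S" using assms finite_subset by blast
  then show ?thesis unfolding exit_sum_def
    using assms
    by (intro sum_mono, clarify) (intro bern_exp_mono_param finite_induced; auto intro: joined_mono)
qed

lemma reach_prob_mono_param:
  assumes "finite A" "0 \<le> p" "p \<le> q" "q \<le> 1"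
  shows "reach_prob E A p w T \<le> reach_prob E A q w T"
  unfolding reach_prob_def
proof (rule bern_exp_mono_param)
  fix \<omega> :: "'a set set" and e
  have "joined (insert e \<omega>) w t" if "joined \<omega> w t" for t
    using that by (rule joined_mono) auto
  then show "of_bool (\<exists>t\<in>T. joined \<omega> w t) \<le> (of_bool (\<exists>t\<in>T. joined (insert e \<omega>) w t) :: real)"
    by auto
qed (use assms finite_induced in auto)

text \<open>Otherwise every exit sum exceeds \<open>1/2\<close> at \<open>p\<close>, hence at all
  \<open>q\<close> between \<open>p\<close> and \<open>p'\<close>. The reach probability stays below
  \<open>1/4\<close> there, so the derivative is at least \<open>1/2 * (1 - 1/4) = 3/8\<close>, and
  the mean value theorem makes the value at \<open>p'\<close> at least
  \<open>(p' - p) * (3/8)\<close>, which exceeds the assumed bound.\<close>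

lemma exists_small_exit_sum:
  assumes "finite A" "T \<subseteq> A" "w \<in> A" "0 \<le> p" "p < p'" "p' \<le> 1"
    and small: "reach_prob E A p' w T < (p' - p) / 4"
  shows "\<exists>S. w \<in> S \<and> S \<subseteq> A - T \<and> exit_sum E A S p w \<le> 1/2"
proof (rule ccontr)
  assume neg: "\<not> ?thesis"
  have c: "1/2 \<le> exit_sum E A S p w" if "w \<in> S" "S \<subseteq> A - T" for S
  proof -
    have "\<not> exit_sum E A S p w \<le> 1/2" using that neg by blast
    then show ?thesis by simp
  qed
  define g where "g = (\<lambda>\<omega>. of_bool (\<exists>t\<in>T. joined \<omega> w t) :: real)"
  let ?f = "\<lambda>q. reach_prob E A q w T"
  let ?D = "\<lambda>q. (\<Sum>e\<in>induced E A. bern_exp (induced E A - {e}) q (\<lambda>\<omega>. g (insert e \<omega>) - g \<omega>))"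
  have f: "?f = (\<lambda>q. bern_exp (induced E A) q g)"
    by (simp add: reach_prob_def g_def)
  have fin: "finite (induced E A)" by (rule finite_induced[OF assms(1)])
  have "(?f has_real_derivative ?D q) (at q)" for q
    using bern_exp_deriv[OF fin, of g q] by (simp only: f)
  then have "\<exists>q>p. q < p' \<and> ?f p' - ?f p = (p' - p) * ?D q"
    by (intro MVT2[where f = ?f and f' = ?D] assms(5))
  then obtain q where q: "p < q" "q < p'" "?f p' - ?f p = (p' - p) * ?D q" by blast
  have "1/2 * (1 - ?f q) \<le> ?D q"
    unfolding g_def
  proof (rule reach_prob_deriv_ge)
    fix S assume S: "w \<in> S" "S \<subseteq> A - T"
    have "exit_sum E A S p w \<le> exit_sum E A S q w"
      using assms q S by (intro exit_sum_mono_param) auto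
    then show "1/2 \<le> exit_sum E A S q w" using c[OF S] by linarith
  qed (use assms q in auto)
  moreover have "?f q \<le> ?f p'"
    using assms q by (intro reach_prob_mono_param) auto
  ultimately have "3/8 \<le> ?D q" using assms by argo
  then have "(p' - p) * (3/8) \<le> ?f p' - ?f p" unfolding q(3) using assms by (intro mult_left_mono) auto
  moreover have "0 \<le> ?f p" using assms by (intro reach_prob_nonneg) auto
  ultimately show False using small assms by argo
qed

section \<open>Successive exits and exponential decay\<close>

definition cluster_in :: "'v set set \<Rightarrow> 'v \<Rightarrow> 'v set" where
  "cluster_in \<omega> w = {y. joined \<omega> w y}"

text \<open>Finding the cluster of \<open>w\<close> inside \<open>S\<close> reveals only edges that
  touch it. The edges inside \<open>A - C\<close> thus remain independent of the event that this
  cluster is \<open>C\<close>.\<close>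

lemma cluster_in_local:
  assumes "w \<in> C"
  shows "cluster_in ((\<omega> - induced E (A - C)) \<inter> induced E S) w = C \<longleftrightarrow> cluster_in (\<omega> \<inter> induced E S) w = C"
proof
  let ?\<omega>' = "(\<omega> - induced E (A - C)) \<inter> induced E S"
  have sub: "cluster_in ?\<omega>' w \<subseteq> cluster_in (\<omega> \<inter> induced E S) w"
    by (auto simp: cluster_in_def intro: joined_mono)
  {
    assume L: "cluster_in ?\<omega>' w = C"
    have "z \<in> C" if "joined (\<omega> \<inter> induced E S) w z" for z
      using that
    proof (induction rule: joined_induct)
      case (step y z)
      then have "{y, z} \<in> ?\<omega>'" by (auto simp: induced_def)
      moreover have "joined ?\<omega>' w y" using L step by (auto simp: cluster_in_def)
      ultimately have "joined ?\<omega>' w z" using joined_edge joined_trans by metis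
      then show ?case using L by (auto simp: cluster_in_def)
    qed fact
    then show "cluster_in (\<omega> \<inter> induced E S) w = C" using L sub by (auto simp: cluster_in_def)
  }
  {
    assume L: "cluster_in (\<omega> \<inter> induced E S) w = C"
    have "joined ?\<omega>' w z" if "joined (\<omega> \<inter> induced E S) w z" for z
      using that
    proof (induction rule: joined_induct)
      case (step y z)
      then have "y \<in> C" using L by (auto simp: cluster_in_def)
      then have "{y, z} \<in> ?\<omega>'" using step by (auto simp: induced_def)
      then show ?case using step joined_edge joined_trans by metis
    qed simp
    then show "cluster_in ?\<omega>' w = C" using L sub by (auto simp: cluster_in_def)
  }
qed

text \<open>After its last visit to the cluster \<open>C\<close> of \<open>w\<close> inside \<open>S\<close>, a path from \<open>w\<close> to \<open>T\<close> uses no vertex of \<open>C\<close>.\<close>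

lemma last_exit:
  assumes "\<omega> \<subseteq> induced E A" "joined \<omega> w t" "t \<notin> S" "w \<in> S" "S \<subseteq> A"
  defines "C \<equiv> cluster_in (\<omega> \<inter> induced E S) w"
  shows "\<exists>(y, z)\<in>exit_pairs E A S. y \<in> C \<and> joined (\<omega> \<inter> induced E (A - C)) z t"
proof -
  have CS: "C \<subseteq> S"
  proof
    fix y assume "y \<in> C"
    then have "joined (\<omega> \<inter> induced E S) w y" by (simp add: C_def cluster_in_def)
    then show "y \<in> S" by (induction rule: joined_induct) (use assms(4) in \<open>auto simp: induced_def\<close>)
  qed
  have "joined \<omega> t w" using assms joined_sym by metis
  then have "(w \<notin> C \<and> joined (\<omega> \<inter> induced E (A - C)) w t) \<or> ?thesis"
  proof (induction rule: joined_induct)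
    case refl then show ?case using CS assms by auto
  next
    case (step y z)
    show ?case
    proof (cases ?thesis)
      case False
      then have y: "y \<notin> C" "joined (\<omega> \<inter> induced E (A - C)) y t" using step by auto
      have e: "{z, y} \<in> \<omega>" "{z, y} \<in> E" "z \<in> A" "y \<in> A"
        using step(2) assms(1) by (auto simp: insert_commute induced_def)
      have "z \<notin> C"
      proof
        assume z: "z \<in> C"
        have "y \<notin> S"
        proof
          assume "y \<in> S"
          then have "joined (\<omega> \<inter> induced E S) z y"
            using e z CS by (intro joined_edge) (auto simp: induced_def)
          then have "y \<in> C" using z joined_trans unfolding C_def cluster_in_def by fast
          then show False using y by simp
        qed
        then have "(z, y) \<in> exit_pairs E A S" using z e CS by (auto simp: exit_pairs_def)
        then show False using False y z by blast
      qed
      moreover have "joined (\<omega> \<inter> induced E (A - C)) z y"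
        using e calculation y by (intro joined_edge) (auto simp: induced_def)
      ultimately show ?thesis using y joined_trans by metis
    qed simp
  qed
  moreover have "w \<in> C" by (simp add: C_def cluster_in_def)
  ultimately show ?thesis by blast
qed

text \<open>A Simon-Lieb inequality. Given the cluster \<open>C\<close> of \<open>w\<close> inside
  \<open>S\<close>, the path after its last visit to \<open>C\<close> runs in \<open>A - C\<close>,
  whose edges are still unrevealed; the probability of this part is at most
  \<open>reach_prob E A p z T\<close>. Summing over all \<open>C\<close> that contain
  \<open>y\<close> restores the connection probability inside \<open>S\<close>.\<close>

lemma reach_prob_le_exits:
  assumes "finite A" "w \<in> S" "S \<subseteq> A" "S \<inter> T = {}" "0 \<le> p" "p \<le> 1"
  shows "reach_prob E A p w T \<le> (\<Sum>(y, z)\<in>exit_pairs E A S.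
    bern_exp (induced E S) p (\<lambda>\<omega>. of_bool (joined \<omega> w y)) * reach_prob E A p z T)"
proof -
  let ?F = "induced E A"
  let ?X = "exit_pairs E A S"
  let ?cl = "\<lambda>\<omega>. cluster_in (\<omega> \<inter> induced E S) w"
  define CC where "CC = {C. w \<in> C \<and> C \<subseteq> S}"
  define a :: "'a set \<Rightarrow> 'a set set \<Rightarrow> real" where "a = (\<lambda>C \<omega>. of_bool (?cl \<omega> = C))"
  define h :: "'a set \<Rightarrow> 'a \<Rightarrow> 'a set set \<Rightarrow> real"
    where "h = (\<lambda>C z \<omega>. of_bool (\<exists>t\<in>T. joined (\<omega> \<inter> induced E (A - C)) z t))"
  have finF: "finite ?F" by (rule finite_induced) fact
  have finS: "finite S" using assms finite_subset by blast
  have finCC: "finite CC" unfolding CC_def by (rule finite_subset[of _ "Pow S"]) (use finS in auto)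
  have finX: "finite ?X" by (rule finite_exit_pairs) fact+
  have SF: "induced E S \<subseteq> ?F" using assms(3) by (rule induced_mono)
  have cl: "?cl \<omega> \<in> CC" for \<omega>
  proof -
    have "y \<in> S" if "joined (\<omega> \<inter> induced E S) w y" for y
      using that by (induction rule: joined_induct) (use assms(2) in \<open>auto simp: induced_def\<close>)
    then show ?thesis by (auto simp: CC_def cluster_in_def)
  qed
  have sum_a: "(\<Sum>C\<in>CC. a C \<omega> * k C) = k (?cl \<omega>)" for \<omega> k
  proof -
    have "(\<Sum>C\<in>CC. a C \<omega> * k C) = (\<Sum>C\<in>CC. if C = ?cl \<omega> then k C else 0)"
      by (intro sum.cong) (auto simp: a_def)
    then show ?thesis using cl finCC by (simp add: sum.delta)
  qed
  have "reach_prob E A p w T \<le> bern_exp ?F p (\<lambda>\<omega>. \<Sum>C\<in>CC. a C \<omega> * (\<Sum>(y, z)\<in>?X. of_bool (y \<in> C) * h C z \<omega>))"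
    unfolding reach_prob_def
  proof (rule bern_exp_mono[OF assms(5,6)])
    fix \<omega> assume \<omega>: "\<omega> \<subseteq> ?F"
    let ?C = "?cl \<omega>"
    have nn: "0 \<le> (\<Sum>(y, z)\<in>?X. of_bool (y \<in> ?C) * h ?C z \<omega>)"
      by (intro sum_nonneg) (auto simp: h_def)
    have "of_bool (\<exists>t\<in>T. joined \<omega> w t) \<le> (\<Sum>(y, z)\<in>?X. of_bool (y \<in> ?C) * h ?C z \<omega>)"
    proof (cases "\<exists>t\<in>T. joined \<omega> w t")
      case True
      then obtain t where t: "t \<in> T" "joined \<omega> w t" by blast
      then have "t \<notin> S" using assms(4) by auto
      from last_exit[OF \<omega> t(2) this assms(2,3)] obtain y z
        where yz: "(y, z) \<in> ?X" "y \<in> ?C" "joined (\<omega> \<inter> induced E (A - ?C)) z t" by blast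
      have "(1::real) = (\<Sum>(y, z)\<in>{(y, z)}. of_bool (y \<in> ?C) * h ?C z \<omega>)"
        using yz t by (auto simp: h_def)
      also have "\<dots> \<le> (\<Sum>(y, z)\<in>?X. of_bool (y \<in> ?C) * h ?C z \<omega>)"
        using yz finX by (intro sum_mono2) (auto simp: h_def)
      finally show ?thesis using True by simp
    qed (use nn in simp)
    then show "of_bool (\<exists>t\<in>T. joined \<omega> w t) \<le>
        (\<Sum>C\<in>CC. a C \<omega> * (\<Sum>(y, z)\<in>?X. of_bool (y \<in> C) * h C z \<omega>))"
      by (simp only: sum_a)
  qed
  also have "\<dots> = (\<Sum>C\<in>CC. \<Sum>(y, z)\<in>?X. of_bool (y \<in> C) * bern_exp ?F p (\<lambda>\<omega>. a C \<omega> * h C z \<omega>))"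
    unfolding bern_exp_sum
  proof (intro sum.cong refl)
    fix C
    have "(\<lambda>\<omega>. a C \<omega> * (\<Sum>(y, z)\<in>?X. of_bool (y \<in> C) * h C z \<omega>)) =
       (\<lambda>\<omega>. \<Sum>(y, z)\<in>?X. of_bool (y \<in> C) * (a C \<omega> * h C z \<omega>))"
      by (auto simp: fun_eq_iff sum_distrib_left intro!: sum.cong)
    then show "bern_exp ?F p (\<lambda>\<omega>. a C \<omega> * (\<Sum>(y, z)\<in>?X. of_bool (y \<in> C) * h C z \<omega>)) =
       (\<Sum>(y, z)\<in>?X. of_bool (y \<in> C) * bern_exp ?F p (\<lambda>\<omega>. a C \<omega> * h C z \<omega>))"
      by (simp only: bern_exp_sum case_prod_unfold bern_exp_cmult)
  qed
  also have "\<dots> \<le> (\<Sum>C\<in>CC. \<Sum>(y, z)\<in>?X. of_bool (y \<in> C) * (bern_exp ?F p (a C) * reach_prob E A p z T))"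
  proof (intro sum_mono, clarify, intro mult_left_mono)
    fix C y z assume C: "C \<in> CC"
    let ?F2 = "induced E (A - C)"
    let ?F1 = "?F - ?F2"
    have F2: "?F2 \<subseteq> ?F" by (rule induced_mono) auto
    have F: "?F1 \<union> ?F2 = ?F" using F2 by auto
    have loc: "a C (\<omega> \<inter> ?F1) = a C \<omega>" if "\<omega> \<subseteq> ?F" for \<omega>
    proof -
      have "\<omega> \<inter> ?F1 = \<omega> - ?F2" using that by auto
      then show ?thesis using cluster_in_local[of w C \<omega> E A S] C by (simp add: a_def CC_def)
    qed
    have "bern_exp (?F1 \<union> ?F2) p (\<lambda>\<omega>. a C \<omega> * h C z \<omega>) = bern_exp ?F1 p (a C) * bern_exp ?F2 p (h C z)"
    proof (rule bern_exp_indep)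
      show "a C (\<omega> \<inter> ?F1) = a C \<omega>" if "\<omega> \<subseteq> ?F1 \<union> ?F2" for \<omega>
        using loc that unfolding F .
    qed (use finF F2 finite_subset in \<open>auto simp: h_def Int_assoc\<close>)
    moreover have "bern_exp ?F p (a C) = bern_exp ?F1 p (a C)"
      using finF loc by (intro bern_exp_restrict) auto
    moreover have "bern_exp ?F2 p (h C z) \<le> reach_prob E A p z T"
    proof -
      have "bern_exp ?F p (h C z) = bern_exp ?F2 p (h C z)"
        using finF F2 by (intro bern_exp_restrict) (auto simp: h_def Int_assoc)
      moreover have "bern_exp ?F p (h C z) \<le> reach_prob E A p z T"
        unfolding reach_prob_def
      proof (rule bern_exp_mono[OF assms(5,6)])
        fix \<omega>
        have "joined \<omega> z t" if "joined (\<omega> \<inter> induced E (A - C)) z t" for t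
          using that by (rule joined_mono) auto
        then show "h C z \<omega> \<le> of_bool (\<exists>t\<in>T. joined \<omega> z t)"
          by (auto simp: h_def)
      qed
      ultimately show ?thesis by simp
    qed
    moreover have "0 \<le> bern_exp ?F p (a C)"
      using assms by (intro bern_exp_nonneg) (auto simp: a_def)
    ultimately show "bern_exp ?F p (\<lambda>\<omega>. a C \<omega> * h C z \<omega>) \<le> bern_exp ?F p (a C) * reach_prob E A p z T"
      unfolding F by (simp add: mult_left_mono)
  qed simp
  also have "\<dots> = (\<Sum>(y, z)\<in>?X. \<Sum>C\<in>CC. of_bool (y \<in> C) * (bern_exp ?F p (a C) * reach_prob E A p z T))"
    unfolding case_prod_beta by (rule sum.swap)
  also have "\<dots> = (\<Sum>(y, z)\<in>?X.
    bern_exp (induced E S) p (\<lambda>\<omega>. of_bool (joined \<omega> w y)) * reach_prob E A p z T)"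
  proof (intro sum.cong refl, clarify)
    fix y z
    let ?j = "\<lambda>\<omega>. of_bool (joined (\<omega> \<inter> induced E S) w y) :: real"
    have "(\<Sum>C\<in>CC. of_bool (y \<in> C) * (bern_exp ?F p (a C) * reach_prob E A p z T)) =
       bern_exp ?F p (\<lambda>\<omega>. \<Sum>C\<in>CC. of_bool (y \<in> C) * a C \<omega>) * reach_prob E A p z T"
      unfolding bern_exp_sum bern_exp_cmult sum_distrib_right by (simp add: mult.assoc)
    also have "(\<lambda>\<omega>. \<Sum>C\<in>CC. of_bool (y \<in> C) * a C \<omega>) = ?j"
    proof
      fix \<omega>
      have "(\<Sum>C\<in>CC. of_bool (y \<in> C) * a C \<omega>) = (\<Sum>C\<in>CC. a C \<omega> * of_bool (y \<in> C))"
        by (simp add: mult.commute)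
      also have "\<dots> = of_bool (y \<in> ?cl \<omega>)" by (rule sum_a)
      finally show "(\<Sum>C\<in>CC. of_bool (y \<in> C) * a C \<omega>) = ?j \<omega>" by (simp add: cluster_in_def)
    qed
    also have "bern_exp ?F p ?j = bern_exp (induced E S) p ?j"
      using finF SF by (intro bern_exp_restrict) (auto simp: Int_assoc)
    also have "\<dots> = bern_exp (induced E S) p (\<lambda>\<omega>. of_bool (joined \<omega> w y))"
      by (intro bern_exp_cong refl) (auto simp: Int_absorb2)
    finally show "(\<Sum>C\<in>CC. of_bool (y \<in> C) * (bern_exp ?F p (a C) * reach_prob E A p z T)) =
       bern_exp (induced E S) p (\<lambda>\<omega>. of_bool (joined \<omega> w y)) * reach_prob E A p z T" .
  qed
  finally show ?thesis .
qed

text \<open>Each use of the Simon-Lieb inequality gains the factor \<open>1/2\<close> and moves the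
  start by at most \<open>\<rho>\<close>, to the outer end of an exit edge. The distance to
  \<open>T\<close> leaves room for \<open>k\<close> such moves; each new start has its own set
  \<open>S\<close>.\<close>

lemma reach_prob_decay:
  fixes A :: "'v::metric_space set"
  assumes "finite A" "0 \<le> p" "p \<le> 1"
    and step: "\<And>w. w \<in> A \<Longrightarrow> \<exists>S. w \<in> S \<and> S \<subseteq> A \<and> exit_sum E A S p w \<le> 1/2 \<and>
      (\<forall>s\<in>S. dist w s \<le> \<rho>) \<and> (\<forall>(y, z)\<in>exit_pairs E A S. dist w z \<le> \<rho>)"
  shows "w \<in> A \<Longrightarrow> (\<And>t. t \<in> T \<Longrightarrow> real k * \<rho> < dist w t) \<Longrightarrow> reach_prob E A p w T \<le> (1/2) ^ k"
proof (induction k arbitrary: w)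
  case 0
  then show ?case using reach_prob_le_1[OF assms(1-3)] by simp
next
  case (Suc k)
  obtain S where S: "w \<in> S" "S \<subseteq> A" "exit_sum E A S p w \<le> 1/2"
      and S': "\<forall>s\<in>S. dist w s \<le> \<rho>" "\<forall>(y, z)\<in>exit_pairs E A S. dist w z \<le> \<rho>"
    using step[OF Suc.prems(1)] by (elim exE conjE)
  have S4: "dist w s \<le> \<rho>" if "s \<in> S" for s using S'(1) that by simp
  have S5: "dist w z \<le> \<rho>" if "(y, z) \<in> exit_pairs E A S" for y z using S'(2) that by auto
  have "0 \<le> \<rho>" using S4[OF S(1)] by simp
  then have kr: "\<rho> \<le> real (Suc k) * \<rho>" using mult_right_mono[of 1 "real (Suc k)" \<rho>] by simp
  \<comment> \<open>The strict inequality in the distance hypothesis keeps \<open>T\<close> away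
    from \<open>S\<close> even when a single step is left.\<close>
  have disj: "S \<inter> T = {}"
  proof (rule ccontr)
    assume "S \<inter> T \<noteq> {}"
    then obtain t where "t \<in> S" "t \<in> T" by auto
    then show False using S4[of t] Suc.prems(2)[of t] kr by simp
  qed
  have "reach_prob E A p w T \<le> (\<Sum>(y, z)\<in>exit_pairs E A S.
    bern_exp (induced E S) p (\<lambda>\<omega>. of_bool (joined \<omega> w y)) * reach_prob E A p z T)"
    by (rule reach_prob_le_exits) (use assms S disj in auto)
  also have "\<dots> \<le> (\<Sum>(y, z)\<in>exit_pairs E A S.
    bern_exp (induced E S) p (\<lambda>\<omega>. of_bool (joined \<omega> w y)) * (1/2) ^ k)"
  proof (intro sum_mono, clarify, intro mult_left_mono)
    fix y z assume yz: "(y, z) \<in> exit_pairs E A S"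
    have "real k * \<rho> < dist z t" if "t \<in> T" for t
      using Suc.prems(2)[OF that] S5[OF yz] dist_triangle[of w t z] by (simp add: algebra_simps)
    moreover have "z \<in> A" using yz by (auto simp: exit_pairs_def)
    ultimately show "reach_prob E A p z T \<le> (1/2) ^ k" using Suc.IH by blast
  qed (use assms in \<open>auto intro: bern_exp_nonneg\<close>)
  also have "\<dots> = exit_sum E A S p w * (1/2) ^ k"
    by (simp add: exit_sum_def sum_distrib_right case_prod_beta)
  also have "\<dots> \<le> 1/2 * (1/2) ^ k" using S by (intro mult_right_mono) auto
  finally show ?case by simp
qed

section \<open>Invariance of exit sums under graph automorphisms\<close>

lemma joined_image: "joined \<omega> u v \<Longrightarrow> joined ((`) f ` \<omega>) (f u) (f v)"
proof (induction rule: joined_induct)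
  case (step y z)
  have "{f y, f z} = f ` {y, z}" by simp
  then have "{f y, f z} \<in> (`) f ` \<omega>" using step(2) by blast
  then show ?case using step joined_edge joined_trans by metis
qed simp

lemma joined_image_iff:
  assumes "inj_on f V" "\<omega> \<subseteq> Pow V" "u \<in> V" "v \<in> V"
  shows "joined ((`) f ` \<omega>) (f u) (f v) \<longleftrightarrow> joined \<omega> u v"
proof
  let ?g = "inv_into V f"
  assume "joined ((`) f ` \<omega>) (f u) (f v)"
  then have j: "joined ((`) ?g ` (`) f ` \<omega>) (?g (f u)) (?g (f v))" by (rule joined_image)
  have im: "(`) ?g ` (`) f ` \<omega> = \<omega>"
  proof -
    have "(\<lambda>e. ?g ` f ` e) ` \<omega> = (\<lambda>e. e) ` \<omega>"
      by (intro image_cong refl inv_into_image_cancel[OF assms(1)]) (use assms(2) in auto)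
    then show ?thesis by (subst image_image) simp
  qed
  have gf: "?g (f u) = u" "?g (f v) = v"
    by (rule inv_into_f_f[OF assms(1,3)]) (rule inv_into_f_f[OF assms(1,4)])
  show "joined \<omega> u v" using j unfolding im gf .
qed (rule joined_image)

lemma exit_sum_image:
  assumes "bij_betw f V V" "\<And>u v. u \<in> V \<Longrightarrow> v \<in> V \<Longrightarrow> {f u, f v} \<in> E \<longleftrightarrow> {u, v} \<in> E"
    and "E \<subseteq> {{u, v} | u v. u \<in> V \<and> v \<in> V \<and> u \<noteq> v}"
    and "A \<subseteq> V" "S \<subseteq> A" "w \<in> S"
  shows "exit_sum E (f ` A) (f ` S) p (f w) = exit_sum E A S p w"
proof -
  have inj: "inj_on f V" using assms(1) by (simp add: bij_betw_def)
  have SV: "S \<subseteq> V" using assms by auto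
  have ind: "induced E (f ` S) = (`) f ` induced E S"
  proof
    show "induced E (f ` S) \<subseteq> (`) f ` induced E S"
    proof
      fix e assume e: "e \<in> induced E (f ` S)"
      then obtain u v where "e = {u, v}" using assms(3) unfolding induced_def by blast
      with e obtain u' v' where uv: "u' \<in> S" "v' \<in> S" "e = {f u', f v'}" unfolding induced_def by blast
      then have "{u', v'} \<in> induced E S" using e assms(2)[of u' v'] SV by (auto simp: induced_def)
      moreover have "e = f ` {u', v'}" using uv by simp
      ultimately show "e \<in> (`) f ` induced E S" by blast
    qed
    show "(`) f ` induced E S \<subseteq> induced E (f ` S)"
    proof
      fix e assume "e \<in> (`) f ` induced E S"
      then obtain e' where e': "e' \<in> E" "e' \<subseteq> S" "e = f ` e'" by (auto simp: induced_def)
      then obtain u v where uv: "e' = {u, v}" using assms(3) by blast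
      then have "{f u, f v} \<in> E" using e' assms(2)[of u v] SV by auto
      then show "e \<in> induced E (f ` S)" using e' uv by (auto simp: induced_def)
    qed
  qed
  have inj2: "inj_on ((`) f) (induced E S)"
    using inj_on_image_Pow[OF inj_on_subset[OF inj SV]] by (rule inj_on_subset) (auto simp: induced_def)
  have fin: "bern_exp (induced E (f ` S)) p (\<lambda>\<omega>. of_bool (joined \<omega> (f w) (f y))) =
      bern_exp (induced E S) p (\<lambda>\<omega>. of_bool (joined \<omega> w y))" if "y \<in> S" "finite (induced E S)" for y
  proof -
    have "bern_exp (induced E (f ` S)) p (\<lambda>\<omega>. of_bool (joined \<omega> (f w) (f y))) =
      bern_exp (induced E S) p (\<lambda>\<omega>. of_bool (joined ((`) f ` \<omega>) (f w) (f y)))"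
      unfolding ind by (rule bern_exp_image) (use that inj2 in auto)
    also have "\<dots> = bern_exp (induced E S) p (\<lambda>\<omega>. of_bool (joined \<omega> w y))"
    proof (intro bern_exp_cong refl)
      fix \<omega> assume "\<omega> \<subseteq> induced E S"
      then have "\<omega> \<subseteq> Pow V" using SV by (auto simp: induced_def)
      moreover have "w \<in> V" "y \<in> V" using that(1) assms(6) SV by auto
      ultimately show "of_bool (joined ((`) f ` \<omega>) (f w) (f y)) = (of_bool (joined \<omega> w y) :: real)"
        by (simp add: joined_image_iff[OF inj])
    qed
    finally show ?thesis .
  qed
  have X: "exit_pairs E (f ` A) (f ` S) = map_prod f f ` exit_pairs E A S"
  proof -
    have iff: "f z \<in> f ` S \<longleftrightarrow> z \<in> S" if "z \<in> A" for z
      using inj_on_image_mem_iff[OF inj, of z S] that assms SV by auto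
    show ?thesis
    proof
      show "exit_pairs E (f ` A) (f ` S) \<subseteq> map_prod f f ` exit_pairs E A S"
      proof clarify
        fix y z assume "(y, z) \<in> exit_pairs E (f ` A) (f ` S)"
        then obtain y' z' where "y' \<in> S" "y = f y'" "z' \<in> A" "z = f z'" "z' \<notin> S" "{f y', f z'} \<in> E"
          unfolding exit_pairs_def by blast
        moreover from this have "y' \<in> V" "z' \<in> V" using SV assms(4) by auto
        ultimately have "(y', z') \<in> exit_pairs E A S" "(y, z) = map_prod f f (y', z')"
          using assms(2)[of y' z'] by (auto simp: exit_pairs_def)
        then show "(y, z) \<in> map_prod f f ` exit_pairs E A S" by blast
      qed
      show "map_prod f f ` exit_pairs E A S \<subseteq> exit_pairs E (f ` A) (f ` S)"
      proof clarify
        fix y z assume "(y, z) \<in> exit_pairs E A S"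
        then have *: "y \<in> S" "z \<in> A" "z \<notin> S" "{y, z} \<in> E" by (auto simp: exit_pairs_def)
        then have "{f y, f z} \<in> E" "f z \<notin> f ` S"
          using assms(2)[of y z] iff[of z] SV assms(4) by auto
        then show "(f y, f z) \<in> exit_pairs E (f ` A) (f ` S)"
          using * unfolding exit_pairs_def by simp
      qed
    qed
  qed
  have inj3: "inj_on (map_prod f f) (exit_pairs E A S)"
  proof (rule inj_on_subset[OF map_prod_inj_on[OF inj inj]])
    show "exit_pairs E A S \<subseteq> V \<times> V" using assms(4) SV by (auto simp: exit_pairs_def)
  qed
  show ?thesis
  proof (cases "finite (induced E S)")
    case True
    then show ?thesis unfolding exit_sum_def X sum.reindex[OF inj3]
      by (intro sum.cong refl) (auto simp: fin exit_pairs_def)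
  next
    \<comment> \<open>For infinite \<open>induced E S\<close> the sum defining
      \<open>bern_exp\<close> ranges over an infinite set and is \<open>0\<close> by convention, on
      both sides.\<close>
    case False
    then have "infinite (induced E (f ` S))" unfolding ind using inj2 finite_image_iff by blast
    then have "bern_exp (induced E (f ` S)) p g = 0" "bern_exp (induced E S) p g = 0" for g
      using False by (auto simp: bern_exp_def)
    then show ?thesis by (simp add: exit_sum_def)
  qed
qed

section \<open>The percolation measure\<close>

lemma space_percolation: "space (percolation E p) = E \<rightarrow>\<^sub>E UNIV"
  by (simp add: percolation_def space_PiM)

lemma prob_space_percolation: "prob_space (percolation E p)"
  unfolding percolation_def by (intro prob_space_PiM prob_space_measure_pmf)

lemma cylinder:
  assumes "finite F" "F \<subseteq> E" "\<omega>\<^sub>0 \<subseteq> F" "0 \<le> p" "p \<le> 1"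
  shows "{\<omega> \<in> space (percolation E p). {e \<in> F. \<omega> e} = \<omega>\<^sub>0} \<in> sets (percolation E p)" (is "?X \<in> _")
    and "measure (percolation E p) {\<omega> \<in> space (percolation E p). {e \<in> F. \<omega> e} = \<omega>\<^sub>0} =
      p ^ card \<omega>\<^sub>0 * (1 - p) ^ card (F - \<omega>\<^sub>0)"
proof -
  interpret product_prob_space "\<lambda>_. measure_pmf (bernoulli_pmf p)" E
    by (simp add: product_prob_space_def product_prob_space_axioms_def product_sigma_finite_def
        prob_space_measure_pmf measure_pmf.sigma_finite_measure_axioms)
  let ?M = "\<lambda>_. measure_pmf (bernoulli_pmf p)"
  let ?X = "\<lambda>e. {e \<in> \<omega>\<^sub>0}"
  have iff: "{e \<in> F. \<omega> e} = \<omega>\<^sub>0 \<longleftrightarrow> (\<forall>e\<in>F. \<omega> e = (e \<in> \<omega>\<^sub>0))" for \<omega>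
    using assms(3) by blast
  have X: "{\<omega> \<in> space (percolation E p). {e \<in> F. \<omega> e} = \<omega>\<^sub>0} = prod_emb E ?M F (\<Pi>\<^sub>E e\<in>F. ?X e)"
    unfolding iff space_percolation prod_emb_def by (auto simp: PiE_iff extensional_def)
  show "{\<omega> \<in> space (percolation E p). {e \<in> F. \<omega> e} = \<omega>\<^sub>0} \<in> sets (percolation E p)"
    unfolding X unfolding percolation_def by (rule sets_PiM_I) (use assms in auto)
  have "measure (percolation E p) (prod_emb E ?M F (\<Pi>\<^sub>E e\<in>F. ?X e)) =
      (\<Prod>e\<in>F. measure (measure_pmf (bernoulli_pmf p)) (?X e))"
    unfolding percolation_def by (rule measure_PiM_emb) (use assms in auto)
  also have "\<dots> = (\<Prod>e\<in>F. if e \<in> \<omega>\<^sub>0 then p else 1 - p)"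
    using assms(4,5) by (intro prod.cong) (auto simp: measure_pmf_single)
  also have "\<dots> = p ^ card \<omega>\<^sub>0 * (1 - p) ^ card (F - \<omega>\<^sub>0)"
  proof -
    have "F \<inter> {e. e \<in> \<omega>\<^sub>0} = \<omega>\<^sub>0" "F \<inter> - {e. e \<in> \<omega>\<^sub>0} = F - \<omega>\<^sub>0" using assms(3) by auto
    then show ?thesis using assms(1) by (simp add: prod.If_cases)
  qed
  finally show "measure (percolation E p) {\<omega> \<in> space (percolation E p). {e \<in> F. \<omega> e} = \<omega>\<^sub>0} =
      p ^ card \<omega>\<^sub>0 * (1 - p) ^ card (F - \<omega>\<^sub>0)" unfolding X .
qed

lemma finite_event:
  assumes "finite F" "F \<subseteq> E" "0 \<le> p" "p \<le> 1"
  shows "{\<omega> \<in> space (percolation E p). P {e \<in> F. \<omega> e}} \<in> sets (percolation E p)"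
    and "measure (percolation E p) {\<omega> \<in> space (percolation E p). P {e \<in> F. \<omega> e}} =
      bern_exp F p (\<lambda>\<omega>. of_bool (P \<omega>))"
proof -
  interpret prob_space "percolation E p" by (rule prob_space_percolation)
  let ?c = "\<lambda>\<omega>\<^sub>0. {\<omega> \<in> space (percolation E p). {e \<in> F. \<omega> e} = \<omega>\<^sub>0}"
  let ?I = "{\<omega>\<^sub>0 \<in> Pow F. P \<omega>\<^sub>0}"
  have eq: "{\<omega> \<in> space (percolation E p). P {e \<in> F. \<omega> e}} = (\<Union>\<omega>\<^sub>0\<in>?I. ?c \<omega>\<^sub>0)"
    by auto
  have fin: "finite ?I" using assms by simp
  have c: "?c \<omega>\<^sub>0 \<in> sets (percolation E p)" if "\<omega>\<^sub>0 \<in> ?I" for \<omega>\<^sub>0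
    using that assms by (intro cylinder) auto
  show "{\<omega> \<in> space (percolation E p). P {e \<in> F. \<omega> e}} \<in> sets (percolation E p)"
    unfolding eq using fin c by (intro sets.finite_UN) auto
  have "measure (percolation E p) (\<Union>\<omega>\<^sub>0\<in>?I. ?c \<omega>\<^sub>0) = (\<Sum>\<omega>\<^sub>0\<in>?I. measure (percolation E p) (?c \<omega>\<^sub>0))"
    using c by (intro finite_measure_finite_Union[OF fin]) (auto simp: disjoint_family_on_def)
  also have "\<dots> = (\<Sum>\<omega>\<^sub>0\<in>?I. p ^ card \<omega>\<^sub>0 * (1 - p) ^ card (F - \<omega>\<^sub>0))"
    using assms by (intro sum.cong refl cylinder) auto
  also have "\<dots> = bern_exp F p (\<lambda>\<omega>. of_bool (P \<omega>))"
  proof -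
    have "finite (Pow F)" using assms(1) by simp
    from sum.inter_filter[OF this, of "\<lambda>\<omega>\<^sub>0. p ^ card \<omega>\<^sub>0 * (1 - p) ^ card (F - \<omega>\<^sub>0)" P]
    show ?thesis unfolding bern_exp_def by (auto intro!: sum.cong)
  qed
  finally show "measure (percolation E p) {\<omega> \<in> space (percolation E p). P {e \<in> F. \<omega> e}} =
      bern_exp F p (\<lambda>\<omega>. of_bool (P \<omega>))" unfolding eq .
qed

section \<open>Connection events in infinite vertex sets\<close>

lemma joined_Union_chain:
  assumes "incseq F" "joined (\<Union>n. F n) u v"
  shows "\<exists>n. joined (F n) u v"
  using assms(2)
proof (induction rule: joined_induct)
  case (step y z)
  then obtain n m where "joined (F n) u y" "{y, z} \<in> F m" by blast
  moreover have "F n \<subseteq> F (max n m)" "F m \<subseteq> F (max n m)" by (simp_all add: incseqD[OF assms(1)])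
  ultimately have "joined (F (max n m)) u y" "joined (F (max n m)) y z"
    using joined_mono[of "F n" u y] joined_edge[of y z] by auto
  then show ?case by (blast intro: joined_trans)
qed simp

definition reach_event :: "'a::euclidean_space set set \<Rightarrow> real \<Rightarrow> 'a set \<Rightarrow> 'a \<Rightarrow> 'a set \<Rightarrow> ('a set \<Rightarrow> bool) set" where
  "reach_event E p A w U = {\<omega> \<in> space (percolation E p). \<exists>u\<in>U. joined {e \<in> induced E A. \<omega> e} w u}"

lemma reach_event_finite:
  assumes "finite A" "0 \<le> p" "p \<le> 1"
  shows "reach_event E p A w U \<in> sets (percolation E p)"
    and "measure (percolation E p) (reach_event E p A w U) = reach_prob E A p w U"
proof -
  have "finite (induced E A)" "induced E A \<subseteq> E" using finite_induced[OF assms(1)] by (auto simp: induced_def)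
  note * = finite_event[OF this assms(2,3), where P = "\<lambda>\<omega>. \<exists>u\<in>U. joined \<omega> w u"]
  show "reach_event E p A w U \<in> sets (percolation E p)" unfolding reach_event_def by (rule *(1))
  show "measure (percolation E p) (reach_event E p A w U) = reach_prob E A p w U"
    unfolding reach_event_def reach_prob_def by (rule *(2))
qed

lemma reach_event_mono: "A \<subseteq> B \<Longrightarrow> U \<subseteq> U' \<Longrightarrow> reach_event E p A w U \<subseteq> reach_event E p B w U'"
proof
  fix \<omega> assume AB: "A \<subseteq> B" "U \<subseteq> U'" and "\<omega> \<in> reach_event E p A w U"
  then obtain u where "u \<in> U" "joined {e \<in> induced E A. \<omega> e} w u" "\<omega> \<in> space (percolation E p)"
    by (auto simp: reach_event_def)
  moreover have "{e \<in> induced E A. \<omega> e} \<subseteq> {e \<in> induced E B. \<omega> e}"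
    using AB by (auto simp: induced_def)
  ultimately have "joined {e \<in> induced E B. \<omega> e} w u" "u \<in> U'" "\<omega> \<in> space (percolation E p)"
    using AB(2) joined_mono[of "{e \<in> induced E A. \<omega> e}" w u] by auto
  then show "\<omega> \<in> reach_event E p B w U'" unfolding reach_event_def by blast
qed

text \<open>An open path has finitely many edges and each edge is a finite set, so a path in the
  union already lies in one member of the chain.\<close>

lemma reach_event_Union_chain:
  assumes "incseq B" "(\<Union>n. B n) = A" "\<And>e. e \<in> E \<Longrightarrow> finite e"
  shows "reach_event E p A w U = (\<Union>n. reach_event E p (B n) w U)"
proof
  show "(\<Union>n. reach_event E p (B n) w U) \<subseteq> reach_event E p A w U"
    using assms(2) by (intro UN_least reach_event_mono) auto
  show "reach_event E p A w U \<subseteq> (\<Union>n. reach_event E p (B n) w U)"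
  proof
    fix \<omega> assume "\<omega> \<in> reach_event E p A w U"
    then obtain u where u: "u \<in> U" "joined {e \<in> induced E A. \<omega> e} w u" "\<omega> \<in> space (percolation E p)"
      by (auto simp: reach_event_def)
    have "{e \<in> induced E A. \<omega> e} \<subseteq> (\<Union>n. {e \<in> induced E (B n). \<omega> e})"
    proof
      fix e assume e: "e \<in> {e \<in> induced E A. \<omega> e}"
      then have "finite e" "e \<subseteq> (\<Union>n. B n)" using assms by (auto simp: induced_def)
      then have "\<exists>n. e \<subseteq> B n"
      proof (induction e rule: finite_induct)
        case (insert v e)
        then obtain n m where "e \<subseteq> B n" "v \<in> B m" by auto
        moreover have "B n \<subseteq> B (max n m)" "B m \<subseteq> B (max n m)" by (simp_all add: incseqD[OF assms(1)])
        ultimately show ?case by blast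
      qed simp
      then obtain n where "e \<subseteq> B n" by blast
      then show "e \<in> (\<Union>n. {e \<in> induced E (B n). \<omega> e})" using e by (auto simp: induced_def)
    qed
    from joined_mono[OF u(2) this] have "\<exists>n. joined {e \<in> induced E (B n). \<omega> e} w u"
    proof (intro joined_Union_chain)
      show "incseq (\<lambda>n. {e \<in> induced E (B n). \<omega> e})"
      proof (rule monoI)
        fix m n :: nat assume "m \<le> n"
        then have "B m \<subseteq> B n" by (rule incseqD[OF assms(1)])
        then show "{e \<in> induced E (B m). \<omega> e} \<le> {e \<in> induced E (B n). \<omega> e}"
          by (auto simp: induced_def)
      qed
    qed
    then show "\<omega> \<in> (\<Union>n. reach_event E p (B n) w U)" using u by (auto simp: reach_event_def)
  qed
qed

lemma reach_event_limit:
  assumes "incseq B" "(\<Union>n. B n) = A" "\<And>e. e \<in> E \<Longrightarrow> finite e" "\<And>n. finite (B n)" "0 \<le> p" "p \<le> 1"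
  shows "reach_event E p A w U \<in> sets (percolation E p)"
    and "(\<And>n. reach_prob E (B n) p w U \<le> c) \<Longrightarrow> measure (percolation E p) (reach_event E p A w U) \<le> c"
    and "reach_prob E (B n) p w U \<le> measure (percolation E p) (reach_event E p A w U)"
proof -
  interpret prob_space "percolation E p" by (rule prob_space_percolation)
  have eq: "reach_event E p A w U = (\<Union>n. reach_event E p (B n) w U)"
    by (rule reach_event_Union_chain) (use assms in auto)
  note fin = reach_event_finite[OF assms(4,5,6)]
  show m: "reach_event E p A w U \<in> sets (percolation E p)"
    unfolding eq using fin(1) by (intro sets.countable_UN) auto
  have inc: "incseq (\<lambda>n. reach_event E p (B n) w U)"
    by (intro monoI reach_event_mono incseqD[OF assms(1)] order_refl)
  have "(\<lambda>n. measure (percolation E p) (reach_event E p (B n) w U)) \<longlonglongrightarrow>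
      measure (percolation E p) (\<Union>n. reach_event E p (B n) w U)"
    using fin(1) by (intro finite_Lim_measure_incseq inc) auto
  then have "(\<lambda>n. reach_prob E (B n) p w U) \<longlonglongrightarrow> measure (percolation E p) (reach_event E p A w U)"
    unfolding eq fin(2) .
  then show "measure (percolation E p) (reach_event E p A w U) \<le> c" if "\<And>n. reach_prob E (B n) p w U \<le> c"
    by (rule LIMSEQ_le_const2) (use that in auto)
  show "reach_prob E (B n) p w U \<le> measure (percolation E p) (reach_event E p A w U)"
    unfolding fin(2)[symmetric] using m assms(2) by (intro finite_measure_mono reach_event_mono) auto
qed

section \<open>The ball model\<close>

text \<open>For points of the ball this is the square of \<open>sinh (hdist x y / 2)\<close>. It
  determines the distance and is rational in squared norms, so invariance under isometries becomes
  an algebraic identity.\<close>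

definition hquot :: "'a::euclidean_space \<Rightarrow> 'a \<Rightarrow> real" where
  "hquot x y = (norm (x - y))\<^sup>2 / ((1 - (norm x)\<^sup>2) * (1 - (norm y)\<^sup>2))"

lemma hyp_iff: "x \<in> hyp \<longleftrightarrow> norm x < 1"
  by (simp add: hyp_def)

lemma norm_square_less_1: "x \<in> hyp \<Longrightarrow> 0 < 1 - (norm x)\<^sup>2"
  by (simp add: hyp_iff abs_square_less_1)

lemma norm_square_defect_bounds:
  assumes "x \<in> hyp"
  shows "1 - norm x \<le> 1 - (norm x)\<^sup>2" "1 - (norm x)\<^sup>2 \<le> 2 * (1 - norm x)" "1 - (norm x)\<^sup>2 \<le> 1"
proof -
  have n: "0 \<le> norm x" "norm x < 1" using assms by (auto simp: hyp_iff)
  then have "norm x * norm x \<le> 1 * norm x" by (intro mult_right_mono) auto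
  then show "1 - norm x \<le> 1 - (norm x)\<^sup>2" by (simp add: power2_eq_square)
  have "0 \<le> (1 - norm x)\<^sup>2" by simp
  then show "1 - (norm x)\<^sup>2 \<le> 2 * (1 - norm x)" by (simp add: power2_eq_square algebra_simps)
qed simp

lemma hquot_nonneg: "x \<in> hyp \<Longrightarrow> y \<in> hyp \<Longrightarrow> 0 \<le> hquot x y"
  using norm_square_less_1[of x] norm_square_less_1[of y] by (simp add: hquot_def)

lemma norm_diff_hquot:
  assumes "x \<in> hyp" "y \<in> hyp"
  shows "(norm (x - y))\<^sup>2 = hquot x y * ((1 - (norm x)\<^sup>2) * (1 - (norm y)\<^sup>2))"
  using norm_square_less_1[OF assms(1)] norm_square_less_1[OF assms(2)] by (simp add: hquot_def)

lemma norm_square_le_hquot: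
  assumes "x \<in> hyp" "y \<in> hyp"
  shows "(norm (x - y))\<^sup>2 \<le> hquot x y"
proof -
  have "(1 - (norm x)\<^sup>2) * (1 - (norm y)\<^sup>2) \<le> 1"
    using norm_square_less_1[OF assms(1)] norm_square_less_1[OF assms(2)] by (intro mult_le_one) auto
  then show ?thesis using norm_diff_hquot[OF assms] hquot_nonneg[OF assms]
    by (simp add: mult_left_le)
qed

lemma hdist_hquot: "hdist x y = arcosh (1 + 2 * hquot x y)"
  by (simp add: hdist_def hquot_def)

lemma cosh_hdist: "x \<in> hyp \<Longrightarrow> y \<in> hyp \<Longrightarrow> cosh (hdist x y) = 1 + 2 * hquot x y"
  using hquot_nonneg[of x y] by (simp add: hdist_hquot cosh_arcosh_real)

lemma hdist_nonneg: "x \<in> hyp \<Longrightarrow> y \<in> hyp \<Longrightarrow> 0 \<le> hdist x y"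
  using hquot_nonneg[of x y] by (simp add: hdist_hquot arcosh_nonneg_real)

lemma hquot_le_iff:
  assumes "x \<in> hyp" "y \<in> hyp" "x' \<in> hyp" "y' \<in> hyp"
  shows "hquot x y \<le> hquot x' y' \<longleftrightarrow> hdist x y \<le> hdist x' y'"
proof -
  have "hdist x y \<le> hdist x' y' \<longleftrightarrow> cosh (hdist x y) \<le> cosh (hdist x' y')"
    using assms by (simp add: cosh_real_nonneg_le_iff hdist_nonneg)
  then show ?thesis using assms by (simp add: cosh_hdist)
qed

lemma hyp_isometry_hquot:
  assumes "hyp_isometry f" "x \<in> hyp" "y \<in> hyp"
  shows "f x \<in> hyp" "hquot (f x) (f y) = hquot x y"
proof -
  have f: "\<And>x. x \<in> hyp \<Longrightarrow> f x \<in> hyp" using assms(1) by (auto simp: hyp_isometry_def bij_betw_def)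
  show "f x \<in> hyp" using f assms by simp
  have "hdist (f x) (f y) = hdist x y" using assms by (auto simp: hyp_isometry_def)
  then show "hquot (f x) (f y) = hquot x y"
    using hquot_le_iff[of "f x" "f y" x y] hquot_le_iff[of x y "f x" "f y"] assms f by auto
qed

text \<open>Seen from the centre of the ball, an isometry \<open>f\<close> contracts by about \<open>1 - norm (f v)\<close> away from
  the point \<open>a\<close> that it moves to the centre.\<close>

lemma hyp_isometry_contraction:
  assumes "hyp_isometry f" "v \<in> hyp" "a \<in> hyp" "z \<in> hyp" "f a = 0" "0 < \<eta>" "\<eta> \<le> norm (z - a)"
  shows "norm (f z - f v) \<le> 10 / ((1 - (norm v)\<^sup>2) * \<eta>) * (1 - norm (f v))"
    and "1 - (norm a)\<^sup>2 \<le> 10 / (1 - (norm v)\<^sup>2) * (1 - norm (f v))"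
proof -
  let ?d = "\<lambda>x::'a. 1 - (norm x)\<^sup>2"
  note iso = hyp_isometry_hquot[OF assms(1)]
  have fh: "f z \<in> hyp" "f v \<in> hyp" using iso assms by auto
  have pos: "0 < ?d v" "0 < ?d a" "0 < ?d z" "0 < ?d (f z)" "0 < ?d (f v)"
    using norm_square_less_1 fh assms by auto
  \<comment> \<open>Invariance of \<open>hquot\<close> for the pair \<open>x\<close>,
    \<open>a\<close>, where \<open>f a = 0\<close>, rearranged to isolate
    \<open>?d (f x)\<close>.\<close>
  have key: "?d (f x) * (?d x * ?d a + (norm (x - a))\<^sup>2) = ?d x * ?d a" if "x \<in> hyp" for x
  proof -
    have px: "0 < ?d x" "0 < ?d (f x)" by (rule norm_square_less_1[OF that]) (rule norm_square_less_1[OF iso(1)[OF that that]])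
    have "hquot (f x) (f a) = hquot x a" by (rule iso(2)[OF that assms(3)])
    then have "(norm (f x))\<^sup>2 / ?d (f x) = (norm (x - a))\<^sup>2 / (?d x * ?d a)"
      by (simp add: hquot_def assms(5))
    then have "(norm (f x))\<^sup>2 * (?d x * ?d a) = (norm (x - a))\<^sup>2 * ?d (f x)"
      using px pos by (simp add: frac_eq_eq)
    then show ?thesis by (simp add: algebra_simps)
  qed
  have le2: "norm (x - y) \<le> 2" if "x \<in> hyp" "y \<in> hyp" for x y :: 'a
    using norm_triangle_ineq4[of x y] that by (simp add: hyp_iff)
  have le4: "(norm (x - y))\<^sup>2 \<le> 4" if "x \<in> hyp" "y \<in> hyp" for x y :: 'a
    using power_mono[OF le2[OF that], of 2] by simp
  have dle: "?d x \<le> 1" for x :: 'a by simp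
  have sq: "4 * t * (5 * t) \<le> (5 * t)\<^sup>2" for t :: real
    using zero_le_square[of t] by (simp add: power2_eq_square)
  \<comment> \<open>The \<open>5\<close> is \<open>1 + 4\<close>: products of defects
    \<open>?d\<close> are at most \<open>1\<close>, squared Euclidean distances in the ball at most
    \<open>4\<close>. The \<open>10\<close> of the statement is twice this, from
    \<open>?d (f v) \<le> 2 * (1 - norm (f v))\<close>.\<close>
  have A: "?d v * ?d a \<le> 5 * ?d (f v)"
  proof -
    have "?d v * ?d a \<le> 1" using pos dle[of v] dle[of a] by (intro mult_le_one) auto
    then have "?d v * ?d a + (norm (v - a))\<^sup>2 \<le> 5" using le4[of v a] assms by auto
    then have "?d (f v) * (?d v * ?d a + (norm (v - a))\<^sup>2) \<le> ?d (f v) * 5"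
      using pos by (intro mult_left_mono) auto
    then show ?thesis using key[OF assms(2)] by simp
  qed
  have w: "?d (f v) \<le> 2 * (1 - norm (f v))" using norm_square_defect_bounds(2)[OF fh(2)] .
  show "1 - (norm a)\<^sup>2 \<le> 10 / (1 - (norm v)\<^sup>2) * (1 - norm (f v))"
    using A w pos by (simp add: field_simps)
  have Z: "?d (f z) * \<eta>\<^sup>2 \<le> ?d z * ?d a"
  proof -
    have "\<eta>\<^sup>2 \<le> (norm (z - a))\<^sup>2" using assms by (intro power_mono) auto
    then have "\<eta>\<^sup>2 \<le> ?d z * ?d a + (norm (z - a))\<^sup>2" using mult_pos_pos[OF pos(3,2)] by linarith
    then have "?d (f z) * \<eta>\<^sup>2 \<le> ?d (f z) * (?d z * ?d a + (norm (z - a))\<^sup>2)"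
      using pos by (intro mult_left_mono) auto
    then show ?thesis using key[OF assms(4)] by simp
  qed
  have "(norm (f z - f v))\<^sup>2 * (?d z * ?d v) = (norm (z - v))\<^sup>2 * (?d (f z) * ?d (f v))"
    using norm_diff_hquot[OF fh] norm_diff_hquot[OF assms(4,2)] iso(2)[OF assms(4,2)] by simp
  also have "\<dots> \<le> 4 * (?d (f z) * ?d (f v))"
    using le4[of z v] assms pos by (intro mult_right_mono) auto
  finally have "(norm (f z - f v))\<^sup>2 * (?d z * ?d v) * \<eta>\<^sup>2 \<le> 4 * (?d (f z) * ?d (f v)) * \<eta>\<^sup>2"
    by (rule mult_right_mono) simp
  also have "\<dots> = 4 * ?d (f v) * (?d (f z) * \<eta>\<^sup>2)" by simp
  also have "\<dots> \<le> 4 * ?d (f v) * (?d z * ?d a)" using Z pos by (intro mult_left_mono) auto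
  finally have "?d z * ((norm (f z - f v))\<^sup>2 * ?d v * \<eta>\<^sup>2) \<le> ?d z * (4 * ?d (f v) * ?d a)"
    by (simp add: mult_ac)
  then have "(norm (f z - f v))\<^sup>2 * ?d v * \<eta>\<^sup>2 \<le> 4 * ?d (f v) * ?d a"
    using pos(3) by (simp only: mult_le_cancel_left_pos)
  then have "?d v * ((norm (f z - f v))\<^sup>2 * ?d v * \<eta>\<^sup>2) \<le> ?d v * (4 * ?d (f v) * ?d a)"
    using pos by (intro mult_left_mono) auto
  also have "\<dots> = 4 * ?d (f v) * (?d v * ?d a)" by simp
  also have "\<dots> \<le> 4 * ?d (f v) * (5 * ?d (f v))" using A pos by (intro mult_left_mono) auto
  also have "\<dots> \<le> (5 * ?d (f v))\<^sup>2" by (rule sq)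
  finally have "(norm (f z - f v) * (?d v * \<eta>))\<^sup>2 \<le> (5 * ?d (f v))\<^sup>2"
    by (simp add: power2_eq_square mult_ac)
  then have "norm (f z - f v) * (?d v * \<eta>) \<le> 5 * ?d (f v)"
    by (rule power2_le_imp_le) (use pos in simp)
  also have "\<dots> \<le> 10 * (1 - norm (f v))" using w by simp
  finally show "norm (f z - f v) \<le> 10 / ((1 - (norm v)\<^sup>2) * \<eta>) * (1 - norm (f v))"
    using pos assms(6) by (simp add: field_simps)
qed

section \<open>Compactness of geodesic segments\<close>

lemma hquot_commute: "hquot x y = hquot y x"
  by (simp add: hquot_def norm_minus_commute mult.commute)

lemma tendsto_hquot:
  assumes "(f \<longlongrightarrow> x) F" "(g \<longlongrightarrow> y) F" "x \<in> hyp" "y \<in> hyp"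
  shows "((\<lambda>n. hquot (f n) (g n)) \<longlongrightarrow> hquot x y) F"
  unfolding hquot_def
  by (intro tendsto_intros assms) (use norm_square_less_1 assms in force)

lemma hyp_geodesic_in_hyp: "hyp_geodesic g u v \<Longrightarrow> t \<in> {0..hdist u v} \<Longrightarrow> g t \<in> hyp"
  by (auto simp: hyp_geodesic_def)

lemma hyp_geodesic_hquot:
  assumes "hyp_geodesic g u v" "s \<in> {0..hdist u v}" "t \<in> {0..hdist u v}"
  shows "1 + 2 * hquot (g s) (g t) = cosh (s - t)"
proof -
  have "hdist (g s) (g t) = \<bar>s - t\<bar>" using assms by (auto simp: hyp_geodesic_def)
  then show ?thesis
    using cosh_hdist[of "g s" "g t"] hyp_geodesic_in_hyp[OF assms(1)] assms(2,3) by simp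
qed

text \<open>The danger is a limit point on the sphere, where \<open>hquot\<close> degenerates. The
  bound \<open>hquot u (g n t) \<le> hquot u v\<close>, multiplied out, survives the limit and would
  force \<open>u = G t\<close> on the sphere.\<close>

lemma hyp_geodesic_limit:
  assumes uv: "u \<in> hyp" "v \<in> hyp" and g: "\<And>n. hyp_geodesic (g n) u v"
    and lim: "\<And>t. t \<in> {0..hdist u v} \<Longrightarrow> (\<lambda>n. g n t) \<longlonglongrightarrow> G t"
  shows "hyp_geodesic G u v"
proof -
  let ?D = "hdist u v"
  have D: "0 \<le> ?D" by (rule hdist_nonneg[OF uv])
  have G0: "G 0 = u"
    using lim[of 0] g D by (simp add: hyp_geodesic_def LIMSEQ_const_iff)
  have GD: "G ?D = v"
    using lim[of ?D] g D by (simp add: hyp_geodesic_def LIMSEQ_const_iff)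
  have Gh: "G t \<in> hyp" if t: "t \<in> {0..?D}" for t
  proof -
    have "(norm (u - g n t))\<^sup>2 \<le> hquot u v * ((1 - (norm u)\<^sup>2) * (1 - (norm (g n t))\<^sup>2))" for n
    proof -
      have gt: "g n t \<in> hyp" by (rule hyp_geodesic_in_hyp[OF g t])
      have "hdist (g n 0) (g n t) = \<bar>0 - t\<bar>" using g[of n] t D unfolding hyp_geodesic_def by auto
      then have "hdist u (g n t) \<le> hdist u v" using g[of n] t unfolding hyp_geodesic_def by auto
      then have "hquot u (g n t) \<le> hquot u v" using hquot_le_iff[OF uv(1) gt uv] by simp
      then show ?thesis unfolding norm_diff_hquot[OF uv(1) gt]
        using norm_square_less_1[OF uv(1)] norm_square_less_1[OF gt] by (intro mult_right_mono) auto
    qed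
    then have le: "(norm (u - G t))\<^sup>2 \<le> hquot u v * ((1 - (norm u)\<^sup>2) * (1 - (norm (G t))\<^sup>2))"
      by (intro LIMSEQ_le[of "\<lambda>n. (norm (u - g n t))\<^sup>2" _ "\<lambda>n. hquot u v * ((1 - (norm u)\<^sup>2) * (1 - (norm (g n t))\<^sup>2))"]
          tendsto_intros lim t) auto
    have "norm (g n t) \<le> 1" for n using hyp_geodesic_in_hyp[OF g t, of n] by (simp add: hyp_iff)
    then have "norm (G t) \<le> 1" by (intro LIMSEQ_le_const2[OF tendsto_norm[OF lim[OF t]]]) auto
    moreover have "norm (G t) \<noteq> 1"
    proof
      assume "norm (G t) = 1"
      then have "u = G t" using le by simp
      then show False using \<open>norm (G t) = 1\<close> uv by (simp add: hyp_iff)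
    qed
    ultimately show ?thesis by (simp add: hyp_iff)
  qed
  have "hdist (G s) (G t) = \<bar>s - t\<bar>" if st: "s \<in> {0..?D}" "t \<in> {0..?D}" for s t
  proof -
    have "(\<lambda>n. 1 + 2 * hquot (g n s) (g n t)) \<longlonglongrightarrow> 1 + 2 * hquot (G s) (G t)"
      by (intro tendsto_intros tendsto_hquot lim st Gh)
    then have "cosh (s - t) = 1 + 2 * hquot (G s) (G t)"
      by (simp add: hyp_geodesic_hquot[OF g st] LIMSEQ_const_iff)
    then have "hdist (G s) (G t) = arcosh (cosh \<bar>s - t\<bar>)" by (simp add: hdist_hquot)
    also have "\<dots> = \<bar>s - t\<bar>" by (rule arcosh_cosh_real) simp
    finally show ?thesis .
  qed
  then show ?thesis using G0 GD Gh by (auto simp: hyp_geodesic_def)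
qed

text \<open>As the segment is a union over all geodesics from \<open>u\<close> to \<open>v\<close>,
  a convergent sequence of its points comes with a varying geodesic. Arzela-Ascoli extracts a
  uniform limit, again a geodesic, and the parameters converge along a further subsequence.\<close>

lemma compact_hyp_segment:
  assumes uv: "u \<in> hyp" "v \<in> hyp"
  shows "compact (hyp_segment u v)"
proof -
  let ?D = "hdist u v"
  have "hyp_segment u v \<subseteq> ball 0 1"
    unfolding hyp_segment_def hyp_geodesic_def hyp_def by blast
  then have "bounded (hyp_segment u v)" by (rule bounded_subset[OF bounded_ball])
  moreover have "closed (hyp_segment u v)"
    unfolding closed_sequential_limits
  proof (intro allI impI, elim conjE)
    fix x l assume "\<forall>n. x n \<in> hyp_segment u v" and xl: "x \<longlonglongrightarrow> l"
    then have "\<forall>n. \<exists>g s. hyp_geodesic g u v \<and> s \<in> {0..?D} \<and> x n = g s"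
      unfolding hyp_segment_def by blast
    then obtain g s where g: "\<And>n. hyp_geodesic (g n) u v" and s: "\<And>n. s n \<in> {0..?D}"
      and x: "\<And>n. x n = g n (s n)" by metis
    \<comment> \<open>Squared Euclidean displacement is at most \<open>hquot\<close>, which along a
      geodesic is \<open>(cosh (t - y) - 1) / 2\<close>. Continuity of \<open>cosh\<close> at
      \<open>0\<close> thus gives one modulus for all geodesics.\<close>
    have equi: "\<exists>d>0. \<forall>n y. y \<in> {0..?D} \<and> norm (t - y) < d \<longrightarrow> norm (g n t - g n y) < e"
      if t: "t \<in> {0..?D}" "0 < e" for t e :: real
    proof -
      have "isCont (cosh :: real \<Rightarrow> real) 0" by (intro continuous_intros)
      moreover have "0 < 2 * e\<^sup>2" using t(2) by simp
      ultimately obtain d where "d > 0" "\<forall>h. dist h 0 < d \<longrightarrow> dist (cosh h) (cosh 0 :: real) < 2 * e\<^sup>2"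
        unfolding continuous_at_eps_delta by blast
      then have d: "d > 0" "\<And>h. \<bar>h\<bar> < d \<Longrightarrow> \<bar>cosh h - 1\<bar> < (2 * e\<^sup>2 :: real)" by (auto simp: dist_real_def)
      have "norm (g n t - g n y) < e" if y: "y \<in> {0..?D}" "norm (t - y) < d" for n y
      proof -
        have "(norm (g n t - g n y))\<^sup>2 \<le> hquot (g n t) (g n y)"
          by (intro norm_square_le_hquot hyp_geodesic_in_hyp[OF g] t y)
        also have "\<dots> = (cosh (t - y) - 1) / 2" using hyp_geodesic_hquot[OF g t(1) y(1), of n] by simp
        also have "\<dots> < e\<^sup>2" using d(2)[of "t - y"] y(2) by simp
        finally show ?thesis by (rule power2_less_imp_less) (use t in simp)
      qed
      then show ?thesis using d(1) by blast
    qed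
    have bdd: "norm (g n t) \<le> 1" if "t \<in> {0..?D}" for n t
      using hyp_geodesic_in_hyp[OF g that, of n] by (simp add: hyp_iff)
    obtain G k where G: "continuous_on {0..?D} G" and k: "strict_mono (k :: nat \<Rightarrow> nat)"
      and conv: "\<And>e. 0 < e \<Longrightarrow> \<exists>N. \<forall>n t. n \<ge> N \<and> t \<in> {0..?D} \<longrightarrow> norm (g (k n) t - G t) < e"
      by (rule Arzela_Ascoli[of "{0..?D}" g 1]) (use equi bdd in auto)
    have lim: "(\<lambda>n. g (k n) t) \<longlonglongrightarrow> G t" if "t \<in> {0..?D}" for t
      using conv that unfolding LIMSEQ_iff by blast
    have geo: "hyp_geodesic G u v" by (rule hyp_geodesic_limit[OF uv, of "\<lambda>n. g (k n)"]) (use g lim in auto)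
    obtain s0 r where s0: "s0 \<in> {0..?D}" and r: "strict_mono (r :: nat \<Rightarrow> nat)" and sr: "((s \<circ> k) \<circ> r) \<longlonglongrightarrow> s0"
      using compact_Icc[of 0 ?D] s unfolding compact_def by (metis comp_apply)
    have "(\<lambda>n. G (s (k (r n)))) \<longlonglongrightarrow> G s0"
      by (rule continuous_on_tendsto_compose[OF G]) (use sr s s0 in \<open>auto simp: o_def\<close>)
    moreover have "(\<lambda>n. g (k (r n)) (s (k (r n))) - G (s (k (r n)))) \<longlonglongrightarrow> 0"
      unfolding LIMSEQ_iff
    proof (intro allI impI)
      fix e :: real assume "0 < e"
      then obtain N where N: "\<forall>n t. n \<ge> N \<and> t \<in> {0..?D} \<longrightarrow> norm (g (k n) t - G t) < e" using conv by blast
      have "norm (g (k (r n)) (s (k (r n))) - G (s (k (r n))) - 0) < e" if "n \<ge> N" for n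
        using N[rule_format, of "r n" "s (k (r n))"] s order_trans[OF that seq_suble[OF r]] by simp
      then show "\<exists>N. \<forall>n\<ge>N. norm (g (k (r n)) (s (k (r n))) - G (s (k (r n))) - 0) < e" by blast
    qed
    ultimately have "(\<lambda>n. G (s (k (r n))) + (g (k (r n)) (s (k (r n))) - G (s (k (r n))))) \<longlonglongrightarrow> G s0 + 0"
      by (rule tendsto_add)
    then have "(\<lambda>n. x (k (r n))) \<longlonglongrightarrow> G s0" by (simp add: x)
    moreover have "(\<lambda>n. x (k (r n))) \<longlonglongrightarrow> l"
      using LIMSEQ_subseq_LIMSEQ[OF LIMSEQ_subseq_LIMSEQ[OF xl k] r] by (simp add: o_def)
    ultimately have "l = G s0" by (rule LIMSEQ_unique[symmetric])
    then show "l \<in> hyp_segment u v" using geo s0 unfolding hyp_segment_def by blast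
  qed
  ultimately show ?thesis by (simp add: compact_eq_bounded_closed)
qed

lemma hyp_segment_hquot:
  assumes "u \<in> hyp" "v \<in> hyp" "z \<in> hyp_segment u v"
  shows "z \<in> hyp" "hquot u z \<le> hquot u v" "hquot v z \<le> hquot u v"
proof -
  obtain g t where g: "hyp_geodesic g u v" and t: "t \<in> {0..hdist u v}" and z: "z = g t"
    using assms(3) unfolding hyp_segment_def by blast
  show zh: "z \<in> hyp" using hyp_geodesic_in_hyp[OF g t] z by simp
  have D: "0 \<in> {0..hdist u v}" "hdist u v \<in> {0..hdist u v}" using hdist_nonneg[OF assms(1,2)] by auto
  have "hdist (g 0) (g t) = \<bar>0 - t\<bar>" "hdist (g (hdist u v)) (g t) = \<bar>hdist u v - t\<bar>"
    using g D t unfolding hyp_geodesic_def by blast+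
  then have "hdist u z \<le> hdist u v" "hdist v z \<le> hdist u v"
    using g t z unfolding hyp_geodesic_def by auto
  then show "hquot u z \<le> hquot u v" "hquot v z \<le> hquot u v"
    using hquot_le_iff assms zh by auto
qed

lemma edge_segment_doubleton: "edge_segment {u, v} = hyp_segment u v \<union> hyp_segment v u"
proof
  show "edge_segment {u, v} \<subseteq> hyp_segment u v \<union> hyp_segment v u"
    unfolding edge_segment_def by (auto simp: doubleton_eq_iff)
  show "hyp_segment u v \<union> hyp_segment v u \<subseteq> edge_segment {u, v}"
    unfolding edge_segment_def by (auto simp: insert_commute)
qed

lemma compact_subset_cball_less_1:
  fixes K :: "'a::euclidean_space set"
  assumes "compact K" "K \<subseteq> hyp"
  shows "\<exists>n. K \<subseteq> cball 0 (1 - 1 / real (Suc n))"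
proof (cases "K = {}")
  case False
  have "compact (norm ` K)" by (intro compact_continuous_image continuous_intros assms)
  then obtain s where s: "s \<in> norm ` K" "\<And>t. t \<in> norm ` K \<Longrightarrow> t \<le> s"
    using compact_attains_sup[of "norm ` K"] False by blast
  then have "0 < 1 - s" using assms(2) by (auto simp: hyp_iff)
  then obtain n where "1 / real (Suc n) < 1 - s" using nat_approx_posE by metis
  then have "norm x \<le> 1 - 1 / real (Suc n)" if "x \<in> K" for x using s(2)[of "norm x"] that by fastforce
  then show ?thesis by (intro exI[of _ n]) auto
qed simp

text \<open>With countably many radii, boundary events become countable combinations of connection
  events.\<close>

lemma in_closure_iff_balls: "x \<in> closure S \<longleftrightarrow> (\<forall>n. S \<inter> ball x (1 / real (Suc n)) \<noteq> {})"
  for x :: "'a::metric_space"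
proof
  assume "x \<in> closure S"
  then have *: "\<And>e. 0 < e \<Longrightarrow> \<exists>y\<in>S. dist y x < e" by (simp add: closure_approachable)
  show "\<forall>n. S \<inter> ball x (1 / real (Suc n)) \<noteq> {}"
  proof
    fix n
    have "0 < 1 / real (Suc n)" by simp
    from *[OF this] obtain y where "y \<in> S" "dist y x < 1 / real (Suc n)" by blast
    then have "y \<in> S \<inter> ball x (1 / real (Suc n))" by (simp only: Int_iff mem_ball dist_commute)
    then show "S \<inter> ball x (1 / real (Suc n)) \<noteq> {}" by blast
  qed
next
  assume *: "\<forall>n. S \<inter> ball x (1 / real (Suc n)) \<noteq> {}"
  show "x \<in> closure S"
    unfolding closure_approachable
  proof (intro allI impI)
    fix e :: real assume "0 < e"
    then obtain n where n: "1 / real (Suc n) < e" using nat_approx_posE by metis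
    obtain y where "y \<in> S" "y \<in> ball x (1 / real (Suc n))" using * by blast
    then show "\<exists>y\<in>S. dist y x < e" using n by (intro bexI[of _ y]) (auto simp: dist_commute)
  qed
qed

lemma half_power_times_poly_bounded: "\<exists>B>0. \<forall>k. (real k + 1) ^ d * (1/2) ^ k \<le> B"
proof -
  have "(\<lambda>k. (real k + 1) ^ d * (1/2) ^ k) \<longlonglongrightarrow> 0"
    by real_asymp
  then have "Bseq (\<lambda>k. (real k + 1) ^ d * (1/2) ^ k)"
    by (intro convergent_imp_Bseq convergentI)
  then obtain B where "B > 0" "\<And>k. norm ((real k + 1) ^ d * (1/2) ^ k) \<le> B" by (auto elim: BseqE)
  then show ?thesis by (intro exI[of _ B]) (auto intro: order_trans[OF abs_ge_self])
qed

section \<open>Transitive graphs below the threshold\<close>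

locale hyp_graph =
  fixes V :: "'a::euclidean_space set" and E :: "'a set set"
  assumes embedded: "embedded_simple_graph V E"
    and locally_finite: "locally_finite_graph V E"
    and transitive: "transitive_under_isometries V E"
begin

lemma V_hyp: "v \<in> V \<Longrightarrow> v \<in> hyp"
  using embedded by (auto simp: embedded_simple_graph_def)

lemma E_pairs: "E \<subseteq> {{u, v} | u v. u \<in> V \<and> v \<in> V \<and> u \<noteq> v}"
  using embedded by (simp add: embedded_simple_graph_def)

lemma E_cases:
  assumes "e \<in> E" obtains u v where "e = {u, v}" "u \<in> V" "v \<in> V" "u \<noteq> v"
  using E_pairs assms by blast

lemma E_finite: "e \<in> E \<Longrightarrow> finite e"
  by (erule E_cases) simp

lemma E_V: "e \<in> E \<Longrightarrow> e \<subseteq> V"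
  by (erule E_cases) simp

lemma ends_in_segment: "e \<in> E \<Longrightarrow> edge_segment e \<inter> V = e"
  using embedded by (simp add: embedded_simple_graph_def)

lemma finite_V_compact: "compact K \<Longrightarrow> K \<subseteq> hyp \<Longrightarrow> finite (V \<inter> K)"
  and finite_E_compact: "compact K \<Longrightarrow> K \<subseteq> hyp \<Longrightarrow> finite {e \<in> E. edge_segment e \<inter> K \<noteq> {}}"
  using locally_finite by (auto simp: locally_finite_graph_def)

lemma isometry_exists:
  assumes "u \<in> V" "v \<in> V"
  obtains f where "hyp_isometry f" "graph_automorphism V E f" "f u = v"
proof -
  obtain \<Gamma> where \<Gamma>: "\<forall>f\<in>\<Gamma>. hyp_isometry f \<and> graph_automorphism V E f" "\<forall>u\<in>V. \<forall>v\<in>V. \<exists>f\<in>\<Gamma>. f u = v"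
    using transitive unfolding transitive_under_isometries_def by (elim exE conjE)
  from \<Gamma>(2) assms obtain f where "f \<in> \<Gamma>" "f u = v" by blast
  with \<Gamma>(1) that show ?thesis by blast
qed

section \<open>Local finiteness made uniform by transitivity\<close>

definition exhaustion :: "nat \<Rightarrow> 'a set" where
  "exhaustion n = V \<inter> cball 0 (1 - 1 / real (Suc n))"

lemma finite_exhaustion: "finite (exhaustion n)"
  unfolding exhaustion_def
proof (rule finite_V_compact)
  have "0 < 1 / real (Suc n)" by simp
  then show "cball 0 (1 - 1 / real (Suc n)) \<subseteq> hyp" unfolding hyp_iff subset_iff mem_cball_0 by linarith
qed simp

lemma incseq_exhaustion: "incseq exhaustion"
proof (rule monoI)
  fix m n :: nat assume "m \<le> n"
  then have "1 / real (Suc n) \<le> 1 / real (Suc m)" by (simp add: frac_le)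
  then show "exhaustion m \<le> exhaustion n" unfolding exhaustion_def by (intro Int_mono subset_cball) auto
qed

lemma UN_exhaustion: "(\<Union>n. exhaustion n) = V"
proof
  show "V \<subseteq> (\<Union>n. exhaustion n)"
  proof
    fix v assume v: "v \<in> V"
    then have "0 < 1 - norm v" using V_hyp by (simp add: hyp_iff)
    then obtain n where "1 / real (Suc n) < 1 - norm v" using nat_approx_posE by metis
    then show "v \<in> (\<Union>n. exhaustion n)" using v by (auto simp: exhaustion_def intro!: exI[of _ n])
  qed
qed (auto simp: exhaustion_def)

lemma countable_V: "countable V"
proof -
  have "countable (\<Union>n. exhaustion n)" by (simp add: finite_exhaustion countable_finite)
  then show ?thesis by (simp only: UN_exhaustion)
qed

lemma countable_E: "countable E"
proof (rule countable_subset)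
  show "E \<subseteq> (\<lambda>(u, v). {u, v}) ` (V \<times> V)" using E_pairs by auto
  show "countable ((\<lambda>(u, v). {u, v}) ` (V \<times> V))" using countable_V by simp
qed

text \<open>Every edge is the isometric image of an edge at one fixed vertex \<open>o'\<close>, and
  local finiteness for the compact set \<open>{o'}\<close> leaves finitely many of those.\<close>

lemma edge_hquot_bounded: "\<exists>D\<ge>0. \<forall>u v. {u, v} \<in> E \<longrightarrow> hquot u v \<le> D"
proof (cases "V = {}")
  case True
  then have "E = {}" using E_pairs by auto
  then show ?thesis by auto
next
  case False
  then obtain o' where o: "o' \<in> V" by auto
  let ?N = "{e \<in> E. edge_segment e \<inter> {o'} \<noteq> {}}"
  have finN: "finite ?N" by (rule finite_E_compact) (use V_hyp[OF o] in auto)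
  have "finite (\<Union>?N)" using finN E_finite by auto
  then have "finite (hquot o' ` \<Union>?N)" by simp
  then obtain D where D: "\<And>z. z \<in> \<Union>?N \<Longrightarrow> hquot o' z \<le> D"
    by (meson bdd_above_finite bdd_above.unfold finite_imageI imageI)
  have "hquot u v \<le> max D 0" if "{u, v} \<in> E" for u v
  proof -
    have uv: "u \<in> V" "v \<in> V" using E_V[OF that] by auto
    obtain f where f: "hyp_isometry f" "graph_automorphism V E f" "f o' = u"
      using isometry_exists[OF o uv(1)] .
    have "f ` V = V" using f(2) by (simp add: graph_automorphism_def bij_betw_def)
    then obtain v' where v': "v' \<in> V" "v = f v'" using uv(2) by blast
    then have e: "{o', v'} \<in> E" using f o that by (auto simp: graph_automorphism_def)
    then have "o' \<in> edge_segment {o', v'}" using ends_in_segment[OF e] by blast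
    then have "v' \<in> \<Union>?N" using e by auto
    then have "hquot o' v' \<le> D" by (rule D)
    moreover have "hquot u v = hquot o' v'"
      using hyp_isometry_hquot(2)[OF f(1), of o' v'] V_hyp o v' f by auto
    ultimately show ?thesis by simp
  qed
  then show ?thesis by (intro exI[of _ "max D 0"]) auto
qed

text \<open>A small Euclidean ball around one vertex contains finitely many others, which gives a
  gap there; transitivity spreads it to all vertices. A Euclidean gap is enough, because squared
  Euclidean distance bounds \<open>hquot\<close> from below.\<close>

lemma uniformly_discrete: "\<exists>c>0. \<forall>u\<in>V. \<forall>v\<in>V. u \<noteq> v \<longrightarrow> c \<le> hquot u v"
proof (cases "V = {}")
  case False
  then obtain o' where o: "o' \<in> V" by auto
  have oh: "norm o' < 1" using V_hyp[OF o] by (simp add: hyp_iff)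
  define r where "r = (1 - norm o') / 2"
  have r: "0 < r" using oh by (simp add: r_def)
  let ?N = "V \<inter> cball o' r - {o'}"
  have "cball o' r \<subseteq> hyp"
  proof
    fix x assume "x \<in> cball o' r"
    then have "norm (x - o') \<le> r" by (simp add: dist_norm norm_minus_commute)
    then show "x \<in> hyp" using norm_triangle_sub[of x o'] oh by (simp add: hyp_iff r_def field_simps)
  qed
  then have fin: "finite ?N" using finite_V_compact[of "cball o' r"] by auto
  define c where "c = Min (insert (r\<^sup>2) ((\<lambda>z. (norm (o' - z))\<^sup>2) ` ?N))"
  have c0: "0 < c" unfolding c_def using fin r by (subst Min_gr_iff) auto
  have c: "c \<le> hquot o' z" if z: "z \<in> V" "z \<noteq> o'" for z
  proof -
    have "c \<le> (norm (o' - z))\<^sup>2"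
    proof (cases "z \<in> cball o' r")
      case True
      then show ?thesis unfolding c_def using z fin by (intro Min_le) auto
    next
      case False
      then have "r\<^sup>2 \<le> (norm (o' - z))\<^sup>2" using r by (intro power_mono) (auto simp: dist_norm)
      moreover have "c \<le> r\<^sup>2" unfolding c_def using fin by (intro Min_le) auto
      ultimately show ?thesis by simp
    qed
    then show ?thesis using norm_square_le_hquot[of o' z] V_hyp o z by force
  qed
  have "c \<le> hquot u v" if uv: "u \<in> V" "v \<in> V" "u \<noteq> v" for u v
  proof -
    obtain f where f: "hyp_isometry f" "graph_automorphism V E f" "f o' = u"
      using isometry_exists[OF o uv(1)] .
    have "f ` V = V" using f(2) by (simp add: graph_automorphism_def bij_betw_def)
    then obtain v' where v': "v' \<in> V" "v = f v'" using uv(2) by blast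
    have "hquot u v = hquot o' v'"
      using hyp_isometry_hquot(2)[OF f(1), of o' v'] V_hyp o v' f by auto
    moreover have "v' \<noteq> o'" using v' f uv by auto
    ultimately show ?thesis using c[OF v'(1)] by simp
  qed
  then show ?thesis using c0 by blast
qed (auto intro: exI[of _ 1])

section \<open>Measurability of boundary events, and the parameter \<open>0\<close>\<close>

lemma open_edges_induced: "open_edges E \<omega> = {e \<in> induced E V. \<omega> e}"
  using E_V by (auto simp: open_edges_def induced_def)

lemma joined_open_V: "joined (open_edges E \<omega>) v u \<Longrightarrow> v \<in> V \<Longrightarrow> u \<in> V"
  by (induction rule: joined_induct) (use E_V in \<open>auto simp: open_edges_def\<close>)

lemmas reach_event_exhaustion =
  reach_event_limit[OF incseq_exhaustion UN_exhaustion E_finite finite_exhaustion]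

lemma sets_joined_open:
  assumes "0 \<le> p" "p \<le> 1"
  shows "{\<omega> \<in> space (percolation E p). joined (open_edges E \<omega>) v u} \<in> sets (percolation E p)"
proof -
  have "reach_event E p V v {u} \<in> sets (percolation E p)"
    by (rule reach_event_exhaustion(1)) (use assms in auto)
  then show ?thesis by (simp add: reach_event_def open_edges_induced)
qed

lemma sets_open:
  assumes "0 \<le> p" "p \<le> 1" "e \<in> E"
  shows "{\<omega> \<in> space (percolation E p). \<omega> e} \<in> sets (percolation E p)"
  using finite_event(1)[of "{e}" E p "\<lambda>S. e \<in> S"] assms by simp

text \<open>This replaces the uncountably many points of a drawn cluster by countably many vertices
  and edges, whose membership in the cluster is measurable.\<close>

lemma cluster_meets_iff:
  assumes "v \<in> V"
  shows "cluster E \<omega> v \<inter> B \<noteq> {} \<longleftrightarrow> (\<exists>u\<in>V \<inter> B. joined (open_edges E \<omega>) v u) \<or>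
    (\<exists>e\<in>{e \<in> E. edge_segment e \<inter> B \<noteq> {}}. \<omega> e \<and> (\<forall>u\<in>e. joined (open_edges E \<omega>) v u))"
proof
  assume "cluster E \<omega> v \<inter> B \<noteq> {}"
  then obtain y where y: "y \<in> cluster E \<omega> v" "y \<in> B" by blast
  show "(\<exists>u\<in>V \<inter> B. joined (open_edges E \<omega>) v u) \<or>
    (\<exists>e\<in>{e \<in> E. edge_segment e \<inter> B \<noteq> {}}. \<omega> e \<and> (\<forall>u\<in>e. joined (open_edges E \<omega>) v u))"
  proof (cases "y \<in> cluster_vertices E \<omega> v")
    case True
    then show ?thesis using y joined_open_V[OF _ assms] by (auto simp: cluster_vertices_def)
  next
    case False
    then obtain e where "e \<in> open_edges E \<omega>" "e \<subseteq> cluster_vertices E \<omega> v" "y \<in> edge_segment e"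
      using y by (auto simp: cluster_def)
    then show ?thesis using y by (intro disjI2 bexI[of _ e]) (auto simp: open_edges_def cluster_vertices_def)
  qed
next
  assume "(\<exists>u\<in>V \<inter> B. joined (open_edges E \<omega>) v u) \<or>
    (\<exists>e\<in>{e \<in> E. edge_segment e \<inter> B \<noteq> {}}. \<omega> e \<and> (\<forall>u\<in>e. joined (open_edges E \<omega>) v u))"
  then show "cluster E \<omega> v \<inter> B \<noteq> {}"
  proof
    assume "\<exists>u\<in>V \<inter> B. joined (open_edges E \<omega>) v u"
    then show ?thesis by (auto simp: cluster_def cluster_vertices_def)
  next
    assume "\<exists>e\<in>{e \<in> E. edge_segment e \<inter> B \<noteq> {}}. \<omega> e \<and> (\<forall>u\<in>e. joined (open_edges E \<omega>) v u)"
    then obtain e y where "e \<in> E" "y \<in> edge_segment e" "y \<in> B" "\<omega> e" "\<forall>u\<in>e. joined (open_edges E \<omega>) v u"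
      by blast
    then have "y \<in> cluster E \<omega> v"
      unfolding cluster_def by (intro UnI2 UnionI[of "edge_segment e"]) (auto simp: open_edges_def cluster_vertices_def)
    then show ?thesis using \<open>y \<in> B\<close> by blast
  qed
qed

lemma sets_boundary_event:
  assumes "v \<in> V" "0 \<le> p" "p \<le> 1"
  shows "{\<omega> \<in> space (percolation E p). x \<in> boundary_at_infinity (cluster E \<omega> v)} \<in> sets (percolation E p)"
proof (cases "x \<in> hyp")
  case False
  then have "{\<omega> \<in> space (percolation E p). x \<in> boundary_at_infinity (cluster E \<omega> v)} =
     {\<omega> \<in> space (percolation E p). \<forall>n. cluster E \<omega> v \<inter> ball x (1 / real (Suc n)) \<noteq> {}}"
    by (auto simp: boundary_at_infinity_def in_closure_iff_balls)
  also have "\<dots> \<in> sets (percolation E p)"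
    unfolding cluster_meets_iff[OF assms(1)]
    by (intro sets.sets_Collect_countable_All sets.sets_Collect_disj sets.sets_Collect_countable_Ex'
        sets.sets_Collect_conj sets.sets_Collect_countable_All' sets_joined_open sets_open assms(2,3))
      (auto intro: countable_subset[OF _ countable_V] countable_subset[OF _ countable_E] countable_finite E_finite)
  finally show ?thesis .
qed (simp add: boundary_at_infinity_def)

text \<open>Nonemptiness gives the supremum \<open>p\<^sub>0 E v\<close> its meaning: a number below
  it has a null parameter above it. At parameter \<open>0\<close> almost surely all edges are closed
  and the cluster is a single point.\<close>

lemma zero_in_null_boundary_params:
  assumes "v \<in> V"
  shows "0 \<in> null_boundary_params E v"
proof -
  interpret prob_space "percolation E 0" by (rule prob_space_percolation)
  have "AE \<omega> in percolation E 0. \<not> \<omega> e" if e: "e \<in> E" for e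
  proof -
    have "measure (percolation E 0) {\<omega> \<in> space (percolation E 0). e \<in> {e' \<in> {e}. \<omega> e'}} =
        bern_exp {e} 0 (\<lambda>S. of_bool (e \<in> S))"
      by (rule finite_event(2)) (use e in auto)
    also have "\<dots> = 0" using bern_exp_insert[of "{}" e 0 "\<lambda>S. of_bool (e \<in> S)"] by simp
    finally have "measure (percolation E 0) {\<omega> \<in> space (percolation E 0). \<omega> e} = 0" by simp
    then have "{\<omega> \<in> space (percolation E 0). \<omega> e} \<in> null_sets (percolation E 0)"
      using sets_open[OF _ _ e, of 0] by (simp add: null_sets_def emeasure_eq_measure)
    then show ?thesis by (rule AE_I') auto
  qed
  then have closed: "AE \<omega> in percolation E 0. \<forall>e\<in>E. \<not> \<omega> e"
    by (simp add: AE_ball_countable[OF countable_E])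
  have "{\<omega> \<in> space (percolation E 0). x \<in> boundary_at_infinity (cluster E \<omega> v)} \<in> null_sets (percolation E 0)" for x
  proof -
    have "AE \<omega> in percolation E 0. \<not> x \<in> boundary_at_infinity (cluster E \<omega> v)"
      using closed
    proof (eventually_elim, intro notI)
      fix \<omega> assume *: "\<forall>e\<in>E. \<not> \<omega> e" and x: "x \<in> boundary_at_infinity (cluster E \<omega> v)"
      have "open_edges E \<omega> = {}" using * by (auto simp: open_edges_def)
      moreover have "u = v" if "joined {} v u" for u
        using that by (induction rule: joined_induct) auto
      ultimately have "cluster E \<omega> v = {v}" by (auto simp: cluster_def cluster_vertices_def)
      then show False using x V_hyp[OF assms] by (simp add: boundary_at_infinity_def)
    qed
    then show ?thesis using AE_iff_null[of "percolation E 0" "\<lambda>\<omega>. \<not> x \<in> boundary_at_infinity (cluster E \<omega> v)"]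
      sets_boundary_event[OF assms, of 0 x] by simp
  qed
  then show ?thesis by (simp add: null_boundary_params_def)
qed

section \<open>Exit sets avoiding a point at infinity\<close>

lemma null_param_small:
  assumes "v \<in> V" "p \<in> null_boundary_params E v" "x \<in> hyp_boundary" "0 < c"
  shows "\<exists>\<eta>>0. \<forall>\<Lambda>. finite \<Lambda> \<and> \<Lambda> \<subseteq> V \<longrightarrow> reach_prob E \<Lambda> p v (\<Lambda> \<inter> ball x \<eta>) < c"
proof -
  interpret prob_space "percolation E p" by (rule prob_space_percolation)
  have p: "0 \<le> p" "p \<le> 1" using assms(2) by (auto simp: null_boundary_params_def)
  \<comment> \<open>These events decrease to a subset of the null event, so one of them has
    probability below \<open>c\<close>. It contains the corresponding event of every finite
    \<open>\<Lambda>\<close>, which makes the radius uniform in \<open>\<Lambda>\<close>.\<close>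
  define D where "D = (\<lambda>m. reach_event E p V v (V \<inter> ball x (1 / real (Suc m))))"
  have D: "D m \<in> sets (percolation E p)" for m
    unfolding D_def by (rule reach_event_exhaustion(1)) (use p in auto)
  have "decseq D"
    unfolding D_def
  proof (rule antimonoI)
    fix m n :: nat assume "m \<le> n"
    then have "1 / real (Suc n) \<le> 1 / real (Suc m)" by (simp add: frac_le)
    then show "reach_event E p V v (V \<inter> ball x (1 / real (Suc n))) \<le> reach_event E p V v (V \<inter> ball x (1 / real (Suc m)))"
      by (intro reach_event_mono Int_mono subset_ball) auto
  qed
  then have lim: "(\<lambda>m. prob (D m)) \<longlonglongrightarrow> prob (\<Inter>m. D m)"
    using D by (intro finite_Lim_measure_decseq) auto
  have null: "{\<omega> \<in> space (percolation E p). x \<in> boundary_at_infinity (cluster E \<omega> v)} \<in> null_sets (percolation E p)"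
    using assms by (auto simp: null_boundary_params_def)
  have "(\<Inter>m. D m) \<subseteq> {\<omega> \<in> space (percolation E p). x \<in> boundary_at_infinity (cluster E \<omega> v)}"
  proof
    fix \<omega> assume "\<omega> \<in> (\<Inter>m. D m)"
    then have \<omega>: "\<omega> \<in> D m" for m by blast
    have "x \<in> closure (cluster E \<omega> v)"
      unfolding in_closure_iff_balls
    proof
      fix n
      show "cluster E \<omega> v \<inter> ball x (1 / real (Suc n)) \<noteq> {}"
        unfolding cluster_meets_iff[OF assms(1)]
        using \<omega>[of n] by (auto simp: D_def reach_event_def open_edges_induced)
    qed
    moreover have "x \<notin> hyp" using assms(3) by (auto simp: hyp_boundary_def hyp_def)
    ultimately show "\<omega> \<in> {\<omega> \<in> space (percolation E p). x \<in> boundary_at_infinity (cluster E \<omega> v)}"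
      using \<omega>[of 0] by (auto simp: boundary_at_infinity_def D_def reach_event_def)
  qed
  then have "prob (\<Inter>m. D m) \<le> prob {\<omega> \<in> space (percolation E p). x \<in> boundary_at_infinity (cluster E \<omega> v)}"
    using null by (intro finite_measure_mono) auto
  also have "\<dots> = 0" using null by (simp add: null_sets_def emeasure_eq_measure)
  finally have "prob (\<Inter>m. D m) < c" using assms(4) by simp
  then have "eventually (\<lambda>m. prob (D m) < c) sequentially"
    using lim by (rule order_tendstoD(2)[rotated])
  then obtain m where m: "prob (D m) < c" by (auto simp: eventually_sequentially)
  have "reach_prob E \<Lambda> p v (\<Lambda> \<inter> ball x (1 / real (Suc m))) < c" if "finite \<Lambda>" "\<Lambda> \<subseteq> V" for \<Lambda>
  proof -
    have "reach_prob E \<Lambda> p v (\<Lambda> \<inter> ball x (1 / real (Suc m))) = prob (reach_event E p \<Lambda> v (\<Lambda> \<inter> ball x (1 / real (Suc m))))"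
      using reach_event_finite(2)[OF that(1) p] by simp
    also have "\<dots> \<le> prob (D m)"
      unfolding D_def by (intro finite_measure_mono reach_event_mono D[unfolded D_def]) (use that in auto)
    finally show ?thesis using m by simp
  qed
  then show ?thesis by (intro exI[of _ "1 / real (Suc m)"]) auto
qed

text \<open>Isometries move points \<open>a\<close> of the open ball to the centre, so exit sets are
  needed for interior points near the sphere. Balls of half the radius \<open>\<eta> x\<close> cover
  the sphere, and the other half absorbs the move from \<open>x\<close> to \<open>a\<close>.\<close>

lemma uniform_exit_sets:
  assumes "v \<in> V" "0 \<le> p" "p < p'" "p' \<in> null_boundary_params E v"
  shows "\<exists>\<eta>>0. \<forall>a\<in>hyp. 1 - \<eta> < norm a \<longrightarrow> (\<forall>\<Lambda>. finite \<Lambda> \<and> v \<in> \<Lambda> \<and> \<Lambda> \<subseteq> V \<longrightarrow>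
    (\<exists>S. v \<in> S \<and> S \<subseteq> \<Lambda> \<and> (\<forall>z\<in>S. \<eta> \<le> norm (z - a)) \<and> exit_sum E \<Lambda> S p v \<le> 1/2))"
proof -
  have p': "p' \<le> 1" using assms(4) by (auto simp: null_boundary_params_def)
  have "\<exists>\<eta>>0. \<forall>\<Lambda>. finite \<Lambda> \<and> v \<in> \<Lambda> \<and> \<Lambda> \<subseteq> V \<longrightarrow>
      (\<exists>S. v \<in> S \<and> S \<subseteq> \<Lambda> \<and> (\<forall>z\<in>S. \<eta> \<le> norm (z - x)) \<and> exit_sum E \<Lambda> S p v \<le> 1/2)"
    if x: "x \<in> sphere 0 1" for x
  proof -
    obtain \<eta> where \<eta>: "\<eta> > 0" "\<And>\<Lambda>. finite \<Lambda> \<Longrightarrow> \<Lambda> \<subseteq> V \<Longrightarrow> reach_prob E \<Lambda> p' v (\<Lambda> \<inter> ball x \<eta>) < (p' - p) / 4"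
      using null_param_small[OF assms(1,4), of x "(p' - p) / 4"] x assms(3) by (auto simp: hyp_boundary_def)
    have "\<exists>S. v \<in> S \<and> S \<subseteq> \<Lambda> \<and> (\<forall>z\<in>S. \<eta> \<le> norm (z - x)) \<and> exit_sum E \<Lambda> S p v \<le> 1/2"
      if L: "finite \<Lambda>" "v \<in> \<Lambda>" "\<Lambda> \<subseteq> V" for \<Lambda>
    proof -
      obtain S where S: "v \<in> S" "S \<subseteq> \<Lambda> - \<Lambda> \<inter> ball x \<eta>" "exit_sum E \<Lambda> S p v \<le> 1/2"
        using exists_small_exit_sum[OF L(1) _ L(2) assms(2,3) p' \<eta>(2)[OF L(1,3)]] by auto
      moreover have "\<eta> \<le> norm (z - x)" if "z \<in> S" for z
        using S(2) that by (auto simp: dist_norm norm_minus_commute)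
      ultimately show ?thesis by auto
    qed
    then show ?thesis using \<eta>(1) by auto
  qed
  then obtain \<eta> where \<eta>: "\<And>x. x \<in> sphere 0 1 \<Longrightarrow> 0 < \<eta> x"
    "\<And>x \<Lambda>. x \<in> sphere 0 1 \<Longrightarrow> finite \<Lambda> \<Longrightarrow> v \<in> \<Lambda> \<Longrightarrow> \<Lambda> \<subseteq> V \<Longrightarrow>
      (\<exists>S. v \<in> S \<and> S \<subseteq> \<Lambda> \<and> (\<forall>z\<in>S. \<eta> x \<le> norm (z - x)) \<and> exit_sum E \<Lambda> S p v \<le> 1/2)"
    by metis
  have comp: "compact (sphere (0::'a) 1)" by simp
  have "x \<in> ball x (\<eta> x / 2)" if "x \<in> sphere 0 1" for x using \<eta>(1)[OF that] by simp
  then have "sphere 0 1 \<subseteq> (\<Union>x\<in>sphere 0 1. ball x (\<eta> x / 2))" by blast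
  then obtain X where X: "X \<subseteq> sphere 0 1" "finite X" "sphere 0 1 \<subseteq> (\<Union>x\<in>X. ball x (\<eta> x / 2))"
    by (rule compactE_image[OF comp open_ball])
  define U where "U = (\<Union>x\<in>X. ball x (\<eta> x / 2))"
  \<comment> \<open>The finite cover of the sphere contains a whole collar: the rest of the closed
    ball is compact and misses the sphere, so norms on it stay below some
    \<open>r < 1\<close>.\<close>
  have "compact (cball (0::'a) 1 - U)" unfolding U_def by (intro compact_diff) auto
  then have ck: "compact (norm ` (cball (0::'a) 1 - U))"
    by (intro compact_continuous_image continuous_intros)
  have "\<exists>r<1. \<forall>a\<in>cball (0::'a) 1 - U. norm a \<le> r"
  proof (cases "cball (0::'a) 1 - U = {}")
    case True
    then show ?thesis by (intro exI[of _ 0]) auto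
  next
    case False
    then obtain s where s: "s \<in> norm ` (cball (0::'a) 1 - U)" "\<forall>t\<in>norm ` (cball (0::'a) 1 - U). t \<le> s"
      using compact_attains_sup[OF ck] by blast
    then obtain a where a: "a \<in> cball 0 1 - U" "s = norm a" by blast
    then have "norm a \<noteq> 1" using X(3) unfolding U_def by auto
    then show ?thesis using s(2) a by (intro exI[of _ s]) auto
  qed
  then obtain r where r: "r < 1" "\<And>a. a \<in> cball (0::'a) 1 - U \<Longrightarrow> norm a \<le> r" by blast
  define \<delta> where "\<delta> = Min (insert (1 - r) ((\<lambda>x. \<eta> x / 2) ` X))"
  have \<delta>: "0 < \<delta>" "\<delta> \<le> 1 - r" "\<And>x. x \<in> X \<Longrightarrow> \<delta> \<le> \<eta> x / 2"
  proof -
    show "0 < \<delta>" unfolding \<delta>_def using X \<eta>(1) r by (subst Min_gr_iff) auto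
    show "\<delta> \<le> 1 - r" unfolding \<delta>_def using X(2) by (intro Min_le) auto
    show "\<delta> \<le> \<eta> x / 2" if "x \<in> X" for x unfolding \<delta>_def using X(2) that by (intro Min_le) auto
  qed
  have "\<exists>S. v \<in> S \<and> S \<subseteq> \<Lambda> \<and> (\<forall>z\<in>S. \<delta> \<le> norm (z - a)) \<and> exit_sum E \<Lambda> S p v \<le> 1/2"
    if a: "a \<in> hyp" "1 - \<delta> < norm a" and L: "finite \<Lambda>" "v \<in> \<Lambda>" "\<Lambda> \<subseteq> V" for a \<Lambda>
  proof -
    have "a \<in> U" using r(2)[of a] a \<delta>(2) by (auto simp: hyp_iff)
    then obtain x where x: "x \<in> X" "norm (x - a) < \<eta> x / 2" by (auto simp: U_def dist_norm)
    then obtain S where S: "v \<in> S" "S \<subseteq> \<Lambda>" "\<And>z. z \<in> S \<Longrightarrow> \<eta> x \<le> norm (z - x)" "exit_sum E \<Lambda> S p v \<le> 1/2"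
      using \<eta>(2)[of x \<Lambda>] L X(1) by blast
    have "\<delta> \<le> norm (z - a)" if "z \<in> S" for z
    proof -
      have "norm (z - x) \<le> norm (z - a) + norm (x - a)"
        using norm_triangle_ineq4[of "z - a" "x - a"] by simp
      then show ?thesis using S(3)[OF that] x \<delta>(3)[OF x(1)] by linarith
    qed
    then show ?thesis using S by blast
  qed
  then show ?thesis using \<delta>(1) by blast
qed

text \<open>With \<open>f v = w\<close> and \<open>f a = 0\<close>, a vertex \<open>w\<close> close
  to the sphere forces \<open>a\<close> close to it. The set found for \<open>a\<close> in the
  preimage of \<open>A\<close> keeps away from \<open>a\<close>, near which \<open>f\<close> need
  not contract to the scale \<open>1 - norm w\<close>; its image is the required
  \<open>S\<close>.\<close>

lemma exit_sets_near_boundary: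
  assumes "v \<in> V" "0 \<le> p" "p < p'" "p' \<in> null_boundary_params E v"
  shows "\<exists>N>0. \<exists>\<tau>>0. \<forall>w\<in>V. 1 - norm w < \<tau> \<longrightarrow> (\<forall>A. finite A \<and> w \<in> A \<and> A \<subseteq> V \<longrightarrow>
    (\<exists>S. w \<in> S \<and> S \<subseteq> A \<and> (\<forall>s\<in>S. dist w s \<le> N * (1 - norm w)) \<and> exit_sum E A S p w \<le> 1/2))"
proof -
  obtain \<eta> where \<eta>: "\<eta> > 0" and *: "\<forall>a\<in>hyp. 1 - \<eta> < norm a \<longrightarrow> (\<forall>\<Lambda>. finite \<Lambda> \<and> v \<in> \<Lambda> \<and> \<Lambda> \<subseteq> V \<longrightarrow>
    (\<exists>S. v \<in> S \<and> S \<subseteq> \<Lambda> \<and> (\<forall>z\<in>S. \<eta> \<le> norm (z - a)) \<and> exit_sum E \<Lambda> S p v \<le> 1/2))"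
    using uniform_exit_sets[OF assms] by (elim exE conjE)
  let ?d = "1 - (norm v)\<^sup>2"
  have d: "0 < ?d" using norm_square_less_1 V_hyp assms by blast
  \<comment> \<open>Both constants come from \<open>hyp_isometry_contraction\<close>:
    \<open>N\<close> is the contraction factor at distance \<open>\<eta>\<close> from
    \<open>a\<close>, and \<open>\<tau>\<close> turns the second estimate into
    \<open>1 - (norm a)\<^sup>2 < \<eta>\<close>.\<close>
  define N where "N = 10 / (?d * \<eta>)"
  define \<tau> where "\<tau> = \<eta> * ?d / 10"
  have N\<tau>: "0 < N" "0 < \<tau>" using d \<eta> by (auto simp: N_def \<tau>_def)
  have "\<exists>S. w \<in> S \<and> S \<subseteq> A \<and> (\<forall>s\<in>S. dist w s \<le> N * (1 - norm w)) \<and> exit_sum E A S p w \<le> 1/2"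
    if w: "w \<in> V" "1 - norm w < \<tau>" and A: "finite A" "w \<in> A" "A \<subseteq> V" for w A
  proof -
    obtain f where f: "hyp_isometry f" "graph_automorphism V E f" "f v = w"
      using isometry_exists[OF assms(1) w(1)] .
    have "0 \<in> f ` hyp" using f(1) by (auto simp: hyp_isometry_def bij_betw_def hyp_iff)
    then obtain a where a: "a \<in> hyp" "f a = 0" by auto
    have bij: "bij_betw f V V" using f(2) by (simp add: graph_automorphism_def)
    then have inj: "inj_on f V" and sur: "f ` V = V" by (auto simp: bij_betw_def)
    have adj: "{f u, f u'} \<in> E \<longleftrightarrow> {u, u'} \<in> E" if "u \<in> V" "u' \<in> V" for u u'
      using f(2) that by (auto simp: graph_automorphism_def)
    define \<Lambda> where "\<Lambda> = {u \<in> V. f u \<in> A}"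
    have fL: "f ` \<Lambda> = A"
    proof
      show "A \<subseteq> f ` \<Lambda>"
      proof
        fix y assume y: "y \<in> A"
        then have "y \<in> f ` V" using sur A(3) by auto
        then show "y \<in> f ` \<Lambda>" using y by (auto simp: \<Lambda>_def)
      qed
    qed (auto simp: \<Lambda>_def)
    have LV: "\<Lambda> \<subseteq> V" and vL: "v \<in> \<Lambda>" using assms(1) f(3) A(2) by (auto simp: \<Lambda>_def)
    have finL: "finite \<Lambda>" using finite_image_iff[OF inj_on_subset[OF inj LV]] fL A(1) by simp
    note contr = hyp_isometry_contraction[OF f(1) V_hyp[OF assms(1)] a(1) _ a(2), unfolded f(3)]
    have "1 - \<eta> < norm a"
    proof (cases "v = a")
      \<comment> \<open>The second contraction estimate asks for a positive lower bound on
        \<open>norm (v - a)\<close>, which fails here. But \<open>w = 0\<close> forces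
        \<open>1 < \<eta>\<close>, and the claim is trivial.\<close>
      case True
      then have "w = 0" using a f by simp
      then have "1 < \<tau>" using w by simp
      moreover have "\<eta> * ?d \<le> \<eta> * 1" using \<eta> by (intro mult_left_mono) auto
      ultimately have "1 < \<eta>" unfolding \<tau>_def using \<eta> by linarith
      then show ?thesis using norm_ge_zero[of a] by linarith
    next
      case False
      then have "1 - (norm a)\<^sup>2 \<le> 10 / ?d * (1 - norm w)"
        using contr(2)[OF V_hyp[OF assms(1)], of "norm (v - a)"] by simp
      also have "\<dots> < 10 / ?d * \<tau>" using w d by (intro mult_strict_left_mono) auto
      also have "\<dots> = \<eta>" using d by (simp add: \<tau>_def)
      finally show ?thesis using norm_square_defect_bounds(1)[OF a(1)] by linarith
    qed
    then obtain S where S: "v \<in> S" "S \<subseteq> \<Lambda>" "\<And>z. z \<in> S \<Longrightarrow> \<eta> \<le> norm (z - a)" "exit_sum E \<Lambda> S p v \<le> 1/2"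
      using *[rule_format, OF a(1) _ conjI[OF finL conjI[OF vL LV]]] by blast
    have "exit_sum E (f ` \<Lambda>) (f ` S) p (f v) = exit_sum E \<Lambda> S p v"
      by (rule exit_sum_image[OF bij adj E_pairs LV S(2,1)])
    then have "exit_sum E A (f ` S) p w \<le> 1/2" using S(4) fL f(3) by simp
    moreover have "dist w (f z) \<le> N * (1 - norm w)" if "z \<in> S" for z
    proof -
      have "z \<in> hyp" using that S(2) LV V_hyp by auto
      from contr(1)[OF this \<eta> S(3)[OF that]] show ?thesis
        by (simp add: N_def dist_norm norm_minus_commute)
    qed
    moreover have "w \<in> f ` S" "f ` S \<subseteq> A" using S f(3) fL by auto
    ultimately show ?thesis by (intro exI[of _ "f ` S"]) auto
  qed
  then show ?thesis using N\<tau> by blast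
qed

section \<open>Long open excursions near the sphere\<close>

definition far_event :: "real \<Rightarrow> real \<Rightarrow> 'a \<Rightarrow> ('a set \<Rightarrow> bool) set" where
  "far_event p \<delta> w = reach_event E p {z \<in> V. norm w \<le> norm z} w {u. \<delta> \<le> dist w u}"

text \<open>A small box need not contain \<open>w\<close>, while the decay estimate requires its
  starting point in the box; hence \<open>w\<close> is inserted into each.\<close>

lemma far_event_chain:
  assumes "w \<in> V"
  shows "incseq (\<lambda>n. insert w (exhaustion n) \<inter> {z. norm w \<le> norm z})"
    and "(\<Union>n. insert w (exhaustion n) \<inter> {z. norm w \<le> norm z}) = {z \<in> V. norm w \<le> norm z}"
proof -
  show "incseq (\<lambda>n. insert w (exhaustion n) \<inter> {z. norm w \<le> norm z})"
  proof (rule monoI)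
    fix m n :: nat assume "m \<le> n"
    then have "exhaustion m \<subseteq> exhaustion n" by (rule incseqD[OF incseq_exhaustion])
    then show "insert w (exhaustion m) \<inter> {z. norm w \<le> norm z} \<le> insert w (exhaustion n) \<inter> {z. norm w \<le> norm z}"
      by auto
  qed
  have "(\<Union>n. insert w (exhaustion n) \<inter> {z. norm w \<le> norm z}) = insert w (\<Union>n. exhaustion n) \<inter> {z. norm w \<le> norm z}"
    by auto
  then show "(\<Union>n. insert w (exhaustion n) \<inter> {z. norm w \<le> norm z}) = {z \<in> V. norm w \<le> norm z}"
    using assms unfolding UN_exhaustion by auto
qed

lemmas far_event_limit =
  reach_event_limit[OF far_event_chain E_finite finite_Int[OF disjI1[OF finite.insertI[OF finite_exhaustion]]]]

lemma sets_far_event: "w \<in> V \<Longrightarrow> 0 \<le> p \<Longrightarrow> p \<le> 1 \<Longrightarrow> far_event p \<delta> w \<in> sets (percolation E p)"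
  unfolding far_event_def by (rule far_event_limit(1)) auto

lemma far_event_decay:
  assumes "v \<in> V" "0 \<le> p" "p < p'" "p' \<in> null_boundary_params E v"
  shows "\<exists>K>0. \<exists>\<tau>>0. \<forall>w\<in>V. \<forall>\<delta> k. 1 - norm w < \<tau> \<longrightarrow> real k * (K * (1 - norm w)) < \<delta> \<longrightarrow>
    measure (percolation E p) (far_event p \<delta> w) \<le> (1/2) ^ k"
proof -
  have p: "p \<le> 1" using assms by (auto simp: null_boundary_params_def)
  obtain N \<tau> where N: "N > 0" "\<tau> > 0" and step: "\<forall>w\<in>V. 1 - norm w < \<tau> \<longrightarrow> (\<forall>A. finite A \<and> w \<in> A \<and> A \<subseteq> V \<longrightarrow>
    (\<exists>S. w \<in> S \<and> S \<subseteq> A \<and> (\<forall>s\<in>S. dist w s \<le> N * (1 - norm w)) \<and> exit_sum E A S p w \<le> 1/2))"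
    using exit_sets_near_boundary[OF assms] by (elim exE conjE)
  obtain D where D: "D \<ge> 0" "\<And>u v. {u, v} \<in> E \<Longrightarrow> hquot u v \<le> D"
    using edge_hquot_bounded by blast
  \<comment> \<open>One move crosses an exit set, of radius \<open>N * (1 - norm w)\<close>, and one
    exit edge. Both ends of the edge have norm at least \<open>norm w\<close>, so their defects are
    at most \<open>2 * (1 - norm w)\<close>; with \<open>hquot\<close> at most \<open>D\<close> the
    edge has Euclidean length at most \<open>2 * sqrt D * (1 - norm w)\<close>.\<close>
  define K where "K = N + 2 * sqrt D"
  have K: "K > 0" using N D by (auto simp: K_def intro: add_pos_nonneg)
  have "measure (percolation E p) (far_event p \<delta> w) \<le> (1/2) ^ k"
    if w: "w \<in> V" "1 - norm w < \<tau>" and k: "real k * (K * (1 - norm w)) < \<delta>" for w \<delta> k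
    unfolding far_event_def
  proof (rule far_event_limit(2)[OF w(1) w(1) _ assms(2) p])
    fix n
    let ?h = "1 - norm w"
    let ?A = "insert w (exhaustion n) \<inter> {z. norm w \<le> norm z}"
    have h: "0 < ?h" using V_hyp[OF w(1)] by (simp add: hyp_iff)
    have A: "finite ?A" "?A \<subseteq> V" using finite_exhaustion w(1) by (auto simp: exhaustion_def)
    have near: "dist y z \<le> 2 * sqrt D * ?h" if "y \<in> ?A" "z \<in> ?A" "{y, z} \<in> E" for y z
    proof -
      have yz: "y \<in> hyp" "z \<in> hyp" using that A V_hyp by auto
      have b: "1 - (norm x)\<^sup>2 \<le> 2 * ?h" if "x \<in> hyp" "norm w \<le> norm x" for x :: 'a
        using order_trans[OF norm_square_defect_bounds(2)[OF that(1)], of "2 * ?h"] that(2) by simp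
      have e: "D * ((2 * t) * (2 * t)) = 4 * D * t\<^sup>2" for t :: real by (simp add: power2_eq_square)
      have "(norm (y - z))\<^sup>2 = hquot y z * ((1 - (norm y)\<^sup>2) * (1 - (norm z)\<^sup>2))"
        by (rule norm_diff_hquot[OF yz])
      also have "\<dots> \<le> D * ((2 * ?h) * (2 * ?h))"
        using D that h yz hquot_nonneg[OF yz] norm_square_less_1[OF yz(1)] norm_square_less_1[OF yz(2)]
        by (intro mult_mono b) auto
      also have "\<dots> = 4 * D * ?h\<^sup>2" unfolding e ..
      also have "\<dots> = (2 * sqrt D * ?h)\<^sup>2" using D(1) by (simp add: power_mult_distrib)
      finally have "norm (y - z) \<le> 2 * sqrt D * ?h"
        by (rule power2_le_imp_le) (use D h in auto)
      then show ?thesis by (simp add: dist_norm)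
    qed
    show "reach_prob E ?A p w {u. \<delta> \<le> dist w u} \<le> (1/2) ^ k"
    proof (rule reach_prob_decay[OF A(1) assms(2) p, where \<rho> = "K * ?h"])
      fix w' assume w': "w' \<in> ?A"
      then have w'V: "w' \<in> V" "norm w \<le> norm w'" using A by auto
      then have "1 - norm w' < \<tau>" using w by simp
      then obtain S where S: "w' \<in> S" "S \<subseteq> ?A" "\<forall>s\<in>S. dist w' s \<le> N * (1 - norm w')" "exit_sum E ?A S p w' \<le> 1/2"
        using step[rule_format, OF w'V(1) _ conjI[OF A(1) conjI[OF w' A(2)]]] by blast
      have Nh: "dist w' s \<le> N * ?h" if "s \<in> S" for s
      proof -
        have "N * (1 - norm w') \<le> N * ?h" using N w'V by (intro mult_left_mono) auto
        then show ?thesis using S(3) that by force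
      qed
      have "dist w' s \<le> K * ?h" if "s \<in> S" for s
      proof -
        have "N * ?h \<le> K * ?h" using h D by (intro mult_right_mono) (auto simp: K_def)
        then show ?thesis using Nh[OF that] by simp
      qed
      moreover have "dist w' z \<le> K * ?h" if "(y, z) \<in> exit_pairs E ?A S" for y z
      proof -
        have yz: "y \<in> S" "z \<in> ?A" "{y, z} \<in> E" using that by (auto simp: exit_pairs_def)
        have "dist w' z \<le> dist w' y + dist y z" by (rule dist_triangle)
        also have "\<dots> \<le> N * ?h + 2 * sqrt D * ?h"
          using Nh[OF yz(1)] near[of y z] yz S(2) by (intro add_mono) auto
        also have "\<dots> = K * ?h" by (simp add: K_def algebra_simps)
        finally show ?thesis .
      qed
      ultimately show "\<exists>S. w' \<in> S \<and> S \<subseteq> ?A \<and> exit_sum E ?A S p w' \<le> 1/2 \<and>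
        (\<forall>s\<in>S. dist w' s \<le> K * ?h) \<and> (\<forall>(y, z)\<in>exit_pairs E ?A S. dist w' z \<le> K * ?h)"
        using S by (intro exI[of _ S]) auto
    qed (use k in auto)
  qed
  then show ?thesis using K N by blast
qed

text \<open>Decay exponential in \<open>\<delta> / (1 - norm w)\<close> beats every power of
  \<open>1 - norm w\<close>. The power used later is the dimension, for which the sum over
  \<open>V\<close> is finite by volume.\<close>

lemma far_event_poly_bound:
  assumes "v \<in> V" "0 \<le> p" "p < p'" "p' \<in> null_boundary_params E v" "0 < \<delta>"
  shows "\<exists>C\<ge>0. \<forall>w\<in>V. measure (percolation E p) (far_event p \<delta> w) \<le> C * (1 - norm w) ^ d"
proof -
  interpret prob_space "percolation E p" by (rule prob_space_percolation)
  obtain K \<tau> where K: "K > 0" "\<tau> > 0" and dec: "\<forall>w\<in>V. \<forall>\<delta> k. 1 - norm w < \<tau> \<longrightarrow>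
    real k * (K * (1 - norm w)) < \<delta> \<longrightarrow> prob (far_event p \<delta> w) \<le> (1/2) ^ k"
    using far_event_decay[OF assms(1-4)] by (elim exE conjE)
  obtain B where B: "B > 0" "\<And>k. (real k + 1) ^ d * (1/2) ^ k \<le> B"
    using half_power_times_poly_bounded by blast
  \<comment> \<open>The first entry serves vertices within \<open>\<tau>\<close> of the sphere; the
    second lifts the bound to at least \<open>1\<close> at all others.\<close>
  define C where "C = max (B * (2 * K / \<delta>) ^ d) (1 / \<tau> ^ d)"
  have C: "0 \<le> C" unfolding C_def using K by (intro max.coboundedI2) auto
  have "prob (far_event p \<delta> w) \<le> C * (1 - norm w) ^ d" if w: "w \<in> V" for w
  proof -
    let ?h = "1 - norm w"
    have h: "0 < ?h" using V_hyp[OF w] by (simp add: hyp_iff)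
    show ?thesis
    proof (cases "?h < \<tau>")
      case True
      \<comment> \<open>The denominator has a factor \<open>2\<close> so that \<open>k\<close> moves
        cover at most \<open>\<delta> / 2\<close>, which meets the strict inequality required for
        the decay.\<close>
      define t where "t = \<delta> / (2 * K * ?h)"
      have t: "0 < t" using assms K h by (simp add: t_def)
      define k where "k = nat \<lfloor>t\<rfloor>"
      have k: "real k \<le> t" "t < real k + 1" using t unfolding k_def by linarith+
      have "real k * (K * ?h) \<le> t * (K * ?h)" using k K h by (intro mult_right_mono) auto
      also have "\<dots> = \<delta> / 2" using K h by (simp add: t_def field_simps)
      also have "\<dots> < \<delta>" using assms by simp
      finally have "prob (far_event p \<delta> w) \<le> (1/2) ^ k" using dec w True by blast
      moreover have "t ^ d * (1/2) ^ k \<le> B"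
      proof -
        have "t ^ d * (1/2) ^ k \<le> (real k + 1) ^ d * (1/2) ^ k"
          using t k by (intro mult_right_mono power_mono) auto
        then show ?thesis using B(2)[of k] by linarith
      qed
      then have "(1/2) ^ k \<le> B / t ^ d" using t by (simp add: field_simps)
      moreover have "B / t ^ d = B * (2 * K / \<delta>) ^ d * ?h ^ d"
        using K h assms by (simp add: t_def power_divide power_mult_distrib)
      moreover have "\<dots> \<le> C * ?h ^ d" unfolding C_def using h by (intro mult_right_mono) auto
      ultimately show ?thesis by linarith
    next
      case False
      have "prob (far_event p \<delta> w) \<le> 1" by simp
      also have "1 \<le> (?h / \<tau>) ^ d" using False K by (intro one_le_power) (simp add: field_simps)
      also have "\<dots> = 1 / \<tau> ^ d * ?h ^ d" by (simp add: power_divide)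
      also have "\<dots> \<le> C * ?h ^ d" unfolding C_def using h by (intro mult_right_mono) auto
      finally show ?thesis .
    qed
  qed
  then show ?thesis using C by blast
qed

text \<open>Balls around the vertices with radii proportional to their distance from the sphere are disjoint.\<close>

lemma vertex_sum_bounded:
  "\<exists>M. \<forall>F. finite F \<and> F \<subseteq> V \<longrightarrow> (\<Sum>w\<in>F. (1 - norm w) ^ DIM('a)) \<le> M"
proof -
  obtain c where c: "c > 0" "\<And>u v. u \<in> V \<Longrightarrow> v \<in> V \<Longrightarrow> u \<noteq> v \<Longrightarrow> c \<le> hquot u v"
    using uniformly_discrete by blast
  \<comment> \<open>With \<open>\<kappa> \<le> 1/4\<close>, overlapping balls belong to vertices
    whose distances to the sphere differ by a factor of at most \<open>2\<close>. Then
    \<open>4 * \<kappa>\<^sup>2 \<le> c / 2\<close> contradicts the separation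
    \<open>c\<close>.\<close>
  define \<kappa> where "\<kappa> = min (1/4) (sqrt (c / 8))"
  have k: "0 < \<kappa>" "\<kappa> \<le> 1/4" using c by (auto simp: \<kappa>_def)
  have "\<kappa>\<^sup>2 \<le> (sqrt (c / 8))\<^sup>2" using k by (intro power_mono) (auto simp: \<kappa>_def)
  then have kc: "\<kappa>\<^sup>2 \<le> c / 8" using c by simp
  let ?h = "\<lambda>w::'a. 1 - norm w"
  let ?B = "\<lambda>w::'a. ball w (\<kappa> * ?h w)"
  have h: "0 < ?h w" if "w \<in> V" for w using V_hyp[OF that] by (simp add: hyp_iff)
  have aux: "?B w \<inter> ?B w' = {}" if w: "w \<in> V" "w' \<in> V" "w \<noteq> w'" "?h w' \<le> ?h w" for w w'
  proof (rule ccontr)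
    assume "?B w \<inter> ?B w' \<noteq> {}"
    then obtain y where y: "dist w y < \<kappa> * ?h w" "dist w' y < \<kappa> * ?h w'" by auto
    have "dist w w' \<le> dist w y + dist w' y" by (rule dist_triangle2)
    also have "\<dots> < \<kappa> * ?h w + \<kappa> * ?h w"
      using y w(4) k mult_left_mono[OF w(4), of \<kappa>] by linarith
    finally have d: "norm (w - w') < 2 * \<kappa> * ?h w" by (simp add: dist_norm)
    have "norm w' \<le> norm w + norm (w - w')" using norm_triangle_sub[of w' w] by (simp add: norm_minus_commute)
    moreover have "2 * \<kappa> * ?h w \<le> 1/2 * ?h w" using k h[OF w(1)] by (intro mult_right_mono) auto
    then have "norm (w - w') < 1/2 * ?h w" by (rule order.strict_trans2[OF d])
    ultimately have h': "?h w / 2 \<le> ?h w'" by argo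
    have hy: "w \<in> hyp" "w' \<in> hyp" using w V_hyp by auto
    have "c * (?h w * (?h w / 2)) \<le> hquot w w' * ((1 - (norm w)\<^sup>2) * (1 - (norm w')\<^sup>2))"
      using c w h[OF w(1)] h[OF w(2)] h' hquot_nonneg[OF hy] norm_square_defect_bounds(1)[OF hy(1)]
        norm_square_defect_bounds(1)[OF hy(2)]
      by (intro mult_mono) auto
    also have "\<dots> = (norm (w - w'))\<^sup>2" by (rule norm_diff_hquot[OF hy, symmetric])
    also have "\<dots> < (2 * \<kappa> * ?h w)\<^sup>2" using d by (intro power_strict_mono) auto
    also have "\<dots> = 4 * \<kappa>\<^sup>2 * (?h w)\<^sup>2" by (simp add: power2_eq_square)
    also have "\<dots> \<le> 4 * (c / 8) * (?h w)\<^sup>2" using kc by (intro mult_right_mono mult_left_mono) auto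
    also have "\<dots> = c * (?h w * (?h w / 2))"
    proof -
      have "4 * (c / 8) * t\<^sup>2 = c * (t * (t / 2))" for t by (simp add: power2_eq_square)
      then show ?thesis .
    qed
    finally show False by simp
  qed
  have disj: "?B w \<inter> ?B w' = {}" if "w \<in> V" "w' \<in> V" "w \<noteq> w'" for w w'
    using aux[of w w'] aux[of w' w] that by (metis Int_commute linear)
  let ?u = "measure lborel (ball (0::'a) 1)"
  have u: "0 < ?u" by (rule content_ball_pos) simp
  have "(\<Sum>w\<in>F. ?h w ^ DIM('a)) \<le> measure lborel (ball (0::'a) 2) / (?u * \<kappa> ^ DIM('a))" if F: "finite F" "F \<subseteq> V" for F
  proof -
    have "(\<Sum>w\<in>F. measure lborel (?B w)) = measure lborel (\<Union>w\<in>F. ?B w)"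
    proof (rule measure_finite_Union[symmetric, OF F(1)])
      show "disjoint_family_on ?B F" using disj F(2) by (auto simp: disjoint_family_on_def subset_iff)
      show "emeasure lborel (?B w) \<noteq> \<infinity>" for w using emeasure_lborel_ball_finite[of w] by (simp add: less_top)
    qed auto
    also have "\<dots> \<le> measure lborel (ball (0::'a) 2)"
    proof (rule measure_mono_fmeasurable)
      show "(\<Union>w\<in>F. ?B w) \<subseteq> ball 0 2"
      proof clarify
        fix w y assume w: "w \<in> F" "y \<in> ?B w"
        then have "norm (y - w) < \<kappa> * ?h w" by (simp add: dist_norm norm_minus_commute)
        also have "\<dots> \<le> 1/4 * ?h w" using k w F h by (intro mult_right_mono) (auto intro: less_imp_le)
        finally have "norm (y - w) < 1" using norm_ge_zero[of w] by argo
        moreover have "norm w < 1" using h[of w] w F by auto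
        ultimately show "y \<in> ball 0 2" using norm_triangle_sub[of y w] by simp
      qed
      show "ball (0::'a) 2 \<in> fmeasurable lborel"
        by (intro fmeasurableI emeasure_lborel_ball_finite) simp
      show "(\<Union>w\<in>F. ?B w) \<in> sets lborel" by (simp add: borel_open open_UN)
    qed
    finally have le: "(\<Sum>w\<in>F. measure lborel (?B w)) \<le> measure lborel (ball (0::'a) 2)" .
    have "(?u * \<kappa> ^ DIM('a)) * (\<Sum>w\<in>F. ?h w ^ DIM('a)) = (\<Sum>w\<in>F. measure lborel (?B w))"
      unfolding sum_distrib_left
    proof (rule sum.cong[OF refl])
      fix w assume "w \<in> F"
      then have "0 \<le> \<kappa> * ?h w" using F h[of w] k by (auto simp: subset_iff intro!: mult_nonneg_nonneg)
      then show "(?u * \<kappa> ^ DIM('a)) * ?h w ^ DIM('a) = measure lborel (?B w)"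
        by (subst content_ball_conv_unit_ball) (simp_all add: power_mult_distrib)
    qed
    then have "(?u * \<kappa> ^ DIM('a)) * (\<Sum>w\<in>F. ?h w ^ DIM('a)) \<le> measure lborel (ball (0::'a) 2)"
      using le by simp
    then show ?thesis using u k by (simp add: field_simps)
  qed
  then show ?thesis by blast
qed

lemma AE_finitely_many_far:
  assumes "v \<in> V" "0 \<le> p" "p < p'" "p' \<in> null_boundary_params E v" "0 < \<delta>"
  shows "AE \<omega> in percolation E p. finite {w \<in> V. \<omega> \<in> far_event p \<delta> w}"
proof -
  interpret prob_space "percolation E p" by (rule prob_space_percolation)
  have p: "p \<le> 1" using assms by (auto simp: null_boundary_params_def)
  obtain C where C: "C \<ge> 0" "\<And>w. w \<in> V \<Longrightarrow> prob (far_event p \<delta> w) \<le> C * (1 - norm w) ^ DIM('a)"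
    using far_event_poly_bound[OF assms, of "DIM('a)"] by blast
  obtain M where M: "\<And>F. finite F \<Longrightarrow> F \<subseteq> V \<Longrightarrow> (\<Sum>w\<in>F. (1 - norm w) ^ DIM('a)) \<le> M"
    using vertex_sum_bounded by blast
  let ?f = "from_nat_into V"
  let ?I = "to_nat_on V ` V"
  \<comment> \<open>Borel-Cantelli is applied to a sequence; numbers that code no vertex get the
    empty event and contribute nothing to the sum.\<close>
  define A where "A = (\<lambda>n. if n \<in> ?I then far_event p \<delta> (?f n) else {})"
  have fI: "?f n \<in> V" if "n \<in> ?I" for n
    using that from_nat_into[of V] by auto
  have inj: "inj_on ?f ?I" by (rule inj_onI) (auto simp: countable_V)
  have A: "A n \<in> sets (percolation E p)" for n
    using sets_far_event fI assms p by (auto simp: A_def)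
  have "summable (\<lambda>n. prob (A n))"
  proof (rule summableI_nonneg_bounded)
    fix n
    have "(\<Sum>i<n. prob (A i)) = (\<Sum>i\<in>{..<n} \<inter> ?I. prob (far_event p \<delta> (?f i)))"
      by (auto simp: A_def sum.inter_restrict intro!: sum.cong)
    also have "\<dots> = (\<Sum>w\<in>?f ` ({..<n} \<inter> ?I). prob (far_event p \<delta> w))"
      by (subst sum.reindex[OF inj_on_subset[OF inj]]) auto
    also have "\<dots> \<le> (\<Sum>w\<in>?f ` ({..<n} \<inter> ?I). C * (1 - norm w) ^ DIM('a))"
      using fI by (intro sum_mono C(2)) auto
    also have "\<dots> = C * (\<Sum>w\<in>?f ` ({..<n} \<inter> ?I). (1 - norm w) ^ DIM('a))"
      by (simp add: sum_distrib_left)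
    also have "\<dots> \<le> C * M" using C(1) fI by (intro mult_left_mono M) auto
    finally show "(\<Sum>i<n. prob (A i)) \<le> C * M" .
  qed simp
  then have "AE \<omega> in percolation E p. eventually (\<lambda>n. \<omega> \<in> space (percolation E p) - A n) sequentially"
    by (intro borel_cantelli_AE1[OF A]) (auto simp: emeasure_eq_measure)
  then show ?thesis
  proof eventually_elim
    fix \<omega> assume "eventually (\<lambda>n. \<omega> \<in> space (percolation E p) - A n) sequentially"
    then obtain N where N: "\<And>n. n \<ge> N \<Longrightarrow> \<omega> \<notin> A n" by (auto simp: eventually_sequentially)
    have "{w \<in> V. \<omega> \<in> far_event p \<delta> w} \<subseteq> ?f ` {..<N}"
    proof clarify
      fix w assume w: "w \<in> V" "\<omega> \<in> far_event p \<delta> w"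
      have eq: "?f (to_nat_on V w) = w" using w countable_V by simp
      then have "\<omega> \<in> A (to_nat_on V w)" using w by (simp add: A_def)
      then have "to_nat_on V w < N" using N not_le by blast
      then show "w \<in> ?f ` {..<N}" using eq by (intro image_eqI[of _ _ "to_nat_on V w"]) auto
    qed
    then show "finite {w \<in> V. \<omega> \<in> far_event p \<delta> w}" by (rule finite_subset) simp
  qed
qed

subsection \<open>Ends with two boundary points\<close>

lemma compact_edge_segment: "e \<in> E \<Longrightarrow> compact (edge_segment e)"
  by (erule E_cases) (simp add: edge_segment_doubleton compact_Un compact_hyp_segment V_hyp)

lemma edge_segment_hyp: "e \<in> E \<Longrightarrow> edge_segment e \<subseteq> hyp"
  by (erule E_cases) (auto simp: edge_segment_doubleton dest: hyp_segment_hquot(1)[rotated 2] intro: V_hyp)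

lemma edge_segment_hquot_bounded:
  "\<exists>D\<ge>0. \<forall>e\<in>E. \<forall>u\<in>e. \<forall>z\<in>edge_segment e. hquot u z \<le> D"
proof -
  obtain D where D: "D \<ge> 0" "\<And>u v. {u, v} \<in> E \<Longrightarrow> hquot u v \<le> D"
    using edge_hquot_bounded by blast
  have "hquot q z \<le> D" if e: "e \<in> E" "q \<in> e" "z \<in> edge_segment e" for e q z
  proof -
    obtain u v where uv: "e = {u, v}" "u \<in> V" "v \<in> V" using e(1) by (rule E_cases)
    have h: "u \<in> hyp" "v \<in> hyp" using uv V_hyp by auto
    have le: "hquot u v \<le> D" "hquot v u \<le> D" using D(2)[of u v] e(1) uv by (auto simp: hquot_commute)
    consider "z \<in> hyp_segment u v" | "z \<in> hyp_segment v u"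
      using e(3) uv(1) by (auto simp: edge_segment_doubleton)
    then have "hquot u z \<le> D" "hquot v z \<le> D"
      using hyp_segment_hquot(2,3)[OF h] hyp_segment_hquot(2,3)[OF h(2,1)] le
      by (cases; force)+
    then show ?thesis using e(2) uv(1) by auto
  qed
  then show ?thesis using D(1) by blast
qed

text \<open>Around a point of the open ball only finitely many vertices and segments are met, and a
  finite union of compact sets is closed. Accumulation can occur only at infinity.\<close>

lemma closure_segments:
  assumes "W \<subseteq> V" "\<E> \<subseteq> E"
  shows "closure (W \<union> \<Union>(edge_segment ` \<E>)) \<inter> hyp \<subseteq> W \<union> \<Union>(edge_segment ` \<E>)"
proof
  let ?X = "W \<union> \<Union>(edge_segment ` \<E>)"
  fix q assume q: "q \<in> closure ?X \<inter> hyp"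
  then have "norm q < 1" by (simp add: hyp_iff)
  define r where "r = (1 - norm q) / 2"
  have r: "0 < r" using \<open>norm q < 1\<close> by (simp add: r_def)
  have K: "cball q r \<subseteq> hyp"
  proof
    fix x assume "x \<in> cball q r"
    then have "norm (x - q) \<le> r" by (simp add: dist_norm norm_minus_commute)
    then show "x \<in> hyp" using norm_triangle_sub[of x q] r by (simp add: hyp_iff r_def field_simps)
  qed
  let ?W = "W \<inter> cball q r" and ?F = "{e \<in> \<E>. edge_segment e \<inter> cball q r \<noteq> {}}"
  have "finite (V \<inter> cball q r)" by (rule finite_V_compact[OF compact_cball K])
  then have W: "finite ?W" by (rule finite_subset[rotated]) (use assms in auto)
  have "finite {e \<in> E. edge_segment e \<inter> cball q r \<noteq> {}}" by (rule finite_E_compact[OF compact_cball K])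
  then have F: "finite ?F" by (rule finite_subset[rotated]) (use assms in auto)
  have "closed (\<Union>(edge_segment ` ?F))"
    using F assms(2) compact_edge_segment by (intro closed_UN) (auto intro: compact_imp_closed)
  then have cl: "closed (?W \<union> \<Union>(edge_segment ` ?F))"
    by (rule closed_Un[OF finite_imp_closed[OF W]])
  have "q \<in> closure (ball q r \<inter> ?X)"
    using open_Int_closure_subset[of "ball q r" ?X] q r by auto
  moreover have "ball q r \<inter> ?X \<subseteq> ?W \<union> \<Union>(edge_segment ` ?F)"
    using ball_subset_cball[of q r] by blast
  ultimately have "q \<in> ?W \<union> \<Union>(edge_segment ` ?F)" using closure_minimal[OF _ cl] by blast
  then show "q \<in> ?X" by blast
qed

lemma segment_inter:
  assumes "e \<in> E" "f \<in> E" "e \<noteq> f"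
  shows "edge_segment e \<inter> edge_segment f = e \<inter> f"
  using embedded assms by (auto simp: embedded_simple_graph_def)

text \<open>The edges linked to \<open>u\<close> outside the ball and the remaining ones form two disjoint relatively closed
  sets there, so a connected set avoiding the ball cannot meet both.\<close>

lemma connected_imp_joined_outside:
  assumes "v \<in> V" "connected A" "A \<subseteq> cluster E \<omega> v - cball 0 R" "z \<in> A" "z' \<in> A"
    and u: "u \<in> V" "R < norm u" "u = z \<or> (\<exists>e\<in>open_edges E \<omega>. z \<in> edge_segment e \<and> u \<in> e)"
  shows "\<exists>u'. joined {e \<in> open_edges E \<omega>. \<forall>q\<in>e. R < norm q} u u' \<and>
    (u' = z' \<or> (\<exists>e\<in>open_edges E \<omega>. z' \<in> edge_segment e \<and> u' \<in> e))"
proof -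
  let ?O = "open_edges E \<omega>"
  let ?OR = "{e \<in> ?O. \<forall>q\<in>e. R < norm q}"
  define U where "U = {u'. joined ?OR u u'}"
  \<comment> \<open>\<open>X\<close> also takes open edges with one endpoint in \<open>U\<close> and
    the other inside the ball: their outer part can belong to \<open>A\<close> and has to count as
    linked to \<open>u\<close>.\<close>
  define X where "X = U \<union> \<Union>(edge_segment ` {e \<in> ?O. e \<inter> U \<noteq> {}})"
  define Y where "Y = (V - U) \<union> \<Union>(edge_segment ` {e \<in> ?O. e \<inter> U = {}})"
  have OE: "?O \<subseteq> E" by (auto simp: open_edges_def)
  have U: "u' \<in> V \<and> R < norm u'" if "u' \<in> U" for u'
  proof -
    have "joined ?OR u u'" using that by (simp add: U_def)
    then show ?thesis by (induction rule: joined_induct) (use u E_V OE in auto)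
  qed
  have link: "q \<in> U" if "e \<in> ?O" "e \<inter> U \<noteq> {}" "q \<in> e" "R < norm q" for e q
  proof -
    obtain a where a: "a \<in> e" "a \<in> U" using \<open>e \<inter> U \<noteq> {}\<close> by auto
    show ?thesis
    proof (cases "q = a")
      case False
      have "e \<in> E" using that(1) OE by blast
      then obtain x y where "e = {x, y}" by (rule E_cases)
      then have e: "e = {a, q}" using a(1) that(3) False by auto
      then have "{a, q} \<in> ?OR" using that(1,4) U[OF a(2)] by auto
      then have "joined ?OR a q" by (rule joined_edge)
      moreover have "joined ?OR u a" using a(2) by (simp add: U_def)
      ultimately show ?thesis unfolding U_def using joined_trans by fast
    qed (use a in simp)
  qed
  have Ahyp: "A \<subseteq> hyp"
  proof
    fix x assume "x \<in> A"
    then have "x \<in> cluster E \<omega> v" using assms(3) by auto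
    then have "x \<in> V \<or> (\<exists>e\<in>E. x \<in> edge_segment e)"
      using joined_open_V[OF _ assms(1)] OE by (auto simp: cluster_def cluster_vertices_def)
    then show "x \<in> hyp" using V_hyp edge_segment_hyp by blast
  qed
  have AXY: "A \<subseteq> X \<union> Y"
  proof
    fix x assume "x \<in> A"
    then have "x \<in> cluster E \<omega> v" using assms(3) by auto
    then have "x \<in> V \<or> (\<exists>e\<in>?O. x \<in> edge_segment e)"
      using joined_open_V[OF _ assms(1)] by (auto simp: cluster_def cluster_vertices_def)
    then show "x \<in> X \<union> Y" unfolding X_def Y_def by blast
  qed
  \<comment> \<open>Embeddedness enters here: a point common to two drawn edges, or to an edge and
    the vertex set, is an endpoint, and an endpoint outside the ball of an open edge that touches
    \<open>U\<close> lies in \<open>U\<close>.\<close>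
  have disj: "False" if "q \<in> X" "q \<in> Y" "R < norm q" for q
  proof -
    have vert: "q' \<in> e" if "q' \<in> V" "e \<in> ?O" "q' \<in> edge_segment e" for q' e
      using ends_in_segment[of e] that OE by blast
    consider "q \<in> U" | e where "e \<in> ?O" "e \<inter> U \<noteq> {}" "q \<in> edge_segment e"
      using \<open>q \<in> X\<close> unfolding X_def by blast
    then show False
    proof cases
      case 1
      then obtain f where "f \<in> ?O" "f \<inter> U = {}" "q \<in> edge_segment f"
        using \<open>q \<in> Y\<close> unfolding Y_def by blast
      then show False using vert[of q f] U 1 by blast
    next
      case (2 e)
      consider "q \<in> V - U" | f where "f \<in> ?O" "f \<inter> U = {}" "q \<in> edge_segment f"
        using \<open>q \<in> Y\<close> unfolding Y_def by blast
      then show False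
      proof cases
        case 1
        then have "q \<in> e" using vert 2 by blast
        then show False using link[OF 2(1,2) _ that(3)] 1 by blast
      next
        case (2 f)
        then have "e \<noteq> f" using \<open>e \<inter> U \<noteq> {}\<close> by blast
        then have "q \<in> e \<inter> f" using segment_inter[of e f] 2 \<open>e \<in> ?O\<close> \<open>q \<in> edge_segment e\<close> OE by blast
        then have "q \<in> U" using link[OF \<open>e \<in> ?O\<close> \<open>e \<inter> U \<noteq> {}\<close> _ that(3)] by blast
        then show False using 2 \<open>q \<in> e \<inter> f\<close> by blast
      qed
    qed
  qed
  have "closure X \<inter> hyp \<subseteq> X" unfolding X_def by (rule closure_segments) (use U OE in auto)
  moreover have "closure Y \<inter> hyp \<subseteq> Y" unfolding Y_def by (rule closure_segments) (use OE in auto)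
  ultimately have cl: "A \<inter> closure X \<subseteq> X" "A \<inter> closure Y \<subseteq> Y" using Ahyp by auto
  have RA: "R < norm q" if "q \<in> A" for q using assms(3) that by auto
  have "closure X \<inter> closure Y \<inter> A = {}" using cl disj RA by blast
  moreover have "A \<subseteq> closure X \<union> closure Y" using AXY closure_subset by blast
  moreover have "closure X \<inter> A \<noteq> {}"
  proof -
    have "u \<in> U" by (simp add: U_def)
    then have "z \<in> X" using u(3) unfolding X_def by blast
    then show ?thesis using assms(4) closure_subset by blast
  qed
  ultimately have "closure Y \<inter> A = {}"
    using assms(2) unfolding connected_closed by (metis closed_closure)
  then have "z' \<in> X" using AXY assms(5) closure_subset[of Y] by blast
  then consider "z' \<in> U" | e a where "e \<in> ?O" "a \<in> e" "a \<in> U" "z' \<in> edge_segment e"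
    unfolding X_def by blast
  then show ?thesis
  proof cases
    case 1
    then show ?thesis unfolding U_def by blast
  next
    case (2 e a)
    then show ?thesis unfolding U_def by (intro exI[of _ a]) blast
  qed
qed

text \<open>The vertex of least norm met so far is kept as \<open>w\<close>. When a vertex nearer to
  the centre takes over, the condition on edges relaxes and the old connections persist. The clause
  \<open>norm w \<le> norm u'\<close> is carried along to admit the next edge.\<close>

lemma joined_outside_innermost:
  fixes u u' :: 'a
  assumes "joined {e \<in> F. \<forall>q\<in>e. R < norm q} u u'" "u \<in> V" "R < norm u" "F \<subseteq> E"
  shows "\<exists>w\<in>V. R < norm w \<and> norm w \<le> norm u' \<and> joined {e \<in> F. \<forall>q\<in>e. norm w \<le> norm q} w u \<and>
    joined {e \<in> F. \<forall>q\<in>e. norm w \<le> norm q} w u'"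
  using assms(1)
proof (induction rule: joined_induct)
  case refl
  then show ?case using assms(2,3) by (intro bexI[of _ u]) auto
next
  case (step y z)
  then obtain w where w: "w \<in> V" "R < norm w" "norm w \<le> norm y"
    and j: "joined {e \<in> F. \<forall>q\<in>e. norm w \<le> norm q} w u" "joined {e \<in> F. \<forall>q\<in>e. norm w \<le> norm q} w y"
    by blast
  have e: "{y, z} \<in> F" "R < norm z" "z \<in> V" using step(2) E_V[of "{y, z}"] assms(4) by auto
  show ?case
  proof (cases "norm w \<le> norm z")
    case True
    then have "joined {e \<in> F. \<forall>q\<in>e. norm w \<le> norm q} y z" using e w by (intro joined_edge) auto
    from joined_trans[OF j(2) this] show ?thesis using w j(1) True by blast
  next
    case False
    let ?Fz = "{e \<in> F. \<forall>q\<in>e. norm z \<le> norm q}"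
    have sub: "{e \<in> F. \<forall>q\<in>e. norm w \<le> norm q} \<subseteq> ?Fz" using False by force
    have zy: "joined ?Fz z y" using e w False by (intro joined_edge) (auto simp: insert_commute)
    have "joined ?Fz z u"
      by (rule joined_trans[OF joined_trans[OF zy joined_sym[OF joined_mono[OF j(2) sub]]] joined_mono[OF j(1) sub]])
    then show ?thesis using e by (intro bexI[of _ z]) auto
  qed
qed

text \<open>Points of the component near \<open>x\<close> and \<open>y\<close> may lie inside edges.
  Edges have bounded \<open>hquot\<close>, so near the sphere they are short in the Euclidean sense,
  and their vertices \<open>u\<close>, \<open>u'\<close> are still close to \<open>x\<close> and
  \<open>y\<close>.\<close>

lemma two_point_end_imp_far:
  assumes v: "v \<in> V" and end_C: "is_end (cluster E \<omega> v) e"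
    and xy: "x \<in> end_boundary e" "y \<in> end_boundary e" "4 * \<delta> \<le> dist x y" and "0 < \<delta>"
    and R: "R < 1" and \<omega>: "\<omega> \<in> space (percolation E p)"
  shows "\<exists>w\<in>V. R < norm w \<and> \<omega> \<in> far_event p \<delta> w"
proof -
  obtain D where D: "D \<ge> 0" "\<And>e u z. e \<in> E \<Longrightarrow> u \<in> e \<Longrightarrow> z \<in> edge_segment e \<Longrightarrow> hquot u z \<le> D"
    using edge_segment_hquot_bounded by blast
  let ?K = "cball (0::'a) R"
  have K: "compact ?K" "?K \<subseteq> hyp" using R by (auto simp: hyp_iff)
  define A where "A = e ?K"
  have "A \<in> components (cluster E \<omega> v - ?K)"
    using end_C K unfolding is_end_def A_def by blast
  then have A: "connected A" "A \<subseteq> cluster E \<omega> v - ?K"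
    using in_components_connected in_components_subset by blast+
  \<comment> \<open>The bound \<open>s \<le> \<delta> / 2\<close> leaves
    \<open>dist u u' \<ge> 3 * \<delta>\<close>, so \<open>w\<close> has distance at least
    \<open>\<delta>\<close> from \<open>u\<close> or \<open>u'\<close>; \<open>s < 1 - R\<close>
    keeps both vertices outside the ball.\<close>
  define s where "s = min (\<delta> / 2) ((1 - R) / 2)"
  have s: "0 < s" "s \<le> \<delta> / 2" "s < 1 - R" using \<open>0 < \<delta>\<close> R by (auto simp: s_def min_def)
  \<comment> \<open>The second entry ensures
    \<open>2 * D * \<epsilon> \<le> (s / 2)\<^sup>2\<close>, the bound for the squared distance from
    \<open>z\<close> to a vertex of its edge. As \<open>D\<close> may be \<open>0\<close>, the
    denominator has \<open>D + 1\<close>.\<close>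
  define \<epsilon> where "\<epsilon> = min (s / 2) (s\<^sup>2 / (8 * (D + 1)))"
  have \<epsilon>: "\<epsilon> \<le> s / 2" "\<epsilon> \<le> s\<^sup>2 / (8 * (D + 1))"
    unfolding \<epsilon>_def by (rule min.cobounded1, rule min.cobounded2)
  have \<epsilon>0: "0 < \<epsilon>" using s D by (auto simp: \<epsilon>_def intro!: divide_pos_pos add_nonneg_pos)
  have D\<epsilon>: "2 * D * \<epsilon> \<le> (s / 2)\<^sup>2"
  proof -
    have "2 * D * \<epsilon> \<le> 2 * (D + 1) * (s\<^sup>2 / (8 * (D + 1)))"
      using D(1) \<epsilon>0 \<epsilon>(2) by (intro mult_mono) auto
    also have "\<dots> = (s / 2)\<^sup>2" using D by (simp add: field_simps power2_eq_square)
    finally show ?thesis .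
  qed
  have near: "dist u x < s \<and> R < norm u"
    if x: "x \<notin> hyp" and z: "z \<in> A" "dist z x < \<epsilon>"
      and u: "u = z \<or> (\<exists>e\<in>open_edges E \<omega>. z \<in> edge_segment e \<and> u \<in> e)" for x z u
  proof -
    have x1: "1 \<le> norm x" using x by (simp add: hyp_iff)
    have "dist u z \<le> s / 2"
    proof (cases "u = z")
      case False
      then obtain f where f: "f \<in> E" "z \<in> edge_segment f" "u \<in> f" using u by (auto simp: open_edges_def)
      have h: "u \<in> hyp" "z \<in> hyp" using f E_V V_hyp edge_segment_hyp by blast+
      have "norm x \<le> norm z + norm (x - z)" by (rule norm_triangle_sub)
      then have "1 - norm z \<le> \<epsilon>" using x1 z(2) by (simp add: dist_norm norm_minus_commute)
      then have dz: "1 - (norm z)\<^sup>2 \<le> 2 * \<epsilon>" using norm_square_defect_bounds(2)[OF h(2)] by argo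
      have "(norm (u - z))\<^sup>2 = hquot u z * ((1 - (norm u)\<^sup>2) * (1 - (norm z)\<^sup>2))"
        by (rule norm_diff_hquot[OF h])
      also have "\<dots> \<le> D * (1 * (2 * \<epsilon>))"
        using D f dz \<epsilon>0 hquot_nonneg[OF h] norm_square_less_1[OF h(1)] norm_square_less_1[OF h(2)]
        by (intro mult_mono) auto
      also have "\<dots> \<le> (s / 2)\<^sup>2" using D\<epsilon> by (simp add: mult_ac)
      finally have "norm (u - z) \<le> s / 2" by (rule power2_le_imp_le) (use s in simp)
      then show ?thesis by (simp add: dist_norm)
    qed (use s in simp)
    then have d: "dist u x < s" using dist_triangle[of u x z] z(2) \<epsilon> by linarith
    moreover have "norm x \<le> norm u + norm (x - u)" by (rule norm_triangle_sub)
    then have "R < norm u" using d x1 s by (simp add: dist_norm norm_minus_commute)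
    ultimately show ?thesis by simp
  qed
  have "x \<in> closure A - hyp" "y \<in> closure A - hyp"
    using xy(1,2) K unfolding end_boundary_def boundary_at_infinity_def A_def by blast+
  then have xyh: "x \<notin> hyp" "y \<notin> hyp" and cl: "x \<in> closure A" "y \<in> closure A" by auto
  obtain z where z: "z \<in> A" "dist z x < \<epsilon>"
    using cl(1)[unfolded closure_approachable] \<epsilon>0 by blast
  obtain z' where z': "z' \<in> A" "dist z' y < \<epsilon>"
    using cl(2)[unfolded closure_approachable] \<epsilon>0 by blast
  have "z \<in> cluster E \<omega> v" using z A by auto
  have "\<exists>u\<in>V. u = z \<or> (\<exists>e\<in>open_edges E \<omega>. z \<in> edge_segment e \<and> u \<in> e)"
  proof (cases "z \<in> cluster_vertices E \<omega> v")
    case True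
    then show ?thesis using joined_open_V[OF _ v] by (auto simp: cluster_vertices_def)
  next
    case False
    then obtain f where f: "f \<in> open_edges E \<omega>" "z \<in> edge_segment f"
      using \<open>z \<in> cluster E \<omega> v\<close> by (auto simp: cluster_def)
    then have "f \<in> E" by (simp add: open_edges_def)
    then obtain a b where "f = {a, b}" "a \<in> V" by (rule E_cases)
    then show ?thesis using f by (intro bexI[of _ a]) auto
  qed
  then obtain u where u: "u \<in> V" "u = z \<or> (\<exists>e\<in>open_edges E \<omega>. z \<in> edge_segment e \<and> u \<in> e)" by blast
  have ux: "dist u x < s" "R < norm u" using near[OF xyh(1) z u(2)] by auto
  obtain u' where u': "joined {e \<in> open_edges E \<omega>. \<forall>q\<in>e. R < norm q} u u'"
      "u' = z' \<or> (\<exists>e\<in>open_edges E \<omega>. z' \<in> edge_segment e \<and> u' \<in> e)"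
    using connected_imp_joined_outside[OF v A z(1) z'(1) u(1) ux(2) u(2)] by blast
  have uy: "dist u' y < s" using near[OF xyh(2) z' u'(2)] by auto
  have OE: "open_edges E \<omega> \<subseteq> E" by (auto simp: open_edges_def)
  obtain w where w: "w \<in> V" "R < norm w"
    and j: "joined {e \<in> open_edges E \<omega>. \<forall>q\<in>e. norm w \<le> norm q} w u"
      "joined {e \<in> open_edges E \<omega>. \<forall>q\<in>e. norm w \<le> norm q} w u'"
    using joined_outside_innermost[OF u'(1) u(1) ux(2) OE] by blast
  have eq: "{e \<in> open_edges E \<omega>. \<forall>q\<in>e. norm w \<le> norm q} = {e \<in> induced E {z \<in> V. norm w \<le> norm z}. \<omega> e}"
    using E_V by (auto simp: open_edges_def induced_def)
  have "dist x y \<le> dist u x + dist u u' + dist u' y"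
    using dist_triangle[of x y u] dist_triangle[of u y u'] by (simp add: dist_commute)
  moreover have "dist u u' \<le> dist w u + dist w u'" by (rule dist_triangle3)
  ultimately have "\<delta> \<le> dist w u \<or> \<delta> \<le> dist w u'" using xy(3) ux(1) uy s \<open>0 < \<delta>\<close> by linarith
  then have "\<exists>t. \<delta> \<le> dist w t \<and> joined {e \<in> induced E {z \<in> V. norm w \<le> norm z}. \<omega> e} w t"
    using j unfolding eq by blast
  then have "\<omega> \<in> far_event p \<delta> w" using \<omega> unfolding far_event_def reach_event_def by blast
  then show ?thesis using w by blast
qed

text \<open>If the closure of \<open>e (B n)\<close> stayed in the open ball, it could be removed
  together with \<open>B n\<close>: the component chosen for this larger compact set would be
  nonempty, contained in the removed set and disjoint from it. So all closures reach the sphere, and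
  nested compact sets have a common point.\<close>

lemma end_boundary_nonempty:
  assumes v: "v \<in> V" and end_C: "is_end (cluster E \<omega> v) e"
  shows "end_boundary e \<noteq> {}"
proof -
  have Chyp: "cluster E \<omega> v \<subseteq> hyp"
  proof
    fix x assume "x \<in> cluster E \<omega> v"
    then have "x \<in> V \<or> (\<exists>e\<in>E. x \<in> edge_segment e)"
      using joined_open_V[OF _ v] by (auto simp: cluster_def cluster_vertices_def open_edges_def)
    then show "x \<in> hyp" using V_hyp edge_segment_hyp by blast
  qed
  have comp: "e K \<in> components (cluster E \<omega> v - K)" if "compact K" "K \<subseteq> hyp" for K
    using end_C that unfolding is_end_def by blast
  have anti: "e K' \<subseteq> e K" if "compact K" "compact K'" "K \<subseteq> K'" "K' \<subseteq> hyp" for K K'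
    using end_C that unfolding is_end_def by blast
  define B where "B = (\<lambda>n. cball (0::'a) (1 - 1 / real (Suc n)))"
  have B: "compact (B n)" "B n \<subseteq> hyp" for n
  proof -
    have "0 < 1 / real (Suc n)" by simp
    then show "B n \<subseteq> hyp" unfolding B_def hyp_iff subset_iff mem_cball_0 by linarith
  qed (simp add: B_def)
  have eC: "e (B n) \<subseteq> hyp" for n using in_components_subset[OF comp[OF B]] Chyp by blast
  let ?S = "\<lambda>n. closure (e (B n)) - hyp"
  have "(\<Inter>n. ?S n) \<noteq> {}"
  proof (rule compact_nest)
    fix n
    have "bounded (e (B n))" using eC[of n] unfolding hyp_def by (rule bounded_subset[OF bounded_ball])
    then have cc: "compact (closure (e (B n)))" by simp
    then show "compact (?S n)" unfolding hyp_def by (intro compact_diff) auto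
    show "?S n \<noteq> {}"
    proof
      assume "?S n = {}"
      then have sub: "closure (e (B n)) \<subseteq> hyp" by blast
      let ?K = "B n \<union> closure (e (B n))"
      have K: "compact ?K" "?K \<subseteq> hyp" using B cc sub by auto
      have "e ?K \<subseteq> e (B n)" by (rule anti) (use B K in auto)
      then have "e ?K \<subseteq> ?K" using closure_subset by blast
      moreover have "e ?K \<subseteq> cluster E \<omega> v - ?K" using in_components_subset[OF comp[OF K]] .
      moreover have "e ?K \<noteq> {}" using in_components_nonempty[OF comp[OF K]] .
      ultimately show False by blast
    qed
  next
    fix m n :: nat assume "m \<le> n"
    then have "1 / real (Suc n) \<le> 1 / real (Suc m)" by (simp add: frac_le)
    then have "B m \<subseteq> B n" unfolding B_def by (intro subset_cball) simp
    then have "e (B n) \<subseteq> e (B m)" by (intro anti B)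
    then show "?S n \<subseteq> ?S m" using closure_mono by blast
  qed
  then obtain x where x: "\<And>n. x \<in> ?S n" by blast
  have "x \<in> boundary_at_infinity (e K)" if K: "compact K" "K \<subseteq> hyp" for K
  proof -
    obtain n where "K \<subseteq> B n" using compact_subset_cball_less_1[OF K] unfolding B_def by blast
    then have "e (B n) \<subseteq> e K" by (intro anti B K)
    then show ?thesis using x[of n] closure_mono unfolding boundary_at_infinity_def by blast
  qed
  then show ?thesis unfolding end_boundary_def by blast
qed

end

theorem theorem3p1p9:
  fixes V :: "'a::euclidean_space set" and E :: "'a set set" and v\<^sub>0 :: 'a and p :: real
  assumes "DIM('a) \<ge> 2"
    and "embedded_simple_graph V E"
    and "connected_graph V E"
    and "locally_finite_graph V E"
    and "transitive_under_isometries V E"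
    and "v\<^sub>0 \<in> V"
    and "0 \<le> p" and "p < p\<^sub>0 E v\<^sub>0"
  shows "AE \<omega> in percolation E p.
           \<forall>v\<in>V. \<forall>e. is_end (cluster E \<omega> v) e \<longrightarrow> (\<exists>x. end_boundary e = {x})"
proof -
  interpret hyp_graph V E by unfold_locales fact+
  have "null_boundary_params E v\<^sub>0 \<noteq> {}"
    using zero_in_null_boundary_params[OF \<open>v\<^sub>0 \<in> V\<close>] by blast
  from less_cSupD[OF this \<open>p < p\<^sub>0 E v\<^sub>0\<close>[unfolded p\<^sub>0_def]]
  obtain p' where p': "p' \<in> null_boundary_params E v\<^sub>0" "p < p'" by blast
  \<comment> \<open>Countably many scales suffice, so a single null set serves all clusters, ends
    and pairs of boundary points.\<close>
  have "AE \<omega> in percolation E p. \<forall>k. finite {w \<in> V. \<omega> \<in> far_event p (1 / real (Suc k)) w}"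
    unfolding AE_all_countable
    by (intro allI AE_finitely_many_far[OF \<open>v\<^sub>0 \<in> V\<close> \<open>0 \<le> p\<close> p'(2,1)]) simp
  then show ?thesis
    using AE_space
  proof eventually_elim
    case (elim \<omega>)
    show ?case
    proof (intro ballI allI impI)
      fix v e assume v: "v \<in> V" and end_C: "is_end (cluster E \<omega> v) e"
      have "x = y" if xy: "x \<in> end_boundary e" "y \<in> end_boundary e" for x y
      proof (rule ccontr)
        assume "x \<noteq> y"
        then have "0 < dist x y / 4" by simp
        then obtain k where k: "1 / real (Suc k) < dist x y / 4" using nat_approx_posE by metis
        let ?F = "{w \<in> V. \<omega> \<in> far_event p (1 / real (Suc k)) w}"
        have far: "\<exists>w\<in>V. R < norm w \<and> \<omega> \<in> far_event p (1 / real (Suc k)) w" if "R < 1" for R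
          by (rule two_point_end_imp_far[OF v end_C xy _ _ that elim(2)]) (use k in auto)
        have fin: "finite (norm ` ?F)" using elim(1) by blast
        have ne: "norm ` ?F \<noteq> {}" using far[of 0] by auto
        \<comment> \<open>The largest norm among the finitely many far vertices is below
          \<open>1\<close>; used as the radius \<open>R\<close>, it yields a far vertex still
          further out.\<close>
        have "Max (norm ` ?F) \<in> norm ` ?F" by (rule Max_in[OF fin ne])
        then have "Max (norm ` ?F) < 1" using V_hyp by (auto simp: hyp_iff)
        then obtain w where "w \<in> ?F" "Max (norm ` ?F) < norm w" using far by blast
        moreover have "norm w \<le> Max (norm ` ?F)" using fin \<open>w \<in> ?F\<close> by (intro Max_ge) auto
        ultimately show False by simp
      qed
      moreover obtain x where "x \<in> end_boundary e" using end_boundary_nonempty[OF v end_C] by blast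
      ultimately show "\<exists>x. end_boundary e = {x}" by blast
    qed
  qed
qed

end
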